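(* Suppose that $g(s,x,y)=\tau(s)E(x,y)$, with $\tau:\mathbb R\to\mathbb R$ bounded, measurable and $T$-periodic and $E:\mathcal X\times\mathcal X\to\mathbb R$, and let $E^*(x,y):=E(y,x)$. Then $\psi_s(x)=\tau(s)\big(E^*_{r^*}(x)-E_r(x)\big)$ and the following formulas hold. (1) For every $v:\mathcal X\to\mathbb R$ and $t\ge0$, $$\partial_{\lambda=0}\mathbb E_{\pi_\lambda}[v(X^\lambda_t)]=\int_0^\infty ds\,\tau(t-s)\,\mathbb E_\pi\big[v(X_s)(E^*_{r^*}(X_0)-E_r(X_0))\big].$$ (2) For every $t>0$ and measurable $v:[0,t]\times\mathcal X\to\mathbb R$ with $\int_0^t|v(s,x)|ds<+\infty$ for all $x\in\mathcal X$, $$\partial_{\lambda=0}\mathbb E_{\pi_\lambda}\Big[\int_0^tv(s,X^\lambda_s)ds\Big]=\int_0^tdu\int_0^\infty ds\,\tau(u-s)\,\mathbb E_\pi\big[v(u,X_s)(E^*_{r^*}(X_0)-E_r(X_0))\big].$$ (3) For every $t>0$ and measurable $\alpha:[0,t]\times\mathcal X\times\mathcal X\to\mathbb R$ with $\int_0^t|\alpha|_r(s,x)ds<+\infty$ for all $x\in\mathcal X$, $$\partial_{\lambda=0}\mathbb E_{\pi_\lambda}\Big[\sum_{s\in(0,t]}\alpha(s,X^\lambda_{s-},X^\lambda_s)\Big]=\int_0^t\tau(s)\,\mathbb E_\pi[(\alpha E)_r(s,X_s)]ds+\int_0^tds\int_0^\infty du\,\tau(s-u)\,\mathbb E_\pi\big[\alpha_r(s,X_u)(E^*_{r^*}(X_0)-E_r(X_0))\big].$$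 (4) For every $v:\mathcal X\to\mathbb R$ and $k\in\mathbb Z$, setting $f_\lambda(t):=\mathbb E_{\pi_\lambda}[v(X^\lambda_t)]$ (which is $T$-periodic in $t$), $$\partial_{\lambda=0}c_k(f_\lambda)=\hat\tau_k\int_0^\infty e^{-ik\omega s}\,\mathbb E_\pi\big[v(X_s)(E^*_{r^*}(X_0)-E_r(X_0))\big]ds.$$
   Context: $\mathcal X$ is a finite set and $(X_s)_{s\ge0}$ is the (unperturbed) continuous-time Markov jump process on $\mathcal X$ with transition rates $r(x,y)\ge0$ ($r(x,x)=0$), assumed irreducible; $\pi$ is its unique invariant distribution. $T\in(0,+\infty)$, $\omega:=2\pi/T$ (here $\pi$ is the number). For $\lambda\in\mathbb R$ the perturbed process $(X^\lambda_s)_{s\ge0}$ is the time-inhomogeneous Markov jump process on $\mathcal X$ with transition rates at time $s$ given by $r^\lambda_s(x,y)=e^{\lambda g(s,x,y)}r(x,y)$. The discrete-time chain $(X^\lambda_{nT})_{n\ge0}$ is irreducible and $\pi_\lambda$ denotes its unique invariant distribution; the law of $X^\lambda$ started from $\pi_\lambda$ is the oscillatory steady state. $\mathbb E_{\pi_\lambda}$, $\mathbb E_\pi$ are expectations for initial distribution $\pi_\lambda$, respectively $\pi$. $r^*(x,y):=\pi(y)r(y,x)/\pi(x)$ and $$\psi_s(x):=\sum_{y\in\mathcal X}\big(r^*(x,y)g(s,y,x)-r(x,y)g(s,x,y)\big),\qquad s\in\mathbb R.$$ Contractions: $E_r(x):=\sum_yE(x,y)r(x,y)$, $E^*_{r^*}(x):=\sum_yE^*(x,y)r^*(x,y)$,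 $\alpha_r(s,x):=\sum_y\alpha(s,x,y)r(x,y)$, and similarly for $|\alpha|_r$ and $(\alpha E)_r$. Sums $\sum_{s\in(0,t]}\alpha(s,X^\lambda_{s-},X^\lambda_s)$ run over the jump times $s\in(0,t]$ of $X^\lambda$. For a $T$-periodic integrable $f$, $c_k(f):=\frac1T\int_0^Te^{-ik\omega t}f(t)dt$; $\hat\tau_k:=c_k(\tau)$. $\partial_{\lambda=0}$ is the derivative in $\lambda$ at $\lambda=0$. *)

theory Defs
  imports "HOL-Probability.Probability"
begin

text \<open>The state space is a finite type \<open>'x\<close>. Jump rates are functions \<open>r x y\<close>,
  time-dependent jump rates are functions \<open>q s x y\<close>.\<close>

definition irreducible_rates :: "('x \<Rightarrow> 'x \<Rightarrow> real) \<Rightarrow> bool" where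
  "irreducible_rates r \<longleftrightarrow> (\<forall>x y. (x, y) \<in> {(a, b). r a b > 0}\<^sup>*)"

definition generator :: "('x::finite \<Rightarrow> 'x \<Rightarrow> real) \<Rightarrow> 'x \<Rightarrow> 'x \<Rightarrow> real" where
  "generator r x y = r x y - (if x = y then (\<Sum>z\<in>UNIV. r x z) else 0)"

definition invariant_for_rates :: "('x::finite \<Rightarrow> 'x \<Rightarrow> real) \<Rightarrow> 'x pmf \<Rightarrow> bool" where
  "invariant_for_rates r \<mu> \<longleftrightarrow> (\<forall>y. (\<Sum>x\<in>UNIV. pmf \<mu> x * generator r x y) = 0)"

definition invariant_for_matrix :: "('x::finite \<Rightarrow> 'x \<Rightarrow> real) \<Rightarrow> 'x pmf \<Rightarrow> bool" where
  "invariant_for_matrix K \<mu> \<longleftrightarrow> (\<forall>y. (\<Sum>x\<in>UNIV. pmf \<mu> x * K x y) = pmf \<mu> y)"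

definition perturbed_rate ::
  "('x \<Rightarrow> 'x \<Rightarrow> real) \<Rightarrow> (real \<Rightarrow> 'x \<Rightarrow> 'x \<Rightarrow> real) \<Rightarrow> real \<Rightarrow> real \<Rightarrow> 'x \<Rightarrow> 'x \<Rightarrow> real" where
  "perturbed_rate r g l s x y = exp (l * g s x y) * r x y"

text \<open>\<open>P s t x y\<close> is the probability of being in \<open>y\<close> at time \<open>t\<close> given that the state at time
  \<open>s\<close> is \<open>x\<close>. The rates are only assumed measurable in time, so the infinitesimal relation
  \<open>P s (s + h) = 1 + h L + o(h)\<close> can fail on a null set of times \<open>s\<close>; it is therefore imposed in
  integrated form (Kolmogorov's forward equation), which for bounded rates determines \<open>P\<close>.\<close>

definition transition_function ::
  "(real \<Rightarrow> 'x::finite \<Rightarrow> 'x \<Rightarrow> real) \<Rightarrow> (real \<Rightarrow> real \<Rightarrow> 'x \<Rightarrow> 'x \<Rightarrow> real) \<Rightarrow> bool" where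
  "transition_function q P \<longleftrightarrow>
    (\<forall>s t. 0 \<le> s \<and> s \<le> t \<longrightarrow>
      (\<forall>x y. 0 \<le> P s t x y) \<and>
      (\<forall>x. (\<Sum>y\<in>UNIV. P s t x y) = 1) \<and>
      (\<forall>x y. set_integrable lborel {s..t} (\<lambda>u. \<Sum>z\<in>UNIV. P s u x z * generator (q u) z y) \<and>
             P s t x y = (if x = y then 1 else 0)
               + (LINT u:{s..t}|lborel. (\<Sum>z\<in>UNIV. P s u x z * generator (q u) z y))))"

text \<open>Right-continuity and existence of left limits for the discrete topology on \<open>'x\<close>. On each
  bounded time interval such a path has finitely many jumps. Values at negative times are
  irrelevant.\<close>

definition jump_path :: "(real \<Rightarrow> 'x) \<Rightarrow> bool" where
  "jump_path f \<longleftrightarrow>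
    (\<forall>t\<ge>0. \<forall>\<^sub>F u in at_right t. f u = f t) \<and>
    (\<forall>t>0. \<exists>x. \<forall>\<^sub>F u in at_left t. f u = x)"

definition left_value :: "(real \<Rightarrow> 'x) \<Rightarrow> real \<Rightarrow> 'x" where
  "left_value f s = (THE x. \<forall>\<^sub>F u in at_left s. f u = x)"

definition jump_times :: "(real \<Rightarrow> 'x) \<Rightarrow> real \<Rightarrow> real set" where
  "jump_times f t = {s \<in> {0<..t}. left_value f s \<noteq> f s}"

definition jump_sum :: "(real \<Rightarrow> 'x \<Rightarrow> 'x \<Rightarrow> real) \<Rightarrow> real \<Rightarrow> (real \<Rightarrow> 'x) \<Rightarrow> real" where
  "jump_sum \<alpha> t f = (\<Sum>s\<in>jump_times f t. \<alpha> s (left_value f s) (f s))"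

definition past_events :: "'w measure \<Rightarrow> (real \<Rightarrow> 'w \<Rightarrow> 'x) \<Rightarrow> real \<Rightarrow> 'w set set" where
  "past_events M X s = sigma_sets (space M) {X u -` B \<inter> space M |u B. 0 \<le> u \<and> u \<le> s}"

definition markov_jump_process ::
  "(real \<Rightarrow> 'x::finite \<Rightarrow> 'x \<Rightarrow> real) \<Rightarrow> (real \<Rightarrow> real \<Rightarrow> 'x \<Rightarrow> 'x \<Rightarrow> real) \<Rightarrow> 'x pmf \<Rightarrow>
    'w measure \<Rightarrow> (real \<Rightarrow> 'w \<Rightarrow> 'x) \<Rightarrow> bool" where
  "markov_jump_process q P \<mu> M X \<longleftrightarrow>
    prob_space M \<and>
    transition_function q P \<and>
    (\<forall>t\<ge>0. X t \<in> measurable M (count_space UNIV)) \<and>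
    (\<forall>w\<in>space M. jump_path (\<lambda>t. X t w)) \<and>
    (\<forall>x. measure M {w \<in> space M. X 0 w = x} = pmf \<mu> x) \<and>
    (\<forall>s t x y. \<forall>A \<in> past_events M X s. 0 \<le> s \<and> s \<le> t \<longrightarrow>
      measure M (A \<inter> {w \<in> space M. X s w = x \<and> X t w = y}) =
      measure M (A \<inter> {w \<in> space M. X s w = x}) * P s t x y)"

definition reversed_rate :: "'x pmf \<Rightarrow> ('x \<Rightarrow> 'x \<Rightarrow> real) \<Rightarrow> 'x \<Rightarrow> 'x \<Rightarrow> real" where
  "reversed_rate \<mu> r x y = pmf \<mu> y * r y x / pmf \<mu> x"

definition contraction :: "('x::finite \<Rightarrow> 'x \<Rightarrow> real) \<Rightarrow> ('x \<Rightarrow> 'x \<Rightarrow> real) \<Rightarrow> 'x \<Rightarrow> real" where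
  "contraction r E x = (\<Sum>y\<in>UNIV. E x y * r x y)"

definition response_potential ::
  "'x::finite pmf \<Rightarrow> ('x \<Rightarrow> 'x \<Rightarrow> real) \<Rightarrow> (real \<Rightarrow> 'x \<Rightarrow> 'x \<Rightarrow> real) \<Rightarrow> real \<Rightarrow> 'x \<Rightarrow> real" where
  "response_potential \<mu> r g s x =
    (\<Sum>y\<in>UNIV. reversed_rate \<mu> r x y * g s y x - r x y * g s x y)"

definition fourier_coeff :: "real \<Rightarrow> int \<Rightarrow> (real \<Rightarrow> real) \<Rightarrow> complex" where
  "fourier_coeff T k f =
    (1 / of_real T) *
    (LINT t:{0..T}|lborel. exp (- \<i> * of_int k * of_real (2 * pi / T) * of_real t) * of_real (f t))"

end

theory Submission
  imports Defs
begin

text \<open>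
  The law \<open>p l t\<close> of the perturbed process in its oscillatory steady state solves
  \<open>p' = p A\<close> with \<open>A = L + l \<tau>(t) L' + O(l\<^sup>2)\<close>. Since \<open>p l t = p l (t + n T)\<close>, Duhamel's formula for
  the unperturbed semigroup \<open>S\<close> can be used on \<open>[0, t + n T]\<close> with \<open>n\<close> arbitrarily large. As
  \<open>S\<close> contracts vectors of total mass zero exponentially fast, the initial condition is
  forgotten, and inserting the expansion of \<open>A\<close> twice gives
  \<open>p l t = \<mu> + l \<integral>\<^sub>0\<^sup>\<infinity> \<tau>(t - s) (\<mu> L') S s ds + O(l\<^sup>2)\<close> uniformly in \<open>t \<ge> 0\<close>, where \<open>\<mu> L' = \<mu> \<phi>\<close>.
  All four formulas follow by integrating this expansion, once the expectations are written
  in terms of \<open>p\<close>. For sums over jumps this uses that \<open>x\<rightarrow>y\<close> jumps have intensity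
  \<open>p l s x * q s x y\<close>, obtained for intervals by counting jumps along finer and finer grids.
\<close>

section \<open>Integrals over intervals\<close>

text \<open>Two passes are forced because the first-order term that Duhamel's formula produces
  contains \<open>p l u\<close> in place of the invariant law: the first pass shows that exchanging
  them costs O(l), so that the second leaves only errors of order l^2. Nothing is assumed about how
  \<open>\<nu> l\<close> depends on \<open>l\<close>. The unknown initial law is therefore removed
  for each fixed \<open>l\<close> by letting the number of periods grow, with a remainder
  \<open>2 * K * exp (- \<kappa> * R)\<close> common to all \<open>l\<close>. The perturbation term
  survives this limit because generators have zero row sums: it lies where \<open>S\<close> decays,
  and its integral over [0, R] is bounded independently of \<open>R\<close>. As
  \<open>\<tau>\<close> is merely measurable, laws are differentiable in time only almost
  everywhere. Equations are hence kept in integral form, and Duhamel's formula rests on integration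
  by parts for indefinite integrals. Derivatives in \<open>l\<close> are always read off an explicit
  error \<open>C * l\<^sup>2\<close> with \<open>C\<close> independent of time, which can be
  integrated against any integrable weight.\<close>

lemma set_integrable_sum:
  fixes f :: "'i \<Rightarrow> 'a \<Rightarrow> 'b::{banach, second_countable_topology}"
  assumes "\<And>i. i \<in> I \<Longrightarrow> set_integrable M A (f i)"
  shows "set_integrable M A (\<lambda>x. \<Sum>i\<in>I. f i x)"
  using assms unfolding set_integrable_def by (simp add: scaleR_sum_right)

lemma set_integral_sum:
  fixes f :: "'i \<Rightarrow> 'a \<Rightarrow> 'b::{banach, second_countable_topology}"
  assumes "\<And>i. i \<in> I \<Longrightarrow> set_integrable M A (f i)"
  shows "(LINT x:A|M. (\<Sum>i\<in>I. f i x)) = (\<Sum>i\<in>I. LINT x:A|M. f i x)"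
  using assms unfolding set_integrable_def set_lebesgue_integral_def
  by (simp add: scaleR_sum_right integral_sum)

lemma set_integrable_bounded_mult:
  fixes f h :: "real \<Rightarrow> real"
  assumes "set_integrable lborel A f" "set_borel_measurable lborel A h" "\<And>x. x \<in> A \<Longrightarrow> \<bar>h x\<bar> \<le> B"
  shows "set_integrable lborel A (\<lambda>x. h x * f x)"
proof (rule set_integrable_bound)
  show "set_integrable lborel A (\<lambda>x. B * f x)"
    using assms(1) by simp
  have "(\<lambda>x. (indicator A x *\<^sub>R h x) * (indicator A x *\<^sub>R f x)) \<in> borel_measurable lborel"
    using assms(1,2) unfolding set_integrable_def set_borel_measurable_def
    by (intro borel_measurable_times) auto
  also have "(\<lambda>x. (indicator A x *\<^sub>R h x) * (indicator A x *\<^sub>R f x)) = (\<lambda>x. indicator A x *\<^sub>R (h x * f x))"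
    by (auto simp: indicator_def)
  finally show "set_borel_measurable lborel A (\<lambda>x. h x * f x)"
    by (simp add: set_borel_measurable_def)
  show "AE x in lborel. x \<in> A \<longrightarrow> norm (h x * f x) \<le> norm (B * f x)"
  proof (intro AE_I2 impI)
    fix x assume "x \<in> A"
    from assms(3)[OF this] have "\<bar>h x\<bar> \<le> \<bar>B\<bar>" by linarith
    then show "norm (h x * f x) \<le> norm (B * f x)"
      by (simp add: abs_mult mult_right_mono)
  qed
qed

lemma set_integrable_const_Icc: "set_integrable lborel {a..b::real} (\<lambda>x. c::'a::{banach, second_countable_topology})"
  unfolding set_integrable_def by (intro integrable_scaleR_left) (auto intro!: integrable_real_indicator simp: emeasure_lborel_Icc_eq)

lemma set_integrable_bounded_Icc:
  fixes f :: "real \<Rightarrow> 'a::{banach, second_countable_topology}"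
  assumes "set_borel_measurable lborel {a..b} f" "\<And>x. x \<in> {a..b} \<Longrightarrow> norm (f x) \<le> B"
  shows "set_integrable lborel {a..b} f"
  by (rule set_integrable_bound[OF set_integrable_const_Icc[of a b B] assms(1)])
     (use assms(2) in force)

lemma set_integral_abs_le:
  fixes f :: "real \<Rightarrow> 'a::{banach, second_countable_topology}"
  assumes "set_integrable lborel {a..b} f" "\<And>x. x \<in> {a..b} \<Longrightarrow> norm (f x) \<le> B" "a \<le> b"
  shows "norm (LBINT x:{a..b}. f x) \<le> B * (b - a)"
proof -
  have "norm (LBINT x:{a..b}. f x) \<le> (LBINT x:{a..b}. norm (f x))"
    by (rule set_integral_norm_bound[OF assms(1)])
  also have "\<dots> \<le> (LBINT x:{a..b}. B)"
    by (rule set_integral_mono[OF set_integrable_norm[OF assms(1)] set_integrable_const_Icc assms(2)])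
  also have "\<dots> = B * (b - a)"
    using assms(3) by (subst set_integral_const) auto
  finally show ?thesis .
qed

lemma set_integral_Icc_split:
  fixes f :: "real \<Rightarrow> 'a::{banach, second_countable_topology}"
  assumes "set_integrable lborel {a..c} f" "a \<le> b" "b \<le> c"
  shows "(LBINT x:{a..c}. f x) = (LBINT x:{a..b}. f x) + (LBINT x:{b..c}. f x)"
proof -
  have "{a..c} = {a..b} \<union> {b..c}" using assms by auto
  moreover have "(LINT x:{a..b} \<union> {b..c}|lborel. f x) = (LBINT x:{a..b}. f x) + (LBINT x:{b..c}. f x)"
  proof (rule set_integral_Un_AE)
    have "AE x in lborel. x \<noteq> b" by (rule AE_lborel_singleton)
    then show "AE x in lborel. \<not> (x \<in> {a..b} \<and> x \<in> {b..c})" by eventually_elim auto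
  qed (use assms in \<open>auto intro!: set_integrable_subset[OF assms(1)]\<close>)
  ultimately show ?thesis by simp
qed

text \<open>Translations and reflections of intervals are both instances: for \<open>c = 1\<close>
  and \<open>c = -1\<close> the Jacobian is 1.\<close>

lemma set_integral_affine:
  fixes f :: "real \<Rightarrow> 'a::{banach, second_countable_topology}"
  assumes "\<bar>c\<bar> = 1"
  shows "(LBINT x:A. f x) = (LBINT x:{x. t + c * x \<in> A}. f (t + c * x))"
    and "set_integrable lborel A f \<longleftrightarrow> set_integrable lborel {x. t + c * x \<in> A} (\<lambda>x. f (t + c * x))"
proof -
  have c: "c \<noteq> 0" using assms by auto
  have i: "indicator A (t + c * x) = (indicator {x. t + c * x \<in> A} x :: real)" for x
    by (simp add: indicator_def)
  show "(LBINT x:A. f x) = (LBINT x:{x. t + c * x \<in> A}. f (t + c * x))"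
    unfolding set_lebesgue_integral_def using assms
    by (subst lborel_integral_real_affine[OF c, of _ t]) (simp add: i)
  show "set_integrable lborel A f \<longleftrightarrow> set_integrable lborel {x. t + c * x \<in> A} (\<lambda>x. f (t + c * x))"
    unfolding set_integrable_def
    by (subst lborel_integrable_real_affine_iff[OF c, of _ t, symmetric]) (simp add: i)
qed

lemma set_integral_reflect_Icc:
  fixes f :: "real \<Rightarrow> 'a::{banach, second_countable_topology}"
  shows "(LBINT x:{a..b}. f x) = (LBINT x:{t - b..t - a}. f (t - x))"
    and "set_integrable lborel {a..b} f \<longleftrightarrow> set_integrable lborel {t - b..t - a} (\<lambda>x. f (t - x))"
proof -
  have "{x. t + (-1) * x \<in> {a..b}} = {t - b..t - a}" by auto
  then show "(LBINT x:{a..b}. f x) = (LBINT x:{t - b..t - a}. f (t - x))"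
    "set_integrable lborel {a..b} f \<longleftrightarrow> set_integrable lborel {t - b..t - a} (\<lambda>x. f (t - x))"
    using set_integral_affine[of "-1" "{a..b}" f t] by simp_all
qed

lemma set_integral_shift_Icc:
  fixes f :: "real \<Rightarrow> 'a::{banach, second_countable_topology}"
  shows "(LBINT x:{a..b}. f (x + t)) = (LBINT x:{a + t..b + t}. f x)"
    and "set_integrable lborel {a..b} (\<lambda>x. f (x + t)) \<longleftrightarrow> set_integrable lborel {a + t..b + t} f"
proof -
  have "{x. t + 1 * x \<in> {a + t..b + t}} = {a..b}" by auto
  then show "(LBINT x:{a..b}. f (x + t)) = (LBINT x:{a + t..b + t}. f x)"
    "set_integrable lborel {a..b} (\<lambda>x. f (x + t)) \<longleftrightarrow> set_integrable lborel {a + t..b + t} f"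
    using set_integral_affine[of 1 "{a + t..b + t}" f t] by (simp_all add: add.commute)
qed

lemma periodic_shift_int:
  fixes f :: "real \<Rightarrow> 'a"
  assumes "\<And>s. f (s + T) = f s"
  shows "f (s + of_int n * T) = f s"
proof -
  have nat: "f (s + of_nat k * T) = f s" for k :: nat and s
  proof (induction k)
    case (Suc k)
    have "s + of_nat (Suc k) * T = (s + of_nat k * T) + T" by (simp add: algebra_simps)
    then show ?case using Suc assms by metis
  qed simp
  show ?thesis
  proof (cases "n \<ge> 0")
    case True
    then show ?thesis using nat[of s "nat n"] by simp
  next
    case False
    then show ?thesis using nat[of "s + of_int n * T" "nat (- n)"] by (simp add: algebra_simps)
  qed
qed

text \<open>Whole periods move \<open>c\<close> to a point \<open>c'\<close> of [0, T]. The window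
  from \<open>c'\<close> to \<open>c' + T\<close> is then cut at \<open>T\<close>, and the
  overhanging piece is moved back by one period to \<open>{0..c'}\<close>.\<close>

lemma set_integral_periodic:
  fixes f :: "real \<Rightarrow> 'a::{banach, second_countable_topology}"
  assumes f: "f \<in> borel_measurable borel" "\<And>x. norm (f x) \<le> B"
    and T: "T > 0" "\<And>s. f (s + T) = f s"
  shows "(LBINT x:{c..c + T}. f x) = (LBINT x:{0..T}. f x)"
proof -
  define n where "n = \<lfloor>c / T\<rfloor>"
  define c' where "c' = c - of_int n * T"
  have c': "0 \<le> c'" "c' \<le> T"
    using T floor_divide_lower[of T c] floor_divide_upper[of T c]
    by (auto simp: c'_def n_def field_simps)
  have int: "set_integrable lborel {a..b} f" for a b
    using f by (intro set_integrable_bounded_Icc[of _ _ _ B]) (auto simp: set_borel_measurable_def)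
  have "(LBINT x:{c'..c' + T}. f x) = (LBINT x:{c'..c' + T}. f (x + of_int n * T))"
    using T by (simp add: periodic_shift_int)
  also have "\<dots> = (LBINT x:{c..c + T}. f x)"
    by (subst set_integral_shift_Icc) (simp add: c'_def algebra_simps)
  finally have "(LBINT x:{c..c + T}. f x) = (LBINT x:{c'..c' + T}. f x)" by simp
  also have "\<dots> = (LBINT x:{c'..T}. f x) + (LBINT x:{0 + T..c' + T}. f x)"
    using c' by (subst set_integral_Icc_split[OF int, of _ T]) auto
  also have "(LBINT x:{0 + T..c' + T}. f x) = (LBINT x:{0..c'}. f x)"
    by (subst set_integral_shift_Icc[symmetric]) (simp add: T)
  also have "(LBINT x:{c'..T}. f x) + (LBINT x:{0..c'}. f x) = (LBINT x:{0..T}. f x)"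
    using c' by (subst set_integral_Icc_split[OF int, of 0 c' T]) auto
  finally show ?thesis .
qed

lemma continuous_on_set_integral:
  fixes f :: "real \<Rightarrow> real"
  assumes "set_integrable lborel {a..b} f"
  shows "continuous_on {a..b} (\<lambda>x. LBINT u:{a..x}. f u)"
proof -
  have "continuous_on {a..b} (\<lambda>x. integral {a..x} f)"
    by (rule indefinite_integral_continuous_1[OF set_borel_integral_eq_integral(1)[OF assms]])
  moreover have "integral {a..x} f = (LBINT u:{a..x}. f u)" if "x \<in> {a..b}" for x
    by (rule set_borel_integral_eq_integral(2)[symmetric])
       (rule set_integrable_subset[OF assms], use that in auto)
  ultimately show ?thesis by (auto cong: continuous_on_cong_simp)
qed

text \<open>The densities \<open>f\<close> and \<open>g\<close> may be discontinuous, so the proof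
  goes through Fubini. The product of the increments is the integral of \<open>f u * g s\<close>
  over the square. The square is cut along its diagonal, and the inner integration over each
  triangle leaves \<open>G b - G u\<close>, respectively \<open>F b - F s\<close>.\<close>

lemma set_integral_by_parts:
  fixes f g F G :: "real \<Rightarrow> real"
  assumes f: "set_integrable lborel {a..b} f" and g: "set_integrable lborel {a..b} g"
    and F: "\<And>u. u \<in> {a..b} \<Longrightarrow> F u = F a + (LBINT s:{a..u}. f s)"
    and G: "\<And>u. u \<in> {a..b} \<Longrightarrow> G u = G a + (LBINT s:{a..u}. g s)"
    and ab: "a \<le> b"
  shows "set_integrable lborel {a..b} (\<lambda>u. f u * G u)"
    and "set_integrable lborel {a..b} (\<lambda>u. F u * g u)"
    and "F b * G b - F a * G a = (LBINT u:{a..b}. f u * G u) + (LBINT u:{a..b}. F u * g u)"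
proof -
  define f' g' where "f' = (\<lambda>u. indicator {a..b} u * f u)" and "g' = (\<lambda>u. indicator {a..b} u * g u)"
  have [measurable]: "f' \<in> borel_measurable borel" "g' \<in> borel_measurable borel"
    using f g by (auto simp: set_integrable_def f'_def g'_def dest: borel_measurable_integrable)
  have f': "integrable lborel f'" and g': "integrable lborel g'"
    using f g by (simp_all add: set_integrable_def f'_def g'_def)
  have contG: "continuous_on {a..b} G" and contF: "continuous_on {a..b} F"
  proof -
    have "continuous_on {a..b} (\<lambda>u. G a + (LBINT s:{a..u}. g s))"
      "continuous_on {a..b} (\<lambda>u. F a + (LBINT s:{a..u}. f s))"
      by (intro continuous_intros continuous_on_set_integral f g)+
    then show "continuous_on {a..b} G" "continuous_on {a..b} F"
      by (metis (no_types, lifting) continuous_on_cong F G)+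
  qed
  have bd: "\<exists>B. \<forall>x\<in>{a..b}. \<bar>H x\<bar> \<le> B" if "continuous_on {a..b} H" for H :: "real \<Rightarrow> real"
    using compact_imp_bounded[OF compact_continuous_image[OF that compact_Icc]]
    by (auto simp: bounded_iff)
  obtain BG BF where BG: "\<And>x. x \<in> {a..b} \<Longrightarrow> \<bar>G x\<bar> \<le> BG" and BF: "\<And>x. x \<in> {a..b} \<Longrightarrow> \<bar>F x\<bar> \<le> BF"
    using bd[OF contG] bd[OF contF] by blast
  have mG: "set_borel_measurable lborel {a..b} G" and mF: "set_borel_measurable lborel {a..b} F"
    using borel_measurable_continuous_on_indicator[OF _ contG] borel_measurable_continuous_on_indicator[OF _ contF]
    by (auto simp: set_borel_measurable_def)
  show i1: "set_integrable lborel {a..b} (\<lambda>u. f u * G u)"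
    using set_integrable_bounded_mult[OF f mG BG] by (simp add: mult.commute)
  show i2: "set_integrable lborel {a..b} (\<lambda>u. F u * g u)"
    using set_integrable_bounded_mult[OF g mF BF] by simp
  have [measurable]: "Measurable.pred (borel \<Otimes>\<^sub>M borel) (\<lambda>x. fst x \<le> (snd x :: real))"
    by measurable
  have prod: "integrable (lborel \<Otimes>\<^sub>M lborel) (\<lambda>(u, s). f' u * g' s)"
    using f' g' by (intro lborel_pair.Fubini_integrable) (auto simp: abs_mult)
  have p1: "integrable (lborel \<Otimes>\<^sub>M lborel) (\<lambda>(u, s). f' u * g' s * indicator {z. fst z \<le> snd z} (u, s))"
    by (rule Bochner_Integration.integrable_bound[OF prod]) (auto split: split_indicator)
  have p2: "integrable (lborel \<Otimes>\<^sub>M lborel) (\<lambda>(u, s). f' u * g' s * indicator {z. snd z < fst z} (u, s))"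
    by (rule Bochner_Integration.integrable_bound[OF prod]) (auto split: split_indicator)
  have "(F b - F a) * (G b - G a) = (\<integral>u. f' u \<partial>lborel) * (\<integral>s. g' s \<partial>lborel)"
    using F[of b] G[of b] ab by (simp add: f'_def g'_def set_lebesgue_integral_def)
  also have "\<dots> = (\<integral>u. (\<integral>s. f' u * g' s \<partial>lborel) \<partial>lborel)"
    by simp
  also have "\<dots> = integral\<^sup>L (lborel \<Otimes>\<^sub>M lborel) (\<lambda>(u, s). f' u * g' s)"
    using lborel_pair.integral_fst[OF prod] by simp
  also have "(\<lambda>(u, s). f' u * g' s) = (\<lambda>z. (\<lambda>(u, s). f' u * g' s * indicator {z. fst z \<le> snd z} (u, s)) z
      + (\<lambda>(u, s). f' u * g' s * indicator {z. snd z < fst z} (u, s)) z)"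
    by (auto simp: fun_eq_iff indicator_def)
  also have "integral\<^sup>L (lborel \<Otimes>\<^sub>M lborel) \<dots> =
      integral\<^sup>L (lborel \<Otimes>\<^sub>M lborel) (\<lambda>(u, s). f' u * g' s * indicator {z. fst z \<le> snd z} (u, s))
      + integral\<^sup>L (lborel \<Otimes>\<^sub>M lborel) (\<lambda>(u, s). f' u * g' s * indicator {z. snd z < fst z} (u, s))"
    by (rule Bochner_Integration.integral_add[OF p1 p2])
  also have "\<dots> = (\<integral>u. (\<integral>s. f' u * g' s * indicator {z. fst z \<le> snd z} (u, s) \<partial>lborel) \<partial>lborel)
      + (\<integral>s. (\<integral>u. f' u * g' s * indicator {z. snd z < fst z} (u, s) \<partial>lborel) \<partial>lborel)"
    using lborel_pair.integral_fst[OF p1] lborel_pair.integral_snd[OF p2] by simp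
  also have "(\<integral>u. (\<integral>s. f' u * g' s * indicator {z. fst z \<le> snd z} (u, s) \<partial>lborel) \<partial>lborel)
      = (\<integral>u. indicator {a..b} u * (f u * (G b - G u)) \<partial>lborel)"
  proof (rule Bochner_Integration.integral_cong[OF refl])
    fix u :: real
    show "(\<integral>s. f' u * g' s * indicator {z. fst z \<le> snd z} (u, s) \<partial>lborel) = indicator {a..b} u * (f u * (G b - G u))"
    proof (cases "u \<in> {a..b}")
      case True
      have "(\<integral>s. f' u * g' s * indicator {z. fst z \<le> snd z} (u, s) \<partial>lborel) = (\<integral>s. f u * (indicator {u..b} s * g s) \<partial>lborel)"
        using True by (intro Bochner_Integration.integral_cong[OF refl]) (auto simp: f'_def g'_def indicator_def)
      also have "\<dots> = f u * (LBINT s:{u..b}. g s)"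
        by (simp add: set_lebesgue_integral_def)
      also have "(LBINT s:{u..b}. g s) = G b - G u"
        using G[OF True] G[of b] ab set_integral_Icc_split[OF g, of u] True by simp
      finally show ?thesis using True by simp
    qed (simp add: f'_def)
  qed
  also have "\<dots> = (LBINT u:{a..b}. f u * G b - f u * G u)"
    by (simp add: set_lebesgue_integral_def algebra_simps)
  also have "\<dots> = (F b - F a) * G b - (LBINT u:{a..b}. f u * G u)"
    using F[of b] ab f by (subst set_integral_diff(2)[OF _ i1]) auto
  also have "(\<integral>s. (\<integral>u. f' u * g' s * indicator {z. snd z < fst z} (u, s) \<partial>lborel) \<partial>lborel)
      = (\<integral>s. indicator {a..b} s * ((F b - F s) * g s) \<partial>lborel)"
  proof (rule Bochner_Integration.integral_cong[OF refl])
    fix s :: real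
    show "(\<integral>u. f' u * g' s * indicator {z. snd z < fst z} (u, s) \<partial>lborel) = indicator {a..b} s * ((F b - F s) * g s)"
    proof (cases "s \<in> {a..b}")
      case True
      have "(\<integral>u. f' u * g' s * indicator {z. snd z < fst z} (u, s) \<partial>lborel) = (\<integral>u. g s * (indicator {s..b} u * f u) \<partial>lborel)"
      proof (rule integral_cong_AE)
        \<comment> \<open>The strict triangle has the slice \<open>s < u\<close>, which differs from
          \<open>{s..b}\<close> by the point \<open>s\<close> alone.\<close>
        have "AE x in lborel. x \<noteq> s" by (rule AE_lborel_singleton)
        then show "AE u in lborel. f' u * g' s * indicator {z. snd z < fst z} (u, s) = g s * (indicator {s..b} u * f u)"
          by eventually_elim (use True in \<open>auto simp: f'_def g'_def indicator_def\<close>)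
        have "(\<lambda>u. g s * (indicator {s..b} u * f u)) = (\<lambda>u. g s * (indicator {s..b} u * f' u))"
          using True by (auto simp: f'_def indicator_def)
        then show "(\<lambda>u. g s * (indicator {s..b} u * f u)) \<in> borel_measurable lborel" by simp
      qed measurable
      also have "\<dots> = g s * (LBINT u:{s..b}. f u)"
        by (simp add: set_lebesgue_integral_def)
      also have "(LBINT u:{s..b}. f u) = F b - F s"
        using F[OF True] F[of b] ab set_integral_Icc_split[OF f, of s] True by simp
      finally show ?thesis using True by simp
    qed (simp add: g'_def)
  qed
  also have "\<dots> = (LBINT s:{a..b}. F b * g s - F s * g s)"
    by (simp add: set_lebesgue_integral_def algebra_simps)
  also have "\<dots> = F b * (G b - G a) - (LBINT u:{a..b}. F u * g u)"
    using G[of b] ab g by (subst set_integral_diff(2)[OF _ i2]) auto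
  finally show "F b * G b - F a * G a = (LBINT u:{a..b}. f u * G u) + (LBINT u:{a..b}. F u * g u)"
    by (simp add: algebra_simps)
qed

text \<open>At \<open>l = 0\<close> the hypothesis forces \<open>f 0 = a\<close>, so it is a Taylor
  expansion whose remainder is o(l).\<close>

lemma has_vector_derivative_quadratic:
  fixes f :: "real \<Rightarrow> 'a::real_normed_vector"
  assumes "\<And>l. \<bar>l\<bar> \<le> 1 \<Longrightarrow> norm (f l - a - l *\<^sub>R D) \<le> C * l\<^sup>2"
  shows "(f has_vector_derivative D) (at 0)"
  unfolding has_vector_derivative_def has_derivative_at_alt
proof (intro conjI allI impI)
  show "bounded_linear (\<lambda>x. x *\<^sub>R D)" by (rule bounded_linear_scaleR_left)
  fix e :: real assume e: "e > 0"
  have f0: "f 0 = a" using assms[of 0] by simp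
  \<comment> \<open>Adding 1 keeps the denominator positive when \<open>C = 0\<close>.\<close>
  define d where "d = min 1 (e / (\<bar>C\<bar> + 1))"
  have "d > 0" using e by (simp add: d_def)
  moreover have "norm (f y - f 0 - (y - 0) *\<^sub>R D) \<le> e * norm (y - 0)" if "norm (y - 0) < d" for y
  proof -
    have y: "\<bar>y\<bar> < 1" "\<bar>y\<bar> < e / (\<bar>C\<bar> + 1)" using that by (auto simp: d_def)
    have "norm (f y - f 0 - (y - 0) *\<^sub>R D) \<le> C * y\<^sup>2" using assms[of y] y f0 by simp
    also have "\<dots> \<le> (\<bar>C\<bar> + 1) * \<bar>y\<bar> * \<bar>y\<bar>"
      by (simp add: power2_eq_square mult_right_mono flip: mult.assoc abs_mult)
         (metis abs_ge_self abs_mult_self_eq add_increasing2 le_less mult.assoc mult_right_mono zero_le_square zero_less_one)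
    also have "\<dots> \<le> e * \<bar>y\<bar>"
      using y by (intro mult_right_mono) (auto simp: field_simps)
    finally show ?thesis by simp
  qed
  ultimately show "\<exists>d>0. \<forall>y. norm (y - 0) < d \<longrightarrow> norm (f y - f 0 - (y - 0) *\<^sub>R D) \<le> e * norm (y - 0)"
    by blast
qed

section \<open>Linear integral equations\<close>

definition row_mult :: "('x::finite \<Rightarrow> real) \<Rightarrow> ('x \<Rightarrow> 'x \<Rightarrow> real) \<Rightarrow> 'x \<Rightarrow> real" where
  "row_mult w B y = (\<Sum>x\<in>UNIV. w x * B x y)"

text \<open>For rows this norm fits Markov semigroups: the operator norm of a matrix is the largest
  l1 norm of its rows, so stochastic matrices do not expand it.\<close>

definition l1_norm :: "('x::finite \<Rightarrow> real) \<Rightarrow> real" where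
  "l1_norm w = (\<Sum>x\<in>UNIV. \<bar>w x\<bar>)"

lemma l1_norm_nonneg [simp]: "0 \<le> l1_norm w"
  by (simp add: l1_norm_def sum_nonneg)

lemma abs_le_l1_norm: "\<bar>w x\<bar> \<le> l1_norm w"
  unfolding l1_norm_def by (rule member_le_sum) auto

lemma l1_norm_triangle: "l1_norm (\<lambda>x. v x + w x) \<le> l1_norm v + l1_norm w"
  unfolding l1_norm_def by (simp add: sum.distrib[symmetric] sum_mono abs_triangle_ineq)

lemma l1_norm_scale: "l1_norm (\<lambda>x. c * w x) = \<bar>c\<bar> * l1_norm w"
  unfolding l1_norm_def by (simp add: abs_mult flip: sum_distrib_left)

lemma l1_norm_row_mult_le:
  assumes "\<And>x. l1_norm (B x) \<le> c"
  shows "l1_norm (row_mult w B) \<le> c * l1_norm w"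
proof -
  have "l1_norm (row_mult w B) \<le> (\<Sum>y\<in>UNIV. \<Sum>x\<in>UNIV. \<bar>w x\<bar> * \<bar>B x y\<bar>)"
    unfolding l1_norm_def row_mult_def
    by (intro sum_mono order_trans[OF sum_abs]) (simp add: abs_mult)
  also have "\<dots> = (\<Sum>x\<in>UNIV. \<bar>w x\<bar> * l1_norm (B x))"
    by (subst sum.swap) (simp add: l1_norm_def sum_distrib_left)
  also have "\<dots> \<le> (\<Sum>x\<in>UNIV. \<bar>w x\<bar> * c)"
    by (intro sum_mono mult_left_mono assms) auto
  also have "\<dots> = c * l1_norm w" by (simp add: l1_norm_def sum_distrib_left mult.commute)
  finally show ?thesis .
qed

lemma row_mult_assoc: "row_mult (row_mult w A) B y = row_mult w (\<lambda>x. row_mult (A x) B) y"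
  unfolding row_mult_def
  by (simp add: sum_distrib_left sum_distrib_right mult.assoc) (rule sum.swap)

lemma sum_row_mult: "(\<Sum>y\<in>UNIV. row_mult w B y) = (\<Sum>x\<in>UNIV. w x * (\<Sum>y\<in>UNIV. B x y))"
  unfolding row_mult_def by (subst sum.swap) (simp add: sum_distrib_left)

lemma row_mult_sum_left:
  "row_mult (\<lambda>z. \<Sum>i\<in>I. c i * w i z) B y = (\<Sum>i\<in>I. c i * row_mult (w i) B y)"
  unfolding row_mult_def
  by (simp add: sum_distrib_left sum_distrib_right mult.assoc) (rule sum.swap)

lemma row_mult_diff_left: "row_mult (\<lambda>x. v x - w x) B y = row_mult v B y - row_mult w B y"
  unfolding row_mult_def by (simp add: sum_subtractf algebra_simps)

lemma row_mult_diff_right: "row_mult v (\<lambda>x y. A x y - B x y) y = row_mult v A y - row_mult v B y"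
  unfolding row_mult_def by (simp add: sum_subtractf algebra_simps)

lemma row_mult_scale_left: "row_mult (\<lambda>x. c * w x) B y = c * row_mult w B y"
  unfolding row_mult_def by (simp add: sum_distrib_left mult.assoc)

lemma row_mult_delta [simp]: "row_mult (\<lambda>z. if x = z then 1 else 0) B y = B x y"
  unfolding row_mult_def by (simp add: if_distrib[of "\<lambda>a. a * _"] cong: if_cong)

lemma sum_generator [simp]: "(\<Sum>y\<in>UNIV. generator q x y) = 0"
  unfolding generator_def by (simp add: sum_subtractf)

lemma l1_norm_generator_le: "l1_norm (generator q x) \<le> 2 * l1_norm (q x)"
proof -
  have "l1_norm (generator q x) \<le> (\<Sum>y\<in>UNIV. \<bar>q x y\<bar> + (if x = y then \<bar>\<Sum>z\<in>UNIV. q x z\<bar> else 0))"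
    unfolding l1_norm_def generator_def by (intro sum_mono) auto
  also have "\<dots> = l1_norm (q x) + \<bar>\<Sum>z\<in>UNIV. q x z\<bar>"
    by (simp add: sum.distrib l1_norm_def)
  also have "\<dots> \<le> 2 * l1_norm (q x)"
    using sum_abs[of "q x" UNIV] by (simp add: l1_norm_def)
  finally show ?thesis .
qed

lemma set_integral_Icc_refl [simp]:
  fixes f :: "real \<Rightarrow> 'a::{banach, second_countable_topology}"
  shows "(LBINT x:{a..a}. f x) = 0"
proof -
  have "AE x in lborel. x \<noteq> a" by (rule AE_lborel_singleton)
  then have "AE x in lborel. indicator {a..a} x *\<^sub>R f x = 0"
    by eventually_elim auto
  then show ?thesis unfolding set_lebesgue_integral_def by (rule integral_eq_zero_AE)
qed

lemma set_integral_exp_Icc: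
  fixes c :: real
  assumes "c \<noteq> 0" "0 \<le> t"
  shows "set_integrable lborel {0..t} (\<lambda>u. exp (c * u))"
    and "(LBINT u:{0..t}. exp (c * u)) = (exp (c * t) - 1) / c"
proof -
  show i: "set_integrable lborel {0..t} (\<lambda>u. exp (c * u))"
    by (rule borel_integrable_atLeastAtMost') (intro continuous_intros)
  have "((\<lambda>u. exp (c * u)) has_integral exp (c * t) / c - exp (c * 0) / c) {0..t}"
    using assms
    by (intro fundamental_theorem_of_calculus) (auto intro!: derivative_eq_intros simp flip: has_real_derivative_iff_has_vector_derivative)
  then show "(LBINT u:{0..t}. exp (c * u)) = (exp (c * t) - 1) / c"
    using set_borel_integral_eq_integral(2)[OF i] by (simp add: integral_unique diff_divide_distrib)
qed

lemma set_integrable_exp_Ici: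
  fixes c :: real
  assumes "c > 0"
  shows "set_integrable lborel {0..} (\<lambda>u. exp (- c * u))"
proof -
  have "(\<integral>\<^sup>+ x. ennreal (exp (- c * x)) * indicator {0..} x \<partial>lborel) = ennreal (0 - (- exp (- c * 0) / c))"
  proof (rule nn_integral_FTC_atLeast)
    show "((\<lambda>x. - exp (- c * x) / c) \<longlongrightarrow> 0) at_top"
      using assms filterlim_tendsto_neg_mult_at_bot[OF tendsto_const[of "- c"] _ filterlim_ident]
      by (auto intro!: tendsto_divide_zero tendsto_minus_cancel_left[THEN iffD1] filterlim_compose[OF exp_at_bot])
    show "((\<lambda>x. - exp (- c * x) / c) has_real_derivative exp (- c * x)) (at x)" for x
      using assms by (auto intro!: derivative_eq_intros)
  qed auto
  moreover have "ennreal (norm (indicator {0..} x * exp (- c * x))) = ennreal (exp (- c * x)) * indicator {0..} x" for x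
    by (simp add: indicator_def)
  ultimately have "(\<integral>\<^sup>+ x. ennreal (norm (indicator {0..} x * exp (- c * x))) \<partial>lborel) < \<infinity>"
    by simp
  then show ?thesis
    unfolding set_integrable_def by (intro integrableI_bounded) auto
qed

lemma continuous_on_Ici:
  fixes f :: "real \<Rightarrow> 'a::topological_space"
  assumes "\<And>R. continuous_on {a..R} f"
  shows "continuous_on {a..} f"
  unfolding continuous_on_def
proof
  fix x assume x: "x \<in> {a..}"
  have "at x within {a..} = at x within {a..x + 1}"
    by (rule at_within_nhd[of _ "{..<x + 1}"]) auto
  then show "(f \<longlongrightarrow> f x) (at x within {a..})"
    using assms[of "x + 1"] x by (auto simp: continuous_on_def)
qed

text \<open>Solutions of \<open>w' = w A\<close> in the sense of Caratheodory, since
  \<open>A\<close> is only measurable in time. Integrability is part of the definition because the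
  integral of a non-integrable function is 0 by convention, which would turn the equation into
  \<open>w t y = w 0 y\<close>.\<close>

definition linear_flow :: "(real \<Rightarrow> 'x::finite \<Rightarrow> 'x \<Rightarrow> real) \<Rightarrow> (real \<Rightarrow> 'x \<Rightarrow> real) \<Rightarrow> bool" where
  "linear_flow A w \<longleftrightarrow> (\<forall>t\<ge>0. \<forall>y. set_integrable lborel {0..t} (\<lambda>u. row_mult (w u) (A u) y) \<and>
     w t y = w 0 y + (LBINT u:{0..t}. row_mult (w u) (A u) y))"

lemma linear_flow_integrable:
  assumes "linear_flow A w" "0 \<le> a"
  shows "set_integrable lborel {a..b} (\<lambda>u. row_mult (w u) (A u) y)"
proof (cases "a \<le> b")
  case True
  then have "0 \<le> b" using assms(2) by simp
  then have "set_integrable lborel {0..b} (\<lambda>u. row_mult (w u) (A u) y)"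
    using assms(1) unfolding linear_flow_def by blast
  then show ?thesis
    by (rule set_integrable_subset) (use assms(2) in auto)
qed simp

lemma linear_flow_eq:
  assumes "linear_flow A w" "0 \<le> t"
  shows "w t y = w 0 y + (LBINT u:{0..t}. row_mult (w u) (A u) y)"
  using assms unfolding linear_flow_def by blast

lemma linear_flow_increment:
  assumes "linear_flow A w" "0 \<le> s" "s \<le> t"
  shows "w t y = w s y + (LBINT u:{s..t}. row_mult (w u) (A u) y)"
  using linear_flow_eq[OF assms(1,2), of y] linear_flow_eq[OF assms(1), of t y] assms(2,3)
    set_integral_Icc_split[OF linear_flow_integrable[OF assms(1), of 0 t y], of s]
  by linarith

lemma linear_flow_continuous:
  assumes "linear_flow A w"
  shows "continuous_on {0..} (\<lambda>t. w t y)"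
proof (rule continuous_on_Ici)
  fix R
  have "continuous_on {0..R} (\<lambda>t. w 0 y + (LBINT u:{0..t}. row_mult (w u) (A u) y))"
    by (intro continuous_intros continuous_on_set_integral linear_flow_integrable[OF assms]) simp
  moreover have "w 0 y + (LBINT u:{0..t}. row_mult (w u) (A u) y) = w t y" if "t \<in> {0..R}" for t
    using linear_flow_eq[OF assms, of t y] that by simp
  ultimately show "continuous_on {0..R} (\<lambda>t. w t y)" by (rule continuous_on_eq)
qed

lemma linear_flow_measurable:
  assumes "linear_flow A w"
  shows "(\<lambda>t. indicator {0..} t * w t y) \<in> borel_measurable borel"
  using borel_measurable_continuous_on_indicator[OF _ linear_flow_continuous[OF assms, of y]] by simp

lemma linear_flow_set_measurable:
  assumes "linear_flow A w" "0 \<le> a"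
  shows "set_borel_measurable lborel {a..b} (\<lambda>t. w t y)"
proof -
  have "(\<lambda>t. indicator {a..b} t * (indicator {0..} t * w t y)) \<in> borel_measurable borel"
    by (intro borel_measurable_times linear_flow_measurable[OF assms(1)]) auto
  also have "(\<lambda>t. indicator {a..b} t * (indicator {0..} t * w t y)) = (\<lambda>t. indicator {a..b} t * w t y)"
    using assms(2) by (auto simp: indicator_def)
  finally show ?thesis by (simp add: set_borel_measurable_def)
qed

lemma linear_flow_shift:
  assumes "linear_flow A w" "0 \<le> s"
  shows "linear_flow (\<lambda>u. A (u + s)) (\<lambda>u. w (u + s))"
  unfolding linear_flow_def
proof (intro allI impI conjI)
  fix t :: real and y assume t: "0 \<le> t"
  show "set_integrable lborel {0..t} (\<lambda>u. row_mult (w (u + s)) (A (u + s)) y)"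
    by (subst set_integral_shift_Icc(2)[of _ _ "\<lambda>u. row_mult (w u) (A u) y"])
       (use linear_flow_integrable[OF assms(1)] assms(2) in auto)
  show "w (t + s) y = w (0 + s) y + (LBINT u:{0..t}. row_mult (w (u + s)) (A (u + s)) y)"
    by (subst set_integral_shift_Icc(1)[of _ _ "\<lambda>u. row_mult (w u) (A u) y"])
       (use linear_flow_increment[OF assms(1,2), of "t + s" y] t in auto)
qed

lemma linear_flow_sum:
  assumes "\<And>i. i \<in> I \<Longrightarrow> linear_flow A (w i)"
  shows "linear_flow A (\<lambda>t y. \<Sum>i\<in>I. c i * w i t y)"
  unfolding linear_flow_def row_mult_sum_left
proof (intro allI impI conjI)
  fix t :: real and y assume t: "0 \<le> t"
  have i: "set_integrable lborel {0..t} (\<lambda>u. c i * row_mult (w i u) (A u) y)" if "i \<in> I" for i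
    using linear_flow_integrable[OF assms[OF that], of 0 t y] by simp
  then show "set_integrable lborel {0..t} (\<lambda>u. \<Sum>i\<in>I. c i * row_mult (w i u) (A u) y)"
    by (rule set_integrable_sum)
  have "(\<Sum>i\<in>I. c i * w i t y) = (\<Sum>i\<in>I. c i * (w i 0 y + (LBINT u:{0..t}. row_mult (w i u) (A u) y)))"
    by (intro sum.cong refl arg_cong2[of _ _ _ _ "(*)"] linear_flow_eq assms t)
  then show "(\<Sum>i\<in>I. c i * w i t y) = (\<Sum>i\<in>I. c i * w i 0 y) + (LBINT u:{0..t}. \<Sum>i\<in>I. c i * row_mult (w i u) (A u) y)"
    using i by (simp add: set_integral_sum distrib_left sum.distrib)
qed

lemma linear_flow_diff:
  assumes "linear_flow A v" "linear_flow A w"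
  shows "linear_flow A (\<lambda>t y. v t y - w t y)"
proof -
  have "linear_flow A (\<lambda>t y. \<Sum>b\<in>UNIV. (if b then 1 else - 1) * (if b then v else w) t y)"
    by (rule linear_flow_sum) (use assms in auto)
  then show ?thesis by (simp add: UNIV_bool)
qed

text \<open>Gronwall's argument: the maximum of the weighted norm \<open>exp (- c t) * l1_norm (w t)\<close> over
  a compact interval is at most half of itself once \<open>c\<close> is large.\<close>

lemma linear_flow_eq_0:
  assumes flow: "linear_flow A w" and bound: "\<And>u x. 0 \<le> u \<Longrightarrow> l1_norm (A u x) \<le> K"
    and init: "\<And>y. w 0 y = 0" and t: "0 \<le> t"
  shows "w t y = 0"
proof -
  define n where "n = real CARD('a)"
  \<comment> \<open>The factor \<open>n\<close> is lost in passing from a bound on entries to the l1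
    norm; adding 1 keeps \<open>c\<close> positive when \<open>K = 0\<close>.\<close>
  define c where "c = 2 * n * \<bar>K\<bar> + 1"
  have c: "c > 0" "n * \<bar>K\<bar> / c \<le> 1/2" by (simp_all add: c_def n_def divide_simps add_nonneg_pos)
  define h where "h s = exp (- c * s) * l1_norm (w s)" for s
  have "continuous_on {0..t} h"
    unfolding h_def l1_norm_def
    by (intro continuous_intros continuous_on_subset[OF linear_flow_continuous[OF flow]]) auto
  then obtain t0 where t0: "t0 \<in> {0..t}" "\<And>s. s \<in> {0..t} \<Longrightarrow> h s \<le> h t0"
    using continuous_attains_sup[of "{0..t}" h] t by auto
  have l1: "l1_norm (w s) \<le> h t0 * exp (c * s)" if "s \<in> {0..t}" for s
    using t0(2)[OF that] by (simp add: h_def exp_minus field_simps)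
  have h0: "0 \<le> h t0" by (simp add: h_def)
  have "\<bar>w t0 z\<bar> \<le> \<bar>K\<bar> * h t0 * exp (c * t0) / c" for z
  proof -
    have "\<bar>w t0 z\<bar> = norm (LBINT u:{0..t0}. row_mult (w u) (A u) z)"
      using linear_flow_eq[OF flow, of t0 z] t0 init[of z] by simp
    also have "\<dots> \<le> (LBINT u:{0..t0}. norm (row_mult (w u) (A u) z))"
      by (rule set_integral_norm_bound[OF linear_flow_integrable[OF flow]]) simp
    also have "\<dots> \<le> (LBINT u:{0..t0}. \<bar>K\<bar> * h t0 * exp (c * u))"
    proof (rule set_integral_mono)
      show "set_integrable lborel {0..t0} (\<lambda>u. norm (row_mult (w u) (A u) z))"
        by (rule set_integrable_norm[OF linear_flow_integrable[OF flow]]) simp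
      show "set_integrable lborel {0..t0} (\<lambda>u. \<bar>K\<bar> * h t0 * exp (c * u))"
        using set_integral_exp_Icc(1)[of c t0] c t0 by simp
      fix u assume u: "u \<in> {0..t0}"
      have "norm (row_mult (w u) (A u) z) \<le> l1_norm (row_mult (w u) (A u))"
        using abs_le_l1_norm by simp
      also have "\<dots> \<le> \<bar>K\<bar> * l1_norm (w u)"
        by (rule l1_norm_row_mult_le) (use order_trans[OF bound[of u] abs_ge_self] u in auto)
      also have "\<dots> \<le> \<bar>K\<bar> * (h t0 * exp (c * u))"
        using u t0 by (intro mult_left_mono l1) auto
      finally show "norm (row_mult (w u) (A u) z) \<le> \<bar>K\<bar> * h t0 * exp (c * u)" by simp
    qed
    also have "\<dots> = \<bar>K\<bar> * h t0 * ((exp (c * t0) - 1) / c)"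
      using set_integral_exp_Icc(2)[of c t0] c t0 by simp
    also have "\<dots> \<le> \<bar>K\<bar> * h t0 * (exp (c * t0) / c)"
      using c h0 by (intro mult_left_mono divide_right_mono) auto
    finally show ?thesis by simp
  qed
  then have "l1_norm (w t0) \<le> n * (\<bar>K\<bar> * h t0 * exp (c * t0) / c)"
    unfolding l1_norm_def n_def by (metis sum_bounded_above)
  then have "h t0 \<le> n * \<bar>K\<bar> / c * h t0"
    by (simp add: h_def[of t0] exp_minus field_simps)
  also have "\<dots> \<le> 1/2 * h t0" using c h0 by (intro mult_right_mono) auto
  finally have "h t0 = 0" using h0 by simp
  then have "l1_norm (w t) \<le> 0" using l1[of t] t by simp
  then show ?thesis using abs_le_l1_norm[of "w t" y] by simp
qed

lemma linear_flow_unique: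
  assumes "linear_flow A v" "linear_flow A w" "\<And>u x. 0 \<le> u \<Longrightarrow> l1_norm (A u x) \<le> K"
    and "\<And>y. v 0 y = w 0 y" "0 \<le> t"
  shows "v t y = w t y"
  using linear_flow_eq_0[OF linear_flow_diff[OF assms(1,2)] assms(3), of t y] assms(4,5) by simp

text \<open>Multiplying \<open>w' = w L\<close> by the constant matrix \<open>L\<close> on the right
  gives the same equation for \<open>w L\<close>. With uniqueness this will make \<open>S t\<close>
  commute with \<open>L\<close>.\<close>

lemma linear_flow_generator_image:
  assumes "linear_flow (\<lambda>_. L) w"
  shows "linear_flow (\<lambda>_. L) (\<lambda>t. row_mult (w t) L)"
  unfolding linear_flow_def
proof (intro allI impI conjI)
  fix t :: real and y assume t: "0 \<le> t"
  have i: "set_integrable lborel {0..t} (\<lambda>u. row_mult (w u) L z * L z y)" for z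
    using linear_flow_integrable[OF assms, of 0 t z] by simp
  then have "set_integrable lborel {0..t} (\<lambda>u. \<Sum>z\<in>UNIV. row_mult (w u) L z * L z y)"
    by (rule set_integrable_sum)
  then show "set_integrable lborel {0..t} (\<lambda>u. row_mult (row_mult (w u) L) L y)"
    by (simp add: row_mult_def[of "row_mult _ _"])
  have "row_mult (w t) L y = (\<Sum>z\<in>UNIV. (w 0 z + (LBINT u:{0..t}. row_mult (w u) L z)) * L z y)"
    unfolding row_mult_def[of "w t"] by (intro sum.cong refl arg_cong2[of _ _ _ _ "(*)"] linear_flow_eq assms t)
  also have "\<dots> = row_mult (w 0) L y + (LBINT u:{0..t}. \<Sum>z\<in>UNIV. row_mult (w u) L z * L z y)"
    using i by (simp add: set_integral_sum distrib_right sum.distrib row_mult_def[of "w 0"])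
  finally show "row_mult (w t) L y = row_mult (w 0) L y + (LBINT u:{0..t}. row_mult (row_mult (w u) L) L y)"
    by (simp add: row_mult_def[of "row_mult _ _"])
qed

lemma transition_function_linear_flow:
  assumes "transition_function q P"
  shows "linear_flow (\<lambda>u. generator (q u)) (\<lambda>t. P 0 t x)"
proof -
  have P: "set_integrable lborel {0..t} (\<lambda>u. row_mult (P 0 u x) (generator (q u)) y) \<and>
     P 0 t x y = (if x = y then 1 else 0) + (LBINT u:{0..t}. row_mult (P 0 u x) (generator (q u)) y)" if "0 \<le> t" for t y
    using assms that unfolding transition_function_def row_mult_def by blast
  have "P 0 0 x y = (if x = y then 1 else 0)" for y using P[of 0 y] by (simp only: set_integral_Icc_refl add_0_right)
  then show ?thesis unfolding linear_flow_def using P by presburger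
qed

section \<open>Irreducible Markov semigroups\<close>

text \<open>\<open>S\<close> stands for the unperturbed transition function started at time 0. That
  it is a semigroup and commutes with its generator is derived below from uniqueness for linear
  flows.\<close>

locale irreducible_semigroup =
  fixes r :: "'x::finite \<Rightarrow> 'x \<Rightarrow> real" and S :: "real \<Rightarrow> 'x \<Rightarrow> 'x \<Rightarrow> real"
  assumes r_nonneg: "\<And>x y. 0 \<le> r x y"
    and irreducible: "irreducible_rates r"
    and S_flow: "\<And>x. linear_flow (\<lambda>_. generator r) (\<lambda>t. S t x)"
    and S_0: "\<And>x y. S 0 x y = (if x = y then 1 else 0)"
    and S_nonneg: "\<And>t x y. 0 \<le> t \<Longrightarrow> 0 \<le> S t x y"
    and S_stochastic: "\<And>t x. 0 \<le> t \<Longrightarrow> (\<Sum>y\<in>UNIV. S t x y) = 1"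
begin

abbreviation "L \<equiv> generator r"

lemma L_bound: "l1_norm (L x) \<le> (\<Sum>x\<in>UNIV. l1_norm (L x))"
  by (rule member_le_sum) auto

lemma S_row_flow: "linear_flow (\<lambda>_. L) (\<lambda>t. row_mult w (S t))"
  using linear_flow_sum[of UNIV "\<lambda>_. L" "\<lambda>x t. S t x" w] S_flow
  by (simp add: row_mult_def[abs_def])

lemma S_row_0 [simp]: "row_mult w (S 0) y = w y"
  by (simp add: row_mult_def S_0 if_distrib[of "(*) _"] cong: if_cong)

text \<open>As functions of \<open>t\<close>, both sides solve the forward equation with initial row
  \<open>S s x\<close>.\<close>

lemma semigroup:
  assumes "0 \<le> s" "0 \<le> t"
  shows "S (s + t) x y = row_mult (S s x) (S t) y"
proof -
  have "S (t + s) x y = row_mult (S s x) (S t) y"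
    using linear_flow_unique[OF linear_flow_shift[OF S_flow[of x] assms(1)] S_row_flow[of "S s x"] L_bound _ assms(2)]
    by simp
  then show ?thesis by (simp add: add.commute)
qed

text \<open>Both sides solve the forward equation with initial row \<open>L x\<close>. Through this
  identity the backward equation becomes available.\<close>

lemma commute:
  assumes "0 \<le> t"
  shows "row_mult (S t x) L y = row_mult (L x) (S t) y"
proof -
  have "row_mult (S 0 x) L y = L x y" for y
    by (simp add: row_mult_def S_0 if_distrib[of "\<lambda>a. a * _"] cong: if_cong)
  then show ?thesis
    using linear_flow_unique[OF linear_flow_generator_image[OF S_flow[of x]] S_row_flow[of "L x"] L_bound _ assms]
    by simp
qed

section \<open>Strict positivity of the semigroup\<close>

lemma S_diag_near_0: "\<exists>d>0. \<forall>t\<in>{0..d}. 1/2 < S t x x"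
proof -
  have "((\<lambda>t. S t x x) \<longlongrightarrow> S 0 x x) (at 0 within {0..})"
    using linear_flow_continuous[OF S_flow, of x x] by (simp add: continuous_on_def)
  then have "\<forall>\<^sub>F t in at 0 within {0..}. 1/2 < S t x x"
    by (rule order_tendstoD) (simp add: S_0)
  then obtain d where d: "d > 0" "\<And>t. t \<in> {0..} \<Longrightarrow> t \<noteq> 0 \<Longrightarrow> dist t 0 < d \<Longrightarrow> 1/2 < S t x x"
    by (auto simp: eventually_at)
  have "1/2 < S t x x" if "t \<in> {0..d/2}" for t
    using d(2)[of t] that d(1) by (cases "t = 0") (auto simp: S_0)
  then show ?thesis using d(1) by (intro exI[of _ "d/2"]) auto
qed

lemma S_mult_le:
  assumes "0 \<le> s" "0 \<le> t"
  shows "S s x z * S t z y \<le> S (s + t) x y"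
  unfolding semigroup[OF assms] row_mult_def
  by (rule member_le_sum) (use S_nonneg assms in auto)

text \<open>The time \<open>t\<close> is cut into steps so short that the diagonal exceeds 1/2 on
  each of them; returning to \<open>x\<close> after every step already has positive
  probability.\<close>

lemma S_diag_pos:
  assumes "0 \<le> t"
  shows "0 < S t x x"
proof -
  obtain d where d: "d > 0" "\<And>t. t \<in> {0..d} \<Longrightarrow> 1/2 < S t x x" using S_diag_near_0 by blast
  obtain n :: nat where n: "t / d < real n" using reals_Archimedean2 by blast
  then have n0: "0 < real n" using assms d by (cases n) (auto simp: divide_simps split: if_splits)
  define u where "u = t / real n"
  have u: "0 \<le> u" "u \<le> d" using n n0 assms d(1) by (auto simp: u_def field_simps)
  have "0 < S (real k * u) x x" for k
  proof (induction k)
    case (Suc k)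
    have "0 < S (real k * u) x x * S u x x"
      using Suc d(2)[of u] u by (intro mult_pos_pos) auto
    also have "\<dots> \<le> S (real k * u + u) x x" by (rule S_mult_le) (use u in auto)
    finally show ?case by (simp add: algebra_simps)
  qed (simp add: S_0)
  from this[of n] show ?thesis using n0 by (simp add: u_def)
qed

text \<open>If \<open>S t x y\<close> vanished for all \<open>t\<close>, the negative diagonal term
  of the generator at \<open>y\<close> would drop out of the forward equation. Its right-hand side
  would then be at least \<open>r x y / 2\<close> as long as the chain is still at \<open>x\<close>
  with probability above 1/2, and \<open>S t x y\<close> would grow.\<close>

lemma S_edge_pos:
  assumes "0 < r x y"
  shows "\<exists>t\<ge>0. 0 < S t x y"
proof (rule ccontr)
  assume neg: "\<not> ?thesis"
  have zero: "S t x y = 0" if "0 \<le> t" for t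
    using neg S_nonneg[OF that, of x y] that by force
  then have xy: "x \<noteq> y" using S_0[of x x] by force
  obtain d where d: "d > 0" "\<And>t. t \<in> {0..d} \<Longrightarrow> 1/2 < S t x x" using S_diag_near_0 by blast
  have ge: "r x y / 2 \<le> row_mult (S u x) L y" if u: "u \<in> {0..d}" for u
  proof -
    have "r x y / 2 \<le> S u x x * L x y"
      using d(2)[OF u] assms xy mult_right_mono[of "1/2" "S u x x" "r x y"] by (simp add: generator_def)
    also have "\<dots> \<le> row_mult (S u x) L y"
      unfolding row_mult_def
    proof (rule member_le_sum)
      fix z assume "z \<in> UNIV - {x}"
      show "0 \<le> S u x z * L z y"
        using zero[of u] u S_nonneg[of u x z] r_nonneg[of z y]
        by (cases "z = y") (auto simp: generator_def)
    qed auto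
    finally show ?thesis .
  qed
  have "r x y / 2 * d = (LBINT u:{0..d}. r x y / 2)"
    using d(1) by (subst set_integral_const) auto
  also have "\<dots> \<le> (LBINT u:{0..d}. row_mult (S u x) L y)"
    by (intro set_integral_mono set_integrable_const_Icc linear_flow_integrable[OF S_flow] ge) auto
  also have "\<dots> = 0"
    using linear_flow_eq[OF S_flow, of d x y] zero d(1) by simp
  finally show False using assms d(1) by (simp add: mult_le_0_iff)
qed

lemma S_pos_mono:
  assumes "0 \<le> s" "s \<le> t" "0 < S s x y"
  shows "0 < S t x y"
proof -
  have "0 < S s x y * S (t - s) y y"
    using assms S_diag_pos[of "t - s" y] by simp
  also have "\<dots> \<le> S t x y" using S_mult_le[of s "t - s" x y y] assms by simp
  finally show ?thesis .
qed

lemma S_reach: "\<exists>t\<ge>0. 0 < S t x y"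
proof -
  have "(x, y) \<in> {(a, b). r a b > 0}\<^sup>*" using irreducible by (simp add: irreducible_rates_def)
  then show ?thesis
  proof (induction rule: rtrancl_induct)
    case base
    then show ?case by (intro exI[of _ 0]) (simp add: S_0)
  next
    case (step y z)
    obtain s t where "0 \<le> s" "0 < S s x y" "0 \<le> t" "0 < S t y z"
      using step S_edge_pos[of y z] by blast
    then show ?case using S_mult_le[of s t x y z]
      by (intro exI[of _ "s + t"]) (auto intro: less_le_trans[OF mult_pos_pos])
  qed
qed

lemma S_all_pos: "\<exists>t>0. \<forall>x y. 0 < S t x y"
proof -
  obtain h where h: "\<And>x y. 0 \<le> h x y" "\<And>x y. 0 < S (h x y) x y" using S_reach by metis
  \<comment> \<open>The sum dominates every single reaching time, and positivity persists at later
    times; the 1 makes \<open>t\<close> positive.\<close>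
  define t where "t = 1 + (\<Sum>x\<in>UNIV. \<Sum>y\<in>UNIV. h x y)"
  have le: "h x y \<le> t" for x y
  proof -
    have "h x y \<le> (\<Sum>y\<in>UNIV. h x y)" by (rule member_le_sum) (auto simp: h)
    also have "\<dots> \<le> (\<Sum>x\<in>UNIV. \<Sum>y\<in>UNIV. h x y)"
      by (rule member_le_sum) (auto intro!: sum_nonneg simp: h)
    finally show ?thesis by (simp add: t_def)
  qed
  have "0 < t" unfolding t_def by (intro add_pos_nonneg sum_nonneg) (auto simp: h)
  then show ?thesis using S_pos_mono[OF h(1) le h(2)] by blast
qed

section \<open>Exponential decay on vectors of total mass zero\<close>

lemma l1_norm_S: "0 \<le> t \<Longrightarrow> l1_norm (S t x) = 1"
  using S_nonneg S_stochastic by (simp add: l1_norm_def)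

lemma nonexpansive: "0 \<le> t \<Longrightarrow> l1_norm (row_mult w (S t)) \<le> l1_norm w"
  using l1_norm_row_mult_le[of "S t" 1 w] l1_norm_S by simp

lemma row_mult_semigroup:
  assumes "0 \<le> s" "0 \<le> t"
  shows "row_mult w (S (s + t)) = row_mult (row_mult w (S s)) (S t)"
  by (rule ext) (simp add: row_mult_assoc row_mult_def[of w] semigroup[OF assms])

text \<open>Doeblin's argument: on vectors of total mass zero, \<open>S t\<close> may be replaced by \<open>S t - e\<close>, whose
  entries are nonnegative when \<open>e\<close> is a lower bound for those of \<open>S t\<close>.\<close>

lemma exponential_decay:
  obtains K \<kappa> where "0 \<le> K" "0 < \<kappa>"
    "\<And>w t. (\<Sum>x\<in>UNIV. w x) = 0 \<Longrightarrow> 0 \<le> t \<Longrightarrow> l1_norm (row_mult w (S t)) \<le> K * exp (- \<kappa> * t) * l1_norm w"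
proof -
  \<comment> \<open>Here \<open>T\<close> is a time at which \<open>S\<close> has only positive
    entries; it is unrelated to the period of the perturbation.\<close>
  obtain T where T: "0 < T" "\<And>x y. 0 < S T x y" using S_all_pos by blast
  define e where "e = Min (range (\<lambda>(x, y). S T x y))"
  have e: "e \<le> S T x y" for x y unfolding e_def by (rule Min_le) auto
  have "e \<in> range (\<lambda>(x, y). S T x y)" unfolding e_def by (rule Min_in) auto
  then have e0: "0 < e" using T by auto
  \<comment> \<open>\<open>1 - CARD('x) * e\<close> is the common l1 norm of the rows of
    \<open>S T - e\<close>. The maximum with 1/2 keeps \<open>\<rho>\<close> positive, so that its
    logarithm can serve as decay rate.\<close>
  define \<rho> where "\<rho> = max (1/2) (1 - real CARD('x) * e)"
  have \<rho>: "0 < \<rho>" "\<rho> < 1" using e0 by (auto simp: \<rho>_def)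
  have step: "l1_norm (row_mult w (S T)) \<le> \<rho> * l1_norm w" if w: "(\<Sum>x\<in>UNIV. w x) = 0" for w
  proof -
    have "row_mult w (S T) = row_mult w (\<lambda>x y. S T x y - e)"
      by (rule ext) (simp add: row_mult_def right_diff_distrib sum_subtractf w flip: sum_distrib_right)
    moreover have "l1_norm (\<lambda>y. S T x y - e) \<le> \<rho>" for x
      using e S_stochastic[of T x] T(1) by (simp add: l1_norm_def sum_subtractf \<rho>_def)
    ultimately show ?thesis using l1_norm_row_mult_le[of "\<lambda>x y. S T x y - e" \<rho> w] by simp
  qed
  have mass: "(\<Sum>y\<in>UNIV. row_mult w (S t) y) = 0" if "(\<Sum>x\<in>UNIV. w x) = 0" "0 \<le> t" for w t
    using that by (simp add: sum_row_mult S_stochastic)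
  have iter: "l1_norm (row_mult w (S (real k * T))) \<le> \<rho> ^ k * l1_norm w" if w: "(\<Sum>x\<in>UNIV. w x) = 0" for w k
  proof (induction k)
    case 0
    have "row_mult w (S 0) = w" by (rule ext) simp
    then show ?case by simp
  next
    case (Suc k)
    have "row_mult w (S (real (Suc k) * T)) = row_mult (row_mult w (S (real k * T))) (S T)"
      using row_mult_semigroup[of "real k * T" T w] T(1) by (simp add: algebra_simps)
    then have "l1_norm (row_mult w (S (real (Suc k) * T))) \<le> \<rho> * l1_norm (row_mult w (S (real k * T)))"
      using step mass[OF w] T(1) by simp
    also have "\<dots> \<le> \<rho> * (\<rho> ^ k * l1_norm w)" using Suc \<rho> by simp
    finally show ?case by simp
  qed
  define \<kappa> where "\<kappa> = - ln \<rho> / T"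
  have \<kappa>: "0 < \<kappa>" using \<rho> T(1) by (simp add: \<kappa>_def divide_neg_pos)
  have main: "l1_norm (row_mult w (S t)) \<le> inverse \<rho> * exp (- \<kappa> * t) * l1_norm w"
    if w: "(\<Sum>x\<in>UNIV. w x) = 0" and t: "0 \<le> t" for w t
  proof -
    \<comment> \<open>Only whole multiples of \<open>T\<close> contract, and on the remaining time
      \<open>S\<close> is merely nonexpansive. As \<open>k\<close> is at least
      \<open>t / T - 1\<close>, this costs the factor \<open>inverse \<rho>\<close>.\<close>
    define k where "k = nat \<lfloor>t / T\<rfloor>"
    have k: "real k * T \<le> t" "t / T - 1 \<le> real k"
      using t T(1) floor_divide_lower[of T t] by (auto simp: k_def)
    have "l1_norm (row_mult w (S t)) = l1_norm (row_mult (row_mult w (S (real k * T))) (S (t - real k * T)))"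
      using row_mult_semigroup[of "real k * T" "t - real k * T" w] k(1) T(1) by simp
    also have "\<dots> \<le> l1_norm (row_mult w (S (real k * T)))"
      by (rule nonexpansive) (use k in simp)
    also have "\<dots> \<le> \<rho> ^ k * l1_norm w" by (rule iter[OF w])
    also have "\<dots> \<le> inverse \<rho> * exp (- \<kappa> * t) * l1_norm w"
    proof (rule mult_right_mono)
      have "\<rho> ^ k = \<rho> powr real k" using \<rho> by (simp add: powr_realpow)
      also have "\<dots> \<le> \<rho> powr (t / T - 1)" using k \<rho> by (intro powr_mono') auto
      also have "\<dots> = inverse \<rho> * exp (- \<kappa> * t)"
        using \<rho> by (simp add: powr_def \<kappa>_def left_diff_distrib exp_diff field_simps)
      finally show "\<rho> ^ k \<le> inverse \<rho> * exp (- \<kappa> * t)" .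
    qed simp
    finally show ?thesis .
  qed
  show thesis by (rule that[OF _ \<kappa> main]) (use \<rho> in auto)
qed

text \<open>The constant curve \<open>m\<close> solves the forward equation, so uniqueness
  identifies it with the evolution of \<open>m\<close>.\<close>

lemma invariant_flow:
  assumes "\<And>y. row_mult m L y = 0" "0 \<le> t"
  shows "row_mult m (S t) y = m y"
  by (rule linear_flow_unique[OF S_row_flow _ L_bound, where w = "\<lambda>_. m"])
     (use assms in \<open>auto simp: linear_flow_def set_integrable_def\<close>)

text \<open>The vector equals its own evolution up to a time at which all entries of
  \<open>S\<close> are positive. Reversed rates divide by these weights.\<close>

lemma invariant_pos:
  assumes "\<And>y. row_mult m L y = 0" "\<And>y. 0 \<le> m y" "(\<Sum>x\<in>UNIV. m x) = 1"
  shows "0 < m y"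
proof -
  obtain t where t: "0 < t" "\<And>x y. 0 < S t x y" using S_all_pos by blast
  have "\<exists>x. 0 < m x"
    using assms(2,3) by (metis less_eq_real_def sum.neutral zero_neq_one)
  then obtain x where x: "0 < m x" by blast
  have "0 < m x * S t x y" using x t by simp
  also have "\<dots> \<le> row_mult m (S t) y"
    unfolding row_mult_def by (rule member_le_sum) (auto intro!: mult_nonneg_nonneg assms S_nonneg less_imp_le[OF t(1)])
  also have "\<dots> = m y" by (rule invariant_flow) (use assms t in auto)
  finally show ?thesis .
qed

text \<open>The backward equation in the form needed for integration by parts:
  \<open>S (t - u)\<close> as an indefinite integral in \<open>u\<close>. It follows from the
  forward equation by reflecting time and moving \<open>L\<close> to the other side of
  \<open>S\<close>.\<close>

lemma S_backward_increment:
  assumes "0 \<le> u" "u \<le> t"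
  shows "S (t - u) x y = S t x y + (LBINT s:{0..u}. - row_mult (L x) (S (t - s)) y)"
proof -
  have "S t x y = S (t - u) x y + (LBINT s:{t - u..t}. row_mult (S s x) L y)"
    by (rule linear_flow_increment[OF S_flow]) (use assms in auto)
  also have "(LBINT s:{t - u..t}. row_mult (S s x) L y) = (LBINT s:{0..u}. row_mult (S (t - s) x) L y)"
    by (subst set_integral_reflect_Icc(1)[of _ _ _ t]) simp
  also have "\<dots> = (LBINT s:{0..u}. row_mult (L x) (S (t - s)) y)"
    by (rule set_lebesgue_integral_cong) (use assms in \<open>auto intro!: commute\<close>)
  finally show ?thesis by (simp add: set_lebesgue_integral_def)
qed

lemma S_backward_integrable:
  "set_integrable lborel {0..t} (\<lambda>s. - row_mult (L x) (S (t - s)) y)"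
proof -
  have "set_integrable lborel {0..t} (\<lambda>s. - row_mult (S s x) L y)"
    using linear_flow_integrable[OF S_flow, of 0 t x y] by (simp add: set_integrable_def)
  then have "set_integrable lborel {0..t} (\<lambda>s. - row_mult (S (t - s) x) L y)"
    by (subst (asm) set_integral_reflect_Icc(2)[of _ _ _ t]) simp
  also have "?this \<longleftrightarrow> ?thesis"
    by (rule set_integrable_cong) (auto simp: commute)
  finally show ?thesis .
qed

text \<open>The product of \<open>w u\<close> and \<open>S (t - u)\<close> interpolates between the
  evolved initial row at \<open>u = 0\<close> and \<open>w t\<close> at \<open>u = t\<close>.
  Integration by parts yields \<open>w A S\<close> from the first factor and \<open>- w L S\<close>
  from the second, entry by entry.\<close>

lemma duhamel:
  assumes w: "linear_flow A w" and t: "0 \<le> t"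
  shows "set_integrable lborel {0..t} (\<lambda>u. row_mult (\<lambda>z. row_mult (w u) (A u) z - row_mult (w u) L z) (S (t - u)) y)"
    and "w t y = row_mult (w 0) (S t) y
      + (LBINT u:{0..t}. row_mult (\<lambda>z. row_mult (w u) (A u) z - row_mult (w u) L z) (S (t - u)) y)"
proof -
  let ?a = "\<lambda>z u. row_mult (w u) (A u) z * S (t - u) z y"
  let ?b = "\<lambda>z u. w u z * - row_mult (L z) (S (t - u)) y"
  have parts: "set_integrable lborel {0..t} (?a z)" "set_integrable lborel {0..t} (?b z)"
    "w t z * S (t - t) z y - w 0 z * S (t - 0) z y = (LBINT u:{0..t}. ?a z u) + (LBINT u:{0..t}. ?b z u)" for z
  proof -
    have F: "w u z = w 0 z + (LBINT s:{0..u}. row_mult (w s) (A s) z)" if "u \<in> {0..t}" for u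
      by (rule linear_flow_eq[OF w]) (use that in auto)
    have G: "S (t - u) z y = S (t - 0) z y + (LBINT s:{0..u}. - row_mult (L z) (S (t - s)) y)" if "u \<in> {0..t}" for u
      using S_backward_increment[of u t z y] that by (simp del: minus_apply)
    note by_parts = set_integral_by_parts[where F = "\<lambda>u. w u z" and G = "\<lambda>u. S (t - u) z y",
        OF linear_flow_integrable[OF w order_refl] S_backward_integrable F G t]
    show "set_integrable lborel {0..t} (?a z)" "set_integrable lborel {0..t} (?b z)"
      "w t z * S (t - t) z y - w 0 z * S (t - 0) z y = (LBINT u:{0..t}. ?a z u) + (LBINT u:{0..t}. ?b z u)"
      using by_parts by blast+
  qed
  have eq: "row_mult (\<lambda>z. row_mult (w u) (A u) z - row_mult (w u) L z) (S (t - u)) y = (\<Sum>z\<in>UNIV. ?a z u + ?b z u)" for u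
  proof -
    have "row_mult (\<lambda>z. row_mult (w u) L z) (S (t - u)) y = (\<Sum>z\<in>UNIV. w u z * row_mult (L z) (S (t - u)) y)"
      by (subst row_mult_assoc) (rule row_mult_def)
    then show ?thesis
      by (simp add: row_mult_diff_left sum_subtractf row_mult_def[of "row_mult _ _"])
  qed
  have i: "set_integrable lborel {0..t} (\<lambda>u. ?a z u + ?b z u)" for z
    by (rule set_integral_add[OF parts(1,2)])
  then show "set_integrable lborel {0..t} (\<lambda>u. row_mult (\<lambda>z. row_mult (w u) (A u) z - row_mult (w u) L z) (S (t - u)) y)"
    unfolding eq by (rule set_integrable_sum)
  have "(LBINT u:{0..t}. row_mult (\<lambda>z. row_mult (w u) (A u) z - row_mult (w u) L z) (S (t - u)) y)
      = (\<Sum>z\<in>UNIV. (LBINT u:{0..t}. ?a z u) + (LBINT u:{0..t}. ?b z u))"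
    unfolding eq by (subst set_integral_sum[OF i], subst set_integral_add(2)[OF parts(1,2)]) simp
  also have "\<dots> = (\<Sum>z\<in>UNIV. w t z * S (t - t) z y - w 0 z * S (t - 0) z y)"
    by (intro sum.cong refl parts(3)[symmetric])
  also have "\<dots> = w t y - row_mult (w 0) (S t) y"
    using S_row_0[of "w t" y] by (simp add: sum_subtractf row_mult_def)
  finally show "w t y = row_mult (w 0) (S t) y
      + (LBINT u:{0..t}. row_mult (\<lambda>z. row_mult (w u) (A u) z - row_mult (w u) L z) (S (t - u)) y)"
    by simp
qed

end

section \<open>Linear response of periodic solutions\<close>

lemma abs_exp_minus_1_le:
  fixes c :: real
  shows "\<bar>exp c - 1\<bar> \<le> exp \<bar>c\<bar> * \<bar>c\<bar>"
  using Taylor_exp_field[of c 0] by simp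

lemma abs_exp_minus_1_minus_le:
  fixes c :: real
  shows "\<bar>exp c - 1 - c\<bar> \<le> exp \<bar>c\<bar> * c\<^sup>2"
proof -
  have "\<bar>exp c - 1 - c\<bar> = exp c - (1 + c)" using exp_ge_add_one_self[of c] by linarith
  then show ?thesis using Taylor_exp_field[of c 1] by (simp add: power2_eq_square)
qed

lemma generator_diff: "generator q x y - generator q' x y = generator (\<lambda>x y. q x y - q' x y) x y"
  by (simp add: generator_def sum_subtractf)

lemma generator_scale: "c * generator q x y = generator (\<lambda>x y. c * q x y) x y"
  by (simp add: generator_def right_diff_distrib sum_distrib_left)

context irreducible_semigroup
begin

text \<open>Each perturbation \<open>c u\<close> has mass zero, so its influence after the remaining
  time \<open>s\<close> is at most \<open>K * M * exp (- \<kappa> * s)\<close>. Integrating this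
  gives a bound that is independent of the horizon \<open>R\<close>.\<close>

lemma duhamel_bound:
  assumes decay: "\<And>w t. (\<Sum>x\<in>UNIV. w x) = 0 \<Longrightarrow> 0 \<le> t \<Longrightarrow> l1_norm (row_mult w (S t)) \<le> K * exp (- \<kappa> * t) * l1_norm w"
    and K: "0 \<le> K" "0 < \<kappa>" and R: "0 \<le> R"
    and int: "set_integrable lborel {0..R} (\<lambda>u. row_mult (c u) (S (R - u)) y)"
    and mass: "\<And>u. u \<in> {0..R} \<Longrightarrow> (\<Sum>x\<in>UNIV. c u x) = 0"
    and bound: "\<And>u. u \<in> {0..R} \<Longrightarrow> l1_norm (c u) \<le> M"
  shows "\<bar>LBINT u:{0..R}. row_mult (c u) (S (R - u)) y\<bar> \<le> M * (K / \<kappa>)"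
proof -
  have M: "0 \<le> M" using bound[of 0] R order_trans[OF l1_norm_nonneg] by auto
  have int': "set_integrable lborel {0..R} (\<lambda>s. row_mult (c (R - s)) (S s) y)"
    using int by (subst (asm) set_integral_reflect_Icc(2)[of _ _ _ R]) simp
  have "(LBINT u:{0..R}. row_mult (c u) (S (R - u)) y) = (LBINT s:{0..R}. row_mult (c (R - s)) (S s) y)"
    by (subst set_integral_reflect_Icc(1)[of _ _ _ R]) simp
  also have "\<bar>\<dots>\<bar> \<le> (LBINT s:{0..R}. norm (row_mult (c (R - s)) (S s) y))"
    using set_integral_norm_bound[OF int'] by simp
  also have "\<dots> \<le> (LBINT s:{0..R}. K * M * exp (- \<kappa> * s))"
  proof (rule set_integral_mono[OF set_integrable_norm[OF int']])
    show "set_integrable lborel {0..R} (\<lambda>s. K * M * exp (- \<kappa> * s))"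
      using set_integral_exp_Icc(1)[of "- \<kappa>" R] K R by simp
    fix s assume s: "s \<in> {0..R}"
    have "norm (row_mult (c (R - s)) (S s) y) \<le> l1_norm (row_mult (c (R - s)) (S s))"
      using abs_le_l1_norm by simp
    also have "\<dots> \<le> K * exp (- \<kappa> * s) * l1_norm (c (R - s))"
      by (rule decay) (use s mass in auto)
    also have "\<dots> \<le> K * exp (- \<kappa> * s) * M"
      using s K by (intro mult_left_mono bound) auto
    finally show "norm (row_mult (c (R - s)) (S s) y) \<le> K * M * exp (- \<kappa> * s)"
      by (simp add: mult_ac)
  qed
  also have "\<dots> = K * M * ((1 - exp (- \<kappa> * R)) / \<kappa>)"
    using set_integral_exp_Icc(2)[of "- \<kappa>" R] K R by (simp add: divide_simps)
  also have "\<dots> \<le> K * M * (1 / \<kappa>)"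
    using K M by (intro mult_left_mono divide_right_mono) auto
  finally show ?thesis by (simp add: mult_ac)
qed

lemma S_row_measurable: "(\<lambda>s. indicator {0..} s * row_mult w (S s) y) \<in> borel_measurable borel"
  by (rule linear_flow_measurable[OF S_row_flow])

lemma S_row_integrable:
  assumes "(\<Sum>x\<in>UNIV. w x) = 0"
  shows "set_integrable lborel {0..} (\<lambda>s. row_mult w (S s) y)"
proof -
  obtain K \<kappa> where K: "0 \<le> K" "0 < \<kappa>" and
    decay: "\<And>w t. (\<Sum>x\<in>UNIV. w x) = 0 \<Longrightarrow> 0 \<le> t \<Longrightarrow> l1_norm (row_mult w (S t)) \<le> K * exp (- \<kappa> * t) * l1_norm w"
    by (rule exponential_decay) blast
  show ?thesis
  proof (rule set_integrable_bound)
    show "set_integrable lborel {0..} (\<lambda>s. K * l1_norm w * exp (- \<kappa> * s))"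
      by (intro set_integrable_mult_right set_integrable_exp_Ici K)
    show "set_borel_measurable lborel {0..} (\<lambda>s. row_mult w (S s) y)"
      using S_row_measurable by (simp add: set_borel_measurable_def)
    show "AE s in lborel. s \<in> {0..} \<longrightarrow> norm (row_mult w (S s) y) \<le> norm (K * l1_norm w * exp (- \<kappa> * s))"
    proof (intro AE_I2 impI)
      fix s :: real assume "s \<in> {0..}"
      then have "norm (row_mult w (S s) y) \<le> K * exp (- \<kappa> * s) * l1_norm w"
        using decay[OF assms, of s] abs_le_l1_norm[of "row_mult w (S s)" y] by simp
      then show "norm (row_mult w (S s) y) \<le> norm (K * l1_norm w * exp (- \<kappa> * s))"
        using K by (simp add: abs_mult mult_ac)
    qed
  qed
qed

end

locale periodic_perturbation = irreducible_semigroup r S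
  for r :: "'x::finite \<Rightarrow> 'x \<Rightarrow> real" and S +
  fixes m :: "'x \<Rightarrow> real" and T :: real and \<tau> :: "real \<Rightarrow> real" and B :: real and E :: "'x \<Rightarrow> 'x \<Rightarrow> real"
  assumes m_invariant: "\<And>y. row_mult m (generator r) y = 0"
    and m_nonneg: "\<And>y. 0 \<le> m y" and m_mass: "(\<Sum>y\<in>UNIV. m y) = 1"
    and T_pos: "0 < T"
    and \<tau>_measurable [measurable]: "\<tau> \<in> borel_measurable borel"
    and \<tau>_bound: "\<And>s. \<bar>\<tau> s\<bar> \<le> B"
    and \<tau>_periodic: "\<And>s. \<tau> (s + T) = \<tau> s"
begin

text \<open>The derivative at \<open>l = 0\<close> of the generator of \<open>rate l s\<close> is
  \<open>\<tau> s\<close> times this matrix.\<close>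

definition L' :: "'x \<Rightarrow> 'x \<Rightarrow> real" where "L' = generator (\<lambda>x y. E x y * r x y)"

text \<open>The rate at which a unit perturbation drives the law away from \<open>m\<close>. In the
  final proof it turns out to be the row with entries \<open>pmf \<mu> x * \<phi> x\<close>.\<close>

definition \<beta> :: "'x \<Rightarrow> real" where "\<beta> = row_mult m L'"

text \<open>The future derivative of the law at time \<open>t\<close>. It looks back over the whole
  past, also before time 0, where \<open>\<tau>\<close> is given by periodicity. The integral
  converges because \<open>\<beta>\<close> has mass zero.\<close>

definition response :: "real \<Rightarrow> 'x \<Rightarrow> real" where
  "response t y = (LBINT s:{0..}. \<tau> (t - s) * row_mult \<beta> (S s) y)"

definition rate :: "real \<Rightarrow> real \<Rightarrow> 'x \<Rightarrow> 'x \<Rightarrow> real" where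
  "rate = perturbed_rate r (\<lambda>s x y. \<tau> s * E x y)"

text \<open>The sum of the row norms of \<open>E\<close> serves as a convenient majorant of all its
  entries.\<close>

definition exponent_bound :: real where "exponent_bound = B * (\<Sum>x\<in>UNIV. l1_norm (E x))"

definition rate_bound :: real where "rate_bound = (\<Sum>x\<in>UNIV. l1_norm (r x))"

lemma B_nonneg: "0 \<le> B" using \<tau>_bound[of 0] by linarith

lemma E_bound: "\<bar>E x y\<bar> \<le> (\<Sum>x\<in>UNIV. l1_norm (E x))"
  using abs_le_l1_norm[of "E x" y] member_le_sum[of x UNIV "\<lambda>x. l1_norm (E x)"] by simp

lemma exponent_bound: "\<bar>\<tau> s * E x y\<bar> \<le> exponent_bound"
  unfolding exponent_bound_def abs_mult
  by (intro mult_mono \<tau>_bound E_bound) (auto simp: B_nonneg)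

lemma exponent_bound_nonneg: "0 \<le> exponent_bound"
  using exponent_bound[of 0 undefined undefined] by linarith

lemma rate_bound: "l1_norm (r x) \<le> rate_bound"
  unfolding rate_bound_def by (rule member_le_sum) auto

lemma rate_bound_nonneg: "0 \<le> rate_bound"
  unfolding rate_bound_def by (simp add: sum_nonneg)

lemma rate_measurable [measurable]: "(\<lambda>u. rate l u x y) \<in> borel_measurable borel"
  unfolding rate_def perturbed_rate_def by measurable

lemma rate_periodic: "rate l (u + T) = rate l u"
  by (intro ext) (simp add: rate_def perturbed_rate_def \<tau>_periodic)

lemma rate_nonneg: "0 \<le> rate l u x y"
  by (simp add: rate_def perturbed_rate_def r_nonneg)

lemma weighted_rate_bound:
  assumes "\<And>y. \<bar>c y\<bar> \<le> M"
  shows "l1_norm (\<lambda>y. c y * r x y) \<le> M * rate_bound"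
proof -
  have M: "0 \<le> M" using assms order_trans[OF abs_ge_zero] by blast
  have "l1_norm (\<lambda>y. c y * r x y) \<le> (\<Sum>y\<in>UNIV. M * \<bar>r x y\<bar>)"
    unfolding l1_norm_def by (intro sum_mono) (simp add: abs_mult assms mult_right_mono)
  also have "\<dots> = M * l1_norm (r x)" by (simp add: l1_norm_def sum_distrib_left)
  also have "\<dots> \<le> M * rate_bound" using M by (intro mult_left_mono rate_bound)
  finally show ?thesis .
qed

text \<open>Every order of the expansion has rates of this form: the weight \<open>c\<close> will be
  an exponential, the exponential without its constant term, its second-order remainder, or
  \<open>E\<close> itself.\<close>

lemma weighted_generator_bound:
  assumes "\<And>y. \<bar>c x y\<bar> \<le> M"
  shows "l1_norm (generator (\<lambda>x y. c x y * r x y) x) \<le> 2 * M * rate_bound"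
  using l1_norm_generator_le[of "\<lambda>x y. c x y * r x y" x] weighted_rate_bound[of "c x" M x] assms by simp

lemma generator_rate_bound: "l1_norm (generator (rate l u) x) \<le> 2 * exp (\<bar>l\<bar> * exponent_bound) * rate_bound"
proof -
  have "\<bar>exp (l * (\<tau> u * E x y))\<bar> \<le> exp (\<bar>l\<bar> * exponent_bound)" for y
    using exponent_bound[of u x y] by (simp add: abs_mult mult_left_mono order_trans[OF abs_ge_self, of "l * _"])
  from weighted_generator_bound[of "\<lambda>x y. exp (l * (\<tau> u * E x y))", OF this] show ?thesis
    by (simp add: rate_def perturbed_rate_def[abs_def])
qed

lemma exp_first_order:
  assumes "\<bar>l\<bar> \<le> 1"
  shows "\<bar>exp (l * (\<tau> u * E x y)) - 1\<bar> \<le> \<bar>l\<bar> * (exp exponent_bound * exponent_bound)"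
proof -
  have le: "\<bar>l * (\<tau> u * E x y)\<bar> \<le> \<bar>l\<bar> * exponent_bound"
    by (simp add: abs_mult[of l] mult_left_mono exponent_bound)
  have le1: "\<bar>l\<bar> * exponent_bound \<le> exponent_bound"
    using assms exponent_bound_nonneg mult_right_mono[of "\<bar>l\<bar>" 1] by simp
  have "\<bar>exp (l * (\<tau> u * E x y)) - 1\<bar> \<le> exp \<bar>l * (\<tau> u * E x y)\<bar> * \<bar>l * (\<tau> u * E x y)\<bar>"
    by (rule abs_exp_minus_1_le)
  also have "\<dots> \<le> exp exponent_bound * (\<bar>l\<bar> * exponent_bound)"
    using le le1 by (intro mult_mono) auto
  finally show ?thesis by (simp add: mult_ac)
qed

lemma exp_second_order:
  assumes "\<bar>l\<bar> \<le> 1"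
  shows "\<bar>exp (l * (\<tau> u * E x y)) - 1 - l * (\<tau> u * E x y)\<bar> \<le> l\<^sup>2 * (exp exponent_bound * exponent_bound\<^sup>2)"
proof -
  have le: "\<bar>l * (\<tau> u * E x y)\<bar> \<le> \<bar>l\<bar> * exponent_bound"
    by (simp add: abs_mult[of l] mult_left_mono exponent_bound)
  have le1: "\<bar>l\<bar> * exponent_bound \<le> exponent_bound"
    using assms exponent_bound_nonneg mult_right_mono[of "\<bar>l\<bar>" 1] by simp
  have sq: "(l * (\<tau> u * E x y))\<^sup>2 \<le> (\<bar>l\<bar> * exponent_bound)\<^sup>2"
    using power_mono[OF le abs_ge_zero, of 2] by (simp only: power2_abs)
  have "\<bar>exp (l * (\<tau> u * E x y)) - 1 - l * (\<tau> u * E x y)\<bar> \<le> exp \<bar>l * (\<tau> u * E x y)\<bar> * (l * (\<tau> u * E x y))\<^sup>2"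
    by (rule abs_exp_minus_1_minus_le)
  also have "\<dots> \<le> exp exponent_bound * (\<bar>l\<bar> * exponent_bound)\<^sup>2"
    using le le1 sq by (intro mult_mono) auto
  finally show ?thesis by (simp add: power_mult_distrib mult_ac)
qed

section \<open>The first-order response as a convolution with the past\<close>

lemma \<beta>_mass: "(\<Sum>x\<in>UNIV. \<beta> x) = 0"
  by (simp add: \<beta>_def sum_row_mult L'_def)

lemma response_integrable:
  fixes h :: "real \<Rightarrow> real"
  assumes "h \<in> borel_measurable borel" "\<And>s. \<bar>h s\<bar> \<le> C"
  shows "set_integrable lborel {0..} (\<lambda>s. h s * row_mult \<beta> (S s) y)"
  by (rule set_integrable_bounded_mult[OF S_row_integrable[OF \<beta>_mass], of h C])
     (use assms in \<open>auto simp: set_borel_measurable_def\<close>)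

lemma response_integrable':
  "set_integrable lborel {0..} (\<lambda>s. \<tau> (t - s) * row_mult \<beta> (S s) y)"
  by (rule response_integrable[of _ B]) (auto simp: \<tau>_bound)

lemma response_measurable [measurable]: "(\<lambda>t. response t y) \<in> borel_measurable borel"
proof -
  have [measurable]: "(\<lambda>s. indicator {0..} s * row_mult \<beta> (S s) y) \<in> borel_measurable borel"
    by (rule S_row_measurable)
  have "(\<lambda>t. \<integral>s. \<tau> (t - s) * (indicator {0..} s * row_mult \<beta> (S s) y) \<partial>lborel) \<in> borel_measurable borel"
    by (rule lborel.borel_measurable_lebesgue_integral) measurable
  then show ?thesis by (simp add: response_def[abs_def] set_lebesgue_integral_def mult_ac)
qed

lemma response_bounded: "\<exists>C. \<forall>t. \<bar>response t y\<bar> \<le> C"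
proof -
  have "\<bar>response t y\<bar> \<le> (LBINT s:{0..}. B * norm (row_mult \<beta> (S s) y))" for t
  proof -
    have "norm (response t y) \<le> (LBINT s:{0..}. norm (\<tau> (t - s) * row_mult \<beta> (S s) y))"
      unfolding response_def by (rule set_integral_norm_bound[OF response_integrable'])
    also have "\<dots> \<le> (LBINT s:{0..}. B * norm (row_mult \<beta> (S s) y))"
      by (intro set_integral_mono set_integrable_norm response_integrable' set_integrable_mult_right S_row_integrable \<beta>_mass)
         (simp add: abs_mult mult_right_mono \<tau>_bound)
    finally show ?thesis by simp
  qed
  then show ?thesis by blast
qed

lemma periods_at_top: "filterlim (\<lambda>n. t + real n * T) at_top sequentially"
  using T_pos by (intro filterlim_tendsto_add_at_top[OF tendsto_const] filterlim_at_top_mult_tendsto_pos[OF tendsto_const] filterlim_real_sequentially)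

text \<open>With \<open>R = t + n T\<close>, the substitution \<open>s = R - u\<close> turns
  Duhamel's term into an integral of \<open>\<tau> (R - s)\<close> against the decaying row.
  Periodicity replaces \<open>\<tau> (R - s)\<close> by \<open>\<tau> (t - s)\<close>, so increasing
  \<open>n\<close> merely lengthens a truncation of the integral in \<open>response\<close>.\<close>

lemma response_limit:
  "(\<lambda>n. LBINT u:{0..t + real n * T}. \<tau> u * row_mult \<beta> (S (t + real n * T - u)) y) \<longlonglongrightarrow> response t y"
proof -
  let ?f = "\<lambda>s. indicator {0..} s *\<^sub>R (\<tau> (t - s) * row_mult \<beta> (S s) y)"
  note periods_at_top
  moreover have "((\<lambda>R. \<integral>s. indicator {..R} s *\<^sub>R ?f s \<partial>lborel) \<longlongrightarrow> (\<integral>s. ?f s \<partial>lborel)) at_top"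
    using response_integrable'[of t y] unfolding set_integrable_def by (intro tendsto_integral_at_top) auto
  ultimately have "(\<lambda>n. \<integral>s. indicator {..t + real n * T} s *\<^sub>R ?f s \<partial>lborel) \<longlonglongrightarrow> (\<integral>s. ?f s \<partial>lborel)"
    by (rule filterlim_compose[rotated])
  moreover have "(\<integral>s. indicator {..R} s *\<^sub>R ?f s \<partial>lborel) = (LBINT u:{0..R}. \<tau> u * row_mult \<beta> (S (R - u)) y)"
    if R: "R = t + real n * T" for R n
  proof -
    have "\<tau> (R - s) = \<tau> (t - s)" for s
      using periodic_shift_int[of \<tau> T "t - s" "int n", OF \<tau>_periodic] by (simp add: R algebra_simps)
    then have "(\<integral>s. indicator {..R} s *\<^sub>R ?f s \<partial>lborel) = (LBINT s:{0..R}. \<tau> (R - s) * row_mult \<beta> (S s) y)"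
      unfolding set_lebesgue_integral_def
      by (intro Bochner_Integration.integral_cong) (auto simp: indicator_def)
    also have "\<dots> = (LBINT u:{0..R}. \<tau> u * row_mult \<beta> (S (R - u)) y)"
      by (subst set_integral_reflect_Icc(1)[of _ _ _ R]) simp
    finally show ?thesis .
  qed
  ultimately show ?thesis by (simp add: response_def set_lebesgue_integral_def)
qed

theorem linear_response:
  assumes flow: "\<And>l. linear_flow (\<lambda>u. generator (rate l u)) (p l)"
    and p_nonneg: "\<And>l t y. 0 \<le> t \<Longrightarrow> 0 \<le> p l t y"
    and p_mass: "\<And>l t. 0 \<le> t \<Longrightarrow> (\<Sum>y\<in>UNIV. p l t y) = 1"
    and p_periodic: "\<And>l t y. 0 \<le> t \<Longrightarrow> p l (t + T) y = p l t y"
  shows "\<exists>C. \<forall>l t y. \<bar>l\<bar> \<le> 1 \<longrightarrow> 0 \<le> t \<longrightarrow> \<bar>p l t y - m y - l * response t y\<bar> \<le> C * l\<^sup>2"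
proof -
  obtain K \<kappa> where K: "0 \<le> K" "0 < \<kappa>" and
    decay: "\<And>w t. (\<Sum>x\<in>UNIV. w x) = 0 \<Longrightarrow> 0 \<le> t \<Longrightarrow> l1_norm (row_mult w (S t)) \<le> K * exp (- \<kappa> * t) * l1_norm w"
    by (rule exponential_decay) blast
  \<comment> \<open>\<open>b l u\<close> is the law times the change of the generator, the source
    term in Duhamel's formula.\<close>
  define b where "b l u = (\<lambda>z. row_mult (p l u) (generator (rate l u)) z - row_mult (p l u) (generator r) z)" for l u
  have p_l1: "l1_norm (p l t) = 1" if "0 \<le> t" for l t
    using that p_nonneg p_mass by (simp add: l1_norm_def)
  have p_shift: "p l (t + real n * T) y = p l t y" if "0 \<le> t" for l t n y
  proof (induction n)
    case (Suc n)
    then show ?case using p_periodic[of "t + real n * T" l y] that T_pos by (simp add: algebra_simps)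
  qed simp
  have b_eq: "b l u z = row_mult (p l u) (generator (\<lambda>x y. (exp (l * (\<tau> u * E x y)) - 1) * r x y)) z" for l u z
    unfolding b_def by (subst row_mult_diff_right[symmetric])
      (simp add: generator_diff rate_def perturbed_rate_def[abs_def] left_diff_distrib)
  have b_mass: "(\<Sum>z\<in>UNIV. b l u z) = 0" for l u
    by (simp add: b_eq sum_row_mult)
  have pm_mass: "(\<Sum>z\<in>UNIV. p l 0 z - m z) = 0" for l
    by (simp add: sum_subtractf p_mass m_mass)
  have pm_l1: "l1_norm (\<lambda>z. p l 0 z - m z) \<le> 2" for l
    using l1_norm_triangle[of "p l 0" "\<lambda>z. - 1 * m z"] l1_norm_scale[of "- 1" m] p_l1[of 0 l] m_nonneg m_mass
    by (simp add: l1_norm_def[of m])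
  \<comment> \<open>The 2 bounds the l1 distance between two probability vectors, here the unknown
    initial law and \<open>m\<close>.\<close>
  define e where "e R = 2 * K * exp (- \<kappa> * R)" for R
  have e: "\<bar>row_mult (\<lambda>z. p l 0 z - m z) (S R) y\<bar> \<le> e R" if "0 \<le> R" for l R y
  proof -
    have "\<bar>row_mult (\<lambda>z. p l 0 z - m z) (S R) y\<bar> \<le> K * exp (- \<kappa> * R) * l1_norm (\<lambda>z. p l 0 z - m z)"
      using decay[OF pm_mass that] abs_le_l1_norm order_trans by blast
    also have "\<dots> \<le> K * exp (- \<kappa> * R) * 2"
      using K by (intro mult_left_mono pm_l1) auto
    finally show ?thesis by (simp add: e_def mult_ac)
  qed
  have e_lim: "(\<lambda>n. e (t + real n * T)) \<longlonglongrightarrow> 0" for t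
  proof -
    have "filterlim (\<lambda>n. - \<kappa> * (t + real n * T)) at_bot sequentially"
      using K by (intro filterlim_tendsto_neg_mult_at_bot[OF tendsto_const _ periods_at_top]) auto
    then have "(\<lambda>n. exp (- \<kappa> * (t + real n * T))) \<longlonglongrightarrow> 0"
      by (rule filterlim_compose[OF exp_at_bot])
    then show ?thesis unfolding e_def by (rule tendsto_mult_right_zero)
  qed
  \<comment> \<open>Since \<open>m\<close> is its own evolution, subtracting it turns the initial
    term into one of mass zero.\<close>
  have expansion: "p l t y - m y = row_mult (\<lambda>z. p l 0 z - m z) (S (t + real n * T)) y
      + (LBINT u:{0..t + real n * T}. row_mult (b l u) (S (t + real n * T - u)) y)"
    and b_int: "set_integrable lborel {0..t + real n * T} (\<lambda>u. row_mult (b l u) (S (t + real n * T - u)) y)"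
    if t: "0 \<le> t" for l t y n
  proof -
    have R: "0 \<le> t + real n * T" using t T_pos by simp
    show "set_integrable lborel {0..t + real n * T} (\<lambda>u. row_mult (b l u) (S (t + real n * T - u)) y)"
      unfolding b_def by (rule duhamel(1)[OF flow R])
    show "p l t y - m y = row_mult (\<lambda>z. p l 0 z - m z) (S (t + real n * T)) y
      + (LBINT u:{0..t + real n * T}. row_mult (b l u) (S (t + real n * T - u)) y)"
      using duhamel(2)[OF flow[of l] R, of y] p_shift[OF t, of l n y] invariant_flow[of m, OF m_invariant R, of y]
      by (simp add: b_def row_mult_diff_left)
  qed
  define M1 where "M1 = 2 * (exp exponent_bound * exponent_bound) * rate_bound"
  have b_l1: "l1_norm (b l u) \<le> \<bar>l\<bar> * M1" if "\<bar>l\<bar> \<le> 1" "0 \<le> u" for l u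
  proof -
    have "l1_norm (generator (\<lambda>x y. (exp (l * (\<tau> u * E x y)) - 1) * r x y) x) \<le> \<bar>l\<bar> * M1" for x
      using weighted_generator_bound[of "\<lambda>x y. exp (l * (\<tau> u * E x y)) - 1" x, OF exp_first_order[OF that(1)]]
      by (simp add: M1_def mult_ac)
    from l1_norm_row_mult_le[OF this, of "p l u"] show ?thesis
      using that by (simp add: b_eq[abs_def] p_l1)
  qed
  define M2 where "M2 = M1 * (K / \<kappa>)"
  have first: "\<bar>p l t y - m y\<bar> \<le> \<bar>l\<bar> * M2" if l: "\<bar>l\<bar> \<le> 1" and t: "0 \<le> t" for l t y
  proof (rule LIMSEQ_le_const)
    have "(\<lambda>n. e (t + real n * T) + \<bar>l\<bar> * M2) \<longlonglongrightarrow> 0 + \<bar>l\<bar> * M2"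
      by (intro tendsto_add e_lim tendsto_const)
    then show "(\<lambda>n. e (t + real n * T) + \<bar>l\<bar> * M2) \<longlonglongrightarrow> \<bar>l\<bar> * M2" by simp
    have "\<bar>p l t y - m y\<bar> \<le> e (t + real n * T) + \<bar>l\<bar> * M2" for n
    proof -
      have R: "0 \<le> t + real n * T" using t T_pos by simp
      have "\<bar>LBINT u:{0..t + real n * T}. row_mult (b l u) (S (t + real n * T - u)) y\<bar> \<le> \<bar>l\<bar> * M1 * (K / \<kappa>)"
        by (rule duhamel_bound[OF decay K R b_int[OF t] b_mass b_l1[OF l]]) auto
      then show ?thesis using expansion[OF t, of l y n] e[OF R, of l y] by (simp add: M2_def)
    qed
    then show "\<exists>N. \<forall>n\<ge>N. \<bar>p l t y - m y\<bar> \<le> e (t + real n * T) + \<bar>l\<bar> * M2" by blast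
  qed
  \<comment> \<open>The first summand is the second-order remainder of the exponential in the rates.
    The second is the cost of replacing the law by \<open>m\<close> in the first-order term:
    \<open>M2\<close> bounds the entries of the difference, and \<open>CARD('x)\<close> passes from
    entries to the l1 norm.\<close>
  define M3 where "M3 = 2 * (exp exponent_bound * exponent_bound\<^sup>2) * rate_bound
      + B * (2 * (\<Sum>x\<in>UNIV. l1_norm (E x)) * rate_bound * (real CARD('x) * M2))"
  \<comment> \<open>\<open>c l u\<close> is the source term without its first-order part taken at
    the invariant law; it still has mass zero, so \<open>duhamel_bound\<close> applies to it
    again.\<close>
  define c where "c l u = (\<lambda>z. b l u z - l * \<tau> u * \<beta> z)" for l u
  have c_mass: "(\<Sum>z\<in>UNIV. c l u z) = 0" for l u
    by (simp add: c_def sum_subtractf b_mass \<beta>_mass flip: sum_distrib_left)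
  have c_l1: "l1_norm (c l u) \<le> l\<^sup>2 * M3" if l: "\<bar>l\<bar> \<le> 1" and u: "0 \<le> u" for l u
  proof -
    let ?G = "generator (\<lambda>x y. (exp (l * (\<tau> u * E x y)) - 1 - l * (\<tau> u * E x y)) * r x y)"
    have "generator (\<lambda>x y. (exp (l * (\<tau> u * E x y)) - 1) * r x y) x y = ?G x y + l * \<tau> u * L' x y" for x y
      unfolding L'_def generator_scale
      by (subst diff_eq_eq[symmetric], subst generator_diff) (simp add: algebra_simps)
    then have "c l u z = row_mult (p l u) ?G z + l * \<tau> u * row_mult (\<lambda>x. p l u x - m x) L' z" for z
      by (simp add: c_def b_eq \<beta>_def row_mult_diff_left)
         (simp add: row_mult_def sum.distrib sum_distrib_left algebra_simps)
    then have "l1_norm (c l u) \<le> l1_norm (row_mult (p l u) ?G) + l1_norm (\<lambda>z. l * \<tau> u * row_mult (\<lambda>x. p l u x - m x) L' z)"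
      using l1_norm_triangle[of "row_mult (p l u) ?G" "\<lambda>z. l * \<tau> u * row_mult (\<lambda>x. p l u x - m x) L' z"]
      by (metis (no_types, lifting) ext)
    also have "l1_norm (row_mult (p l u) ?G) \<le> l\<^sup>2 * (2 * (exp exponent_bound * exponent_bound\<^sup>2) * rate_bound)"
    proof -
      have "l1_norm (?G x) \<le> l\<^sup>2 * (2 * (exp exponent_bound * exponent_bound\<^sup>2) * rate_bound)" for x
        using weighted_generator_bound[of "\<lambda>x y. exp (l * (\<tau> u * E x y)) - 1 - l * (\<tau> u * E x y)" x, OF exp_second_order[OF l]]
        by (simp add: mult_ac)
      from l1_norm_row_mult_le[OF this, of "p l u"] show ?thesis using u by (simp add: p_l1)
    qed
    also have "l1_norm (\<lambda>z. l * \<tau> u * row_mult (\<lambda>x. p l u x - m x) L' z)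
        \<le> \<bar>l\<bar> * B * (2 * (\<Sum>x\<in>UNIV. l1_norm (E x)) * rate_bound * (real CARD('x) * (\<bar>l\<bar> * M2)))"
    proof -
      have "l1_norm (L' x) \<le> 2 * (\<Sum>x\<in>UNIV. l1_norm (E x)) * rate_bound" for x
        unfolding L'_def by (rule weighted_generator_bound[OF E_bound])
      then have "l1_norm (row_mult (\<lambda>x. p l u x - m x) L')
          \<le> 2 * (\<Sum>x\<in>UNIV. l1_norm (E x)) * rate_bound * l1_norm (\<lambda>x. p l u x - m x)"
        by (rule l1_norm_row_mult_le)
      also have "\<dots> \<le> 2 * (\<Sum>x\<in>UNIV. l1_norm (E x)) * rate_bound * (real CARD('x) * (\<bar>l\<bar> * M2))"
      proof (rule mult_left_mono)
        show "l1_norm (\<lambda>x. p l u x - m x) \<le> real CARD('x) * (\<bar>l\<bar> * M2)"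
          unfolding l1_norm_def using sum_bounded_above[of UNIV "\<lambda>x. \<bar>p l u x - m x\<bar>"] first[OF l u] by simp
        show "0 \<le> 2 * (\<Sum>x\<in>UNIV. l1_norm (E x)) * rate_bound"
          by (intro mult_nonneg_nonneg sum_nonneg rate_bound_nonneg) auto
      qed
      finally show ?thesis
        unfolding l1_norm_scale abs_mult using B_nonneg by (intro mult_mono \<tau>_bound) auto
    qed
    also have "l\<^sup>2 * (2 * (exp exponent_bound * exponent_bound\<^sup>2) * rate_bound)
        + \<bar>l\<bar> * B * (2 * (\<Sum>x\<in>UNIV. l1_norm (E x)) * rate_bound * (real CARD('x) * (\<bar>l\<bar> * M2))) = l\<^sup>2 * M3"
      by (simp add: M3_def algebra_simps power2_eq_square flip: abs_mult)
    finally show ?thesis by simp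
  qed
  have "\<bar>p l t y - m y - l * response t y\<bar> \<le> M3 * (K / \<kappa>) * l\<^sup>2" if l: "\<bar>l\<bar> \<le> 1" and t: "0 \<le> t" for l t y
  proof (rule LIMSEQ_le)
    let ?D = "\<lambda>n. LBINT u:{0..t + real n * T}. \<tau> u * row_mult \<beta> (S (t + real n * T - u)) y"
    show "(\<lambda>n. \<bar>p l t y - m y - l * ?D n\<bar>) \<longlonglongrightarrow> \<bar>p l t y - m y - l * response t y\<bar>"
      by (intro tendsto_intros response_limit)
    have "(\<lambda>n. e (t + real n * T) + M3 * (K / \<kappa>) * l\<^sup>2) \<longlonglongrightarrow> 0 + M3 * (K / \<kappa>) * l\<^sup>2"
      by (intro tendsto_add e_lim tendsto_const)
    then show "(\<lambda>n. e (t + real n * T) + M3 * (K / \<kappa>) * l\<^sup>2) \<longlonglongrightarrow> M3 * (K / \<kappa>) * l\<^sup>2" by simp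
    have "\<bar>p l t y - m y - l * ?D n\<bar> \<le> e (t + real n * T) + M3 * (K / \<kappa>) * l\<^sup>2" for n
    proof -
      define R where "R = t + real n * T"
      have R: "0 \<le> R" using t T_pos by (simp add: R_def)
      have D_int: "set_integrable lborel {0..R} (\<lambda>u. \<tau> u * row_mult \<beta> (S (R - u)) y)"
      proof -
        have "set_integrable lborel {0..R} (\<lambda>s. \<tau> (R - s) * row_mult \<beta> (S s) y)"
          by (rule set_integrable_subset[OF response_integrable'[of R]]) auto
        then show ?thesis by (subst (asm) set_integral_reflect_Icc(2)[of _ _ _ R]) simp
      qed
      have b_int': "set_integrable lborel {0..R} (\<lambda>u. row_mult (b l u) (S (R - u)) y)"
        unfolding R_def by (rule b_int[OF t])
      have c_eq: "row_mult (c l u) (S (R - u)) y = row_mult (b l u) (S (R - u)) y - l * (\<tau> u * row_mult \<beta> (S (R - u)) y)" for u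
        unfolding c_def by (simp add: row_mult_diff_left row_mult_scale_left mult.assoc)
      have c_int: "set_integrable lborel {0..R} (\<lambda>u. row_mult (c l u) (S (R - u)) y)"
        unfolding c_eq using b_int' D_int by (intro set_integral_diff(1)) auto
      have "(LBINT u:{0..R}. row_mult (c l u) (S (R - u)) y) =
          (LBINT u:{0..R}. row_mult (b l u) (S (R - u)) y) - l * (LBINT u:{0..R}. \<tau> u * row_mult \<beta> (S (R - u)) y)"
        unfolding c_eq using b_int' D_int by (subst set_integral_diff(2)) auto
      moreover have "\<bar>LBINT u:{0..R}. row_mult (c l u) (S (R - u)) y\<bar> \<le> l\<^sup>2 * M3 * (K / \<kappa>)"
        by (rule duhamel_bound[OF decay K R c_int c_mass c_l1[OF l]]) auto
      ultimately show ?thesis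
        using expansion[OF t, of l y n] e[OF R, of l y] unfolding R_def[symmetric] by (simp add: mult_ac)
    qed
    then show "\<exists>N. \<forall>n\<ge>N. \<bar>p l t y - m y - l * ?D n\<bar> \<le> e (t + real n * T) + M3 * (K / \<kappa>) * l\<^sup>2" by blast
  qed
  then show ?thesis by blast
qed

end

section \<open>Laws of jump processes\<close>

lemma (in prob_space) expectation_finite_valued:
  fixes Z :: "'a \<Rightarrow> 'z::finite" and h :: "'z \<Rightarrow> real"
  assumes [measurable]: "\<And>z. {w \<in> space M. Z w = z} \<in> sets M"
  shows "integrable M (\<lambda>w. h (Z w))"
    and "(LINT w|M. h (Z w)) = (\<Sum>z\<in>UNIV. h z * prob {w \<in> space M. Z w = z})"
proof -
  have eq: "h (Z w) = (\<Sum>z\<in>UNIV. h z * indicator {w \<in> space M. Z w = z} w)" if "w \<in> space M" for w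
    using that by (simp add: indicator_def of_bool_def if_distrib[of "(*) _"] cong: if_cong)
  have i: "integrable M (\<lambda>w. h z * indicator {w \<in> space M. Z w = z} w)" for z
    by (intro integrable_mult_right integrable_real_indicator) (auto simp: emeasure_eq_measure)
  have "integrable M (\<lambda>w. \<Sum>z\<in>UNIV. h z * indicator {w \<in> space M. Z w = z} w)"
    by (rule Bochner_Integration.integrable_sum[OF i])
  then show "integrable M (\<lambda>w. h (Z w))"
    by (subst Bochner_Integration.integrable_cong[OF refl eq]) auto
  have "(LINT w|M. h (Z w)) = (LINT w|M. (\<Sum>z\<in>UNIV. h z * indicator {w \<in> space M. Z w = z} w))"
    by (rule Bochner_Integration.integral_cong[OF refl eq])
  also have "\<dots> = (\<Sum>z\<in>UNIV. h z * prob {w \<in> space M. Z w = z})"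
    by (subst Bochner_Integration.integral_sum[OF i]) (simp add: Int_absorb2 subset_eq)
  finally show "(LINT w|M. h (Z w)) = (\<Sum>z\<in>UNIV. h z * prob {w \<in> space M. Z w = z})" .
qed

text \<open>Instantiated for the unperturbed process with constant rates and for each perturbed
  process. The bound \<open>K\<close> may then depend on \<open>l\<close>.\<close>

locale jump_process =
  fixes q :: "real \<Rightarrow> 'x::finite \<Rightarrow> 'x \<Rightarrow> real" and P and \<nu> :: "'x pmf" and M :: "'w measure" and X and K :: real
  assumes process: "markov_jump_process q P \<nu> M X"
    and q_measurable [measurable]: "\<And>x y. (\<lambda>u. q u x y) \<in> borel_measurable borel"
    and q_nonneg: "\<And>u x y. 0 \<le> q u x y"
    and generator_bound: "\<And>u x. l1_norm (generator (q u) x) \<le> K"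
begin

lemma prob_space_M: "prob_space M"
  using process by (simp add: markov_jump_process_def)

sublocale prob_space M by (rule prob_space_M)

lemma transition: "transition_function q P"
  using process by (simp add: markov_jump_process_def)

lemma P_nonneg: "0 \<le> s \<Longrightarrow> s \<le> t \<Longrightarrow> 0 \<le> P s t x y"
  and P_mass: "0 \<le> s \<Longrightarrow> s \<le> t \<Longrightarrow> (\<Sum>y\<in>UNIV. P s t x y) = 1"
  and P_integrable: "0 \<le> s \<Longrightarrow> s \<le> t \<Longrightarrow> set_integrable lborel {s..t} (\<lambda>u. row_mult (P s u x) (generator (q u)) y)"
  and P_eq: "0 \<le> s \<Longrightarrow> s \<le> t \<Longrightarrow> P s t x y = (if x = y then 1 else 0) + (LBINT u:{s..t}. row_mult (P s u x) (generator (q u)) y)"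
  using transition unfolding transition_function_def row_mult_def by blast+

lemma P_l1: "0 \<le> s \<Longrightarrow> s \<le> t \<Longrightarrow> l1_norm (P s t x) = 1"
  using P_nonneg P_mass by (simp add: l1_norm_def)

lemma P_0_0: "P 0 0 x y = (if x = y then 1 else 0)"
proof -
  have "P 0 0 x y = (if x = y then 1 else 0) + (LBINT u:{0..0}. row_mult (P 0 u x) (generator (q u)) y)"
    by (rule P_eq) auto
  then show ?thesis by (simp only: set_integral_Icc_refl add_0_right)
qed

lemma X_measurable [measurable]: "0 \<le> t \<Longrightarrow> X t \<in> measurable M (count_space UNIV)"
  using process by (simp add: markov_jump_process_def)

lemma X_path: "w \<in> space M \<Longrightarrow> jump_path (\<lambda>t. X t w)"
  using process by (simp add: markov_jump_process_def)

lemma X_event [measurable]: "0 \<le> t \<Longrightarrow> {w \<in> space M. X t w = x} \<in> sets M"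
  using measurable_sets[OF X_measurable, of t "{x}"] by (simp add: vimage_def Int_def conj_commute)

lemma X_pair_event [measurable]:
  assumes "0 \<le> s" "0 \<le> t"
  shows "{w \<in> space M. X s w = x \<and> X t w = y} \<in> sets M"
proof -
  have "{w \<in> space M. X s w = x \<and> X t w = y} = {w \<in> space M. X s w = x} \<inter> {w \<in> space M. X t w = y}" by auto
  then show ?thesis using X_event assms by simp
qed

text \<open>Built from \<open>P\<close> and not from \<open>M\<close>, so that the forward equation
  is inherited by linearity; \<open>law_eq\<close> identifies it with the distribution of
  \<open>X t\<close>.\<close>

definition law :: "real \<Rightarrow> 'x \<Rightarrow> real" where
  "law t = row_mult (pmf \<nu>) (P 0 t)"

lemma markov:
  assumes "0 \<le> s" "s \<le> t"
  shows "prob {w \<in> space M. X s w = x \<and> X t w = y} = prob {w \<in> space M. X s w = x} * P s t x y"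
proof -
  have "space M \<in> past_events M X s"
    unfolding past_events_def by (rule sigma_sets_top)
  then have "measure M (space M \<inter> {w \<in> space M. X s w = x \<and> X t w = y}) =
      measure M (space M \<inter> {w \<in> space M. X s w = x}) * P s t x y"
    using process assms unfolding markov_jump_process_def by blast
  then show ?thesis by (simp add: Int_def)
qed

lemma joint_law:
  assumes "0 \<le> t"
  shows "prob {w \<in> space M. X 0 w = x \<and> X t w = y} = pmf \<nu> x * P 0 t x y"
  using markov[of 0 t x y] assms process by (simp add: markov_jump_process_def)

lemma law_eq:
  assumes "0 \<le> t"
  shows "prob {w \<in> space M. X t w = y} = law t y"
proof -
  have "prob {w \<in> space M. X t w = y} = prob (\<Union>x. {w \<in> space M. X 0 w = x \<and> X t w = y})"
    by (rule arg_cong[of _ _ prob]) auto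
  also have "\<dots> = (\<Sum>x\<in>UNIV. prob {w \<in> space M. X 0 w = x \<and> X t w = y})"
    by (rule finite_measure_finite_Union) (use assms in \<open>auto simp: disjoint_family_on_def\<close>)
  also have "\<dots> = law t y" using assms by (simp add: joint_law law_def row_mult_def)
  finally show ?thesis .
qed

lemma markov_law:
  assumes "0 \<le> s" "s \<le> t"
  shows "prob {w \<in> space M. X s w = x \<and> X t w = y} = law s x * P s t x y"
  using markov[OF assms] law_eq[OF assms(1)] by simp

lemma law_nonneg: "0 \<le> t \<Longrightarrow> 0 \<le> law t y"
  unfolding law_def row_mult_def by (intro sum_nonneg mult_nonneg_nonneg P_nonneg) auto

lemma law_mass: "0 \<le> t \<Longrightarrow> (\<Sum>y\<in>UNIV. law t y) = 1"
  unfolding law_def sum_row_mult by (simp add: P_mass sum_pmf_eq_1)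

lemma law_le_1: "0 \<le> t \<Longrightarrow> law t y \<le> 1"
  using law_eq[of t y] prob_le_1 by metis

lemma law_0: "law 0 y = pmf \<nu> y"
  by (simp add: law_def row_mult_def P_0_0 if_distrib[of "(*) _"] cong: if_cong)

lemma law_flow: "linear_flow (\<lambda>u. generator (q u)) law"
  using linear_flow_sum[of UNIV "\<lambda>u. generator (q u)" "\<lambda>x t. P 0 t x" "pmf \<nu>"]
    transition_function_linear_flow[OF transition]
  by (simp add: law_def[abs_def] row_mult_def[abs_def])

lemma law_l1: "0 \<le> t \<Longrightarrow> l1_norm (law t) = 1"
  using law_nonneg law_mass by (simp add: l1_norm_def)

lemma law_measurable: "(\<lambda>t. indicator {0..} t * law t y) \<in> borel_measurable borel"
  by (rule linear_flow_measurable[OF law_flow])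

section \<open>Correlations and time integrals\<close>

lemma expectation_at:
  assumes "0 \<le> t"
  shows "integrable M (\<lambda>w. h (X t w))" "(LINT w|M. h (X t w)) = (\<Sum>x\<in>UNIV. h x * law t x)"
  using expectation_finite_valued[of "X t" h] X_event[OF assms] by (simp_all add: law_eq[OF assms])

text \<open>A factor that depends on \<open>X 0\<close> tilts the initial law: the correlation is an
  expectation under the evolution of the signed row \<open>pmf \<nu> x * k x\<close>.\<close>

lemma correlation:
  assumes "0 \<le> t"
  shows "(LINT w|M. h (X t w) * k (X 0 w)) = (\<Sum>y\<in>UNIV. h y * row_mult (\<lambda>x. pmf \<nu> x * k x) (P 0 t) y)"
proof -
  have ev: "{w \<in> space M. (X 0 w, X t w) = z} = {w \<in> space M. X 0 w = fst z \<and> X t w = snd z}" for z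
    by auto
  have "(LINT w|M. (\<lambda>z. h (snd z) * k (fst z)) (X 0 w, X t w)) =
      (\<Sum>z\<in>UNIV. (h (snd z) * k (fst z)) * prob {w \<in> space M. (X 0 w, X t w) = z})"
    by (rule expectation_finite_valued) (use assms in \<open>simp add: ev\<close>)
  also have "\<dots> = (\<Sum>z\<in>UNIV \<times> UNIV. h (snd z) * k (fst z) * (pmf \<nu> (fst z) * P 0 t (fst z) (snd z)))"
    unfolding ev joint_law[OF assms] by simp
  also have "\<dots> = (\<Sum>x\<in>UNIV. \<Sum>y\<in>UNIV. h y * k x * (pmf \<nu> x * P 0 t x y))"
    by (subst sum.cartesian_product) (simp add: case_prod_unfold)
  also have "\<dots> = (\<Sum>y\<in>UNIV. h y * row_mult (\<lambda>x. pmf \<nu> x * k x) (P 0 t) y)"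
    by (subst sum.swap) (simp add: row_mult_def sum_distrib_left mult_ac)
  finally show ?thesis by simp
qed

text \<open>Time is rounded to a grid point on its right. The rounded process is jointly measurable,
  as the grid is countable, and by right-continuity in the discrete topology it is eventually equal
  to \<open>X\<close> along each path.\<close>

lemma X_jointly_measurable:
  "(\<lambda>z. indicat_real {0..} (snd z) * indicat_real {x} (X (snd z) (fst z))) \<in> borel_measurable (M \<Otimes>\<^sub>M lborel)"
proof (rule borel_measurable_LIMSEQ_real)
  \<comment> \<open>The added 1 puts \<open>g n s\<close> strictly to the right of \<open>s\<close>,
    so that right-continuity applies.\<close>
  define g where "g n s = (real (nat \<lfloor>real (Suc n) * s\<rfloor>) + 1) / real (Suc n)" for n s
  show "(\<lambda>z. indicat_real {0..} (snd z) * indicat_real {x} (X (g n (snd z)) (fst z))) \<in> borel_measurable (M \<Otimes>\<^sub>M lborel)" for n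
  proof -
    have [measurable]: "X ((real k + 1) / real (Suc n)) \<in> measurable M (count_space UNIV)" for k
      by (rule X_measurable) simp
    have "(\<lambda>z. (\<lambda>k z. indicator {x} (X ((real k + 1) / real (Suc n)) (fst z)) :: real) (nat \<lfloor>real (Suc n) * snd z\<rfloor>) z)
        \<in> borel_measurable (M \<Otimes>\<^sub>M lborel)"
      by (rule measurable_compose_countable) measurable
    then have [measurable]: "(\<lambda>z. indicator {x} (X (g n (snd z)) (fst z)) :: real) \<in> borel_measurable (M \<Otimes>\<^sub>M lborel)"
      by (simp add: g_def)
    show ?thesis by measurable
  qed
  fix z assume z: "z \<in> space (M \<Otimes>\<^sub>M (lborel :: real measure))"
  obtain w s where ws: "z = (w, s)" "w \<in> space M" using z by (auto simp: space_pair_measure)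
  show "(\<lambda>n. indicat_real {0..} (snd z) * indicat_real {x} (X (g n (snd z)) (fst z)))
      \<longlonglongrightarrow> indicat_real {0..} (snd z) * indicat_real {x} (X (snd z) (fst z))"
  proof (cases "0 \<le> s")
    case True
    have bounds: "s < g n s \<and> g n s \<le> s + 1 / real (Suc n)" for n
    proof -
      have "real (nat \<lfloor>real (Suc n) * s\<rfloor>) \<le> real (Suc n) * s" "real (Suc n) * s < real (nat \<lfloor>real (Suc n) * s\<rfloor>) + 1"
        using True by (auto intro: of_nat_floor simp del: of_nat_Suc)
      then show ?thesis by (simp add: g_def field_simps del: of_nat_Suc)
    qed
    have "(\<lambda>n. g n s) \<longlonglongrightarrow> s"
    proof (rule tendsto_sandwich[of "\<lambda>_. s" _ _ "\<lambda>n. s + 1 / real (Suc n)"])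
      show "(\<lambda>n. s + 1 / real (Suc n)) \<longlonglongrightarrow> s"
        using tendsto_add[OF tendsto_const LIMSEQ_inverse_real_of_nat, of s] by (simp add: divide_inverse)
      show "\<forall>\<^sub>F n in sequentially. s \<le> g n s" "\<forall>\<^sub>F n in sequentially. g n s \<le> s + 1 / real (Suc n)"
        using bounds by (auto intro!: always_eventually less_imp_le)
    qed simp
    then have "filterlim (\<lambda>n. g n s) (at_right s) sequentially"
      using less_imp_neq[OF conjunct1[OF bounds], symmetric] bounds
      by (auto simp: filterlim_at intro!: always_eventually)
    moreover have "\<forall>\<^sub>F u in at_right s. X u w = X s w"
      using X_path[OF ws(2)] True by (simp add: jump_path_def)
    ultimately have "\<forall>\<^sub>F n in sequentially. X (g n s) w = X s w"
      by (auto simp: filterlim_iff)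
    then show ?thesis unfolding ws by (auto intro!: tendsto_eventually elim!: eventually_mono)
  qed (simp add: ws)
qed

lemma expectation_time_integral:
  assumes v: "\<And>x. set_integrable lborel {0..t} (\<lambda>s. v s x)"
  shows "integrable M (\<lambda>w. LBINT s:{0..t}. v s (X s w))"
    and "(LINT w|M. (LBINT s:{0..t}. v s (X s w))) = (LBINT s:{0..t}. (\<Sum>x\<in>UNIV. v s x * law s x))"
proof -
  interpret MX: pair_sigma_finite M "lborel :: real measure" ..
  \<comment> \<open>The integrand is split by the value of \<open>X s w\<close>, since
    \<open>v\<close> is controlled as a function of time only for each fixed state. The factor
    \<open>indicator {0..} s\<close> brings in the jointly measurable form.\<close>
  define I where "I x w s = (indicator {0..t} s * v s x) * (indicator {0..} s * indicator {x} (X s w))" for x w s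
  have [measurable]: "(\<lambda>s. indicator {0..t} s * v s x) \<in> borel_measurable borel" for x
    using v[of x] by (auto simp: set_integrable_def dest: borel_measurable_integrable)
  have [measurable]: "(\<lambda>z. indicator {0..} (snd z) * indicator {x} (X (snd z) (fst z)) :: real) \<in> borel_measurable (M \<Otimes>\<^sub>M lborel)" for x
    by (rule X_jointly_measurable)
  have int: "integrable (M \<Otimes>\<^sub>M lborel) (\<lambda>(w, s). I x w s)" for x
  proof (rule Bochner_Integration.integrable_bound)
    show "integrable (M \<Otimes>\<^sub>M lborel) (\<lambda>(w, s). indicator {0..t} s * v s x)"
      by (rule MX.Fubini_integrable) (use v[of x] in \<open>auto simp: case_prod_unfold set_integrable_def\<close>)
    show "(\<lambda>(w, s). I x w s) \<in> borel_measurable (M \<Otimes>\<^sub>M lborel)"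
      unfolding I_def case_prod_unfold by measurable
    show "AE z in M \<Otimes>\<^sub>M lborel. norm (case z of (w, s) \<Rightarrow> I x w s) \<le> norm (case z of (w, s) \<Rightarrow> indicator {0..t} s * v s x)"
      by (intro AE_I2) (auto simp: I_def indicator_def)
  qed
  have int_sum: "integrable (M \<Otimes>\<^sub>M lborel) (\<lambda>(w, s). \<Sum>x\<in>UNIV. I x w s)"
    using int by (simp add: case_prod_unfold)
  have I_sum: "(\<Sum>x\<in>UNIV. I x w s) = indicator {0..t} s *\<^sub>R v s (X s w)" for w s
  proof -
    have "(\<Sum>x\<in>UNIV. I x w s) = (\<Sum>x\<in>UNIV. if X s w = x then indicator {0..t} s * v s x else 0)"
      unfolding I_def by (intro sum.cong) (auto simp: indicator_def)
    then show ?thesis by simp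
  qed
  show "integrable M (\<lambda>w. LBINT s:{0..t}. v s (X s w))"
    using MX.integrable_fst[OF int_sum] unfolding I_sum set_lebesgue_integral_def .
  have "(LINT w|M. (LBINT s:{0..t}. v s (X s w))) = (LINT w|M. (LBINT s. (\<Sum>x\<in>UNIV. I x w s)))"
    unfolding I_sum set_lebesgue_integral_def ..
  also have "\<dots> = (LBINT s. (LINT w|M. (\<Sum>x\<in>UNIV. I x w s)))"
    by (rule MX.Fubini_integral[OF int_sum, symmetric])
  also have "\<dots> = (LBINT s:{0..t}. (\<Sum>x\<in>UNIV. v s x * law s x))"
    unfolding set_lebesgue_integral_def I_sum
  proof (rule Bochner_Integration.integral_cong[OF refl])
    fix s :: real
    show "(LINT w|M. indicator {0..t} s *\<^sub>R v s (X s w)) = indicator {0..t} s *\<^sub>R (\<Sum>x\<in>UNIV. v s x * law s x)"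
      using expectation_at(2)[of s "v s"] by (cases "s \<in> {0..t}") auto
  qed
  finally show "(LINT w|M. (LBINT s:{0..t}. v s (X s w))) = (LBINT s:{0..t}. (\<Sum>x\<in>UNIV. v s x * law s x))" .
qed

end

section \<open>Jumps of a path\<close>

lemma left_value_eq:
  assumes "\<forall>\<^sub>F u in at_left s. f u = x"
  shows "left_value f s = x"
  unfolding left_value_def
proof (rule the_equality)
  show "\<forall>\<^sub>F u in at_left s. f u = x" by fact
  fix y assume "\<forall>\<^sub>F u in at_left s. f u = y"
  with assms have "\<forall>\<^sub>F u in at_left s. y = x" by eventually_elim simp
  then show "y = x" by (simp add: eventually_const trivial_limit_at_left_real)
qed

lemma left_value_eqI:
  assumes "a < s" "\<And>u. a < u \<Longrightarrow> u < s \<Longrightarrow> f u = x"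
  shows "left_value f s = x"
  by (rule left_value_eq) (use assms in \<open>auto simp: eventually_at_left_field\<close>)

text \<open>Jumps only if \<open>x\<close> and \<open>y\<close> differ; for \<open>x = y\<close> the
  set collects times at which the path does not jump. Hence the index sets \<open>- {x}\<close>
  below.\<close>

definition jumps :: "(real \<Rightarrow> 'x) \<Rightarrow> 'x \<Rightarrow> 'x \<Rightarrow> real set" where
  "jumps f x y = {s. 0 < s \<and> left_value f s = x \<and> f s = y}"

text \<open>The path is constant on either side of \<open>c\<close>, with \<open>c\<close> belonging
  to the right side, so \<open>c\<close> is the only possible jump nearby. At \<open>c = 0\<close>
  the left side is vacuous.\<close>

lemma jump_path_local:
  assumes f: "jump_path f" and c: "0 \<le> c"
  shows "\<exists>d>0. \<exists>x. (\<forall>u. c \<le> u \<and> u < c + d \<longrightarrow> f u = f c) \<and> (\<forall>u. 0 \<le> u \<and> c - d < u \<and> u < c \<longrightarrow> f u = x)"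
proof -
  obtain d1 where d1: "d1 > c" "\<And>u. c < u \<Longrightarrow> u < d1 \<Longrightarrow> f u = f c"
    using f c unfolding jump_path_def eventually_at_right_field by blast
  obtain d2 x where d2: "d2 < c" "\<And>u. 0 \<le> u \<Longrightarrow> d2 < u \<Longrightarrow> u < c \<Longrightarrow> f u = x"
  proof (cases "c = 0")
    case True
    then show ?thesis using that[of "- 1"] by simp
  next
    case False
    then obtain x where "\<forall>\<^sub>F u in at_left c. f u = x" using f c unfolding jump_path_def by force
    then obtain d2 where "d2 < c" "\<And>u. d2 < u \<Longrightarrow> u < c \<Longrightarrow> f u = x"
      unfolding eventually_at_left_field by blast
    then show ?thesis using that by blast
  qed
  define d where "d = min (d1 - c) (c - d2)"
  have "d > 0" using d1 d2 by (simp add: d_def)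
  moreover have "f u = f c" if "c \<le> u \<and> u < c + d" for u
    using d1(2)[of u] that by (cases "u = c") (auto simp: d_def)
  moreover have "f u = x" if "0 \<le> u \<and> c - d < u \<and> u < c" for u
    using d2(2)[of u] that by (auto simp: d_def)
  ultimately show ?thesis by blast
qed

text \<open>By compactness, the path has at most one jump in each sufficiently short subinterval.\<close>

lemma jump_path_mesh:
  assumes f: "jump_path f" and a: "0 \<le> a"
  shows "\<exists>d>0. \<forall>u v. a \<le> u \<and> u < v \<and> v \<le> b \<and> v - u < d \<longrightarrow>
    (\<forall>x y. x \<noteq> y \<longrightarrow> finite (jumps f x y \<inter> {u<..v}) \<and>
      card (jumps f x y \<inter> {u<..v}) = (if f u = x \<and> f v = y then 1 else 0))"
proof -
  obtain d l where d: "\<And>c. 0 \<le> c \<Longrightarrow> d c > 0"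
    and right: "\<And>c u. 0 \<le> c \<Longrightarrow> c \<le> u \<Longrightarrow> u < c + d c \<Longrightarrow> f u = f c"
    and left: "\<And>c u. 0 \<le> c \<Longrightarrow> 0 \<le> u \<Longrightarrow> c - d c < u \<Longrightarrow> u < c \<Longrightarrow> f u = l c"
    using jump_path_local[OF f] by metis
  \<comment> \<open>Balls in which only the centre can be a jump time. The Lebesgue number of this
    cover is the required mesh.\<close>
  define \<G> where "\<G> = (\<lambda>c. ball c (d c)) ` {a..b}"
  have "{a..b} \<subseteq> \<Union>\<G>" using d a by (auto simp: \<G>_def intro!: bexI)
  then obtain e where e: "e > 0" "\<And>x. x \<in> {a..b} \<Longrightarrow> \<exists>G\<in>\<G>. ball x e \<subseteq> G"
    by (rule Heine_Borel_lemma[OF compact_Icc]) (auto simp: \<G>_def)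
  have "finite (jumps f x y \<inter> {u<..v}) \<and> card (jumps f x y \<inter> {u<..v}) = (if f u = x \<and> f v = y then 1 else 0)"
    if uv: "a \<le> u" "u < v" "v \<le> b" "v - u < e" and xy: "x \<noteq> y" for u v x y
  proof -
    obtain c where c: "c \<in> {a..b}" "ball u e \<subseteq> ball c (d c)"
      using e(2)[of u] uv by (auto simp: \<G>_def)
    have c0: "0 \<le> c" using c a by auto
    have near: "c - d c < s" "s < c + d c" if "s \<in> {u..v}" for s
    proof -
      have "s \<in> ball u e" using that uv by (auto simp: dist_real_def)
      then have "s \<in> ball c (d c)" using c by blast
      then show "c - d c < s" "s < c + d c" by (auto simp: dist_real_def)
    qed
    \<comment> \<open>At any point other than the centre, the path is constant on a left
      neighbourhood that includes the point.\<close>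
    have const: "left_value f s = f s" if s: "s \<in> {u<..v}" "s \<noteq> c" for s
    proof (cases "s < c")
      case True
      have "left_value f s = l c"
        by (rule left_value_eqI[of "max u 0"]) (use s True uv a near[of s] near[of u] c0 in \<open>auto intro!: left\<close>)
      also have "\<dots> = f s" using left[of c s] near[of s] s True c0 uv a by auto
      finally show ?thesis .
    next
      case False
      then have "c < s" using s by simp
      have "left_value f s = f c"
        by (rule left_value_eqI[of c]) (use \<open>c < s\<close> near[of s] s c0 in \<open>auto intro!: right\<close>)
      also have "\<dots> = f s" using right[of c s] near[of s] s \<open>c < s\<close> c0 by auto
      finally show ?thesis .
    qed
    show ?thesis
    proof (cases "c \<in> {u<..v}")
      case True
      have "left_value f c = l c"
        by (rule left_value_eqI[of u]) (use True uv a near[of u] c0 in \<open>auto intro!: left\<close>)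
      moreover have "f u = l c" using left[of c u] near[of u] True uv a c0 by auto
      moreover have "f v = f c" using right[of c v] near[of v] True c0 by auto
      moreover have "s = c" if "s \<in> jumps f x y \<inter> {u<..v}" for s
        using that const[of s] xy unfolding jumps_def by blast
      moreover have "0 < c" using True uv a by auto
      ultimately have "jumps f x y \<inter> {u<..v} = (if f u = x \<and> f v = y then {c} else {})"
        using True by (auto simp: jumps_def)
      then show ?thesis by simp
    next
      case False
      have "f u = f v"
      proof (cases "c \<le> u")
        case True
        then show ?thesis using right[of c u] right[of c v] near[of u] near[of v] uv c0 by auto
      next
        case F: False
        then show ?thesis using False left[of c u] left[of c v] near[of u] near[of v] uv a c0 by auto
      qed
      moreover have "jumps f x y \<inter> {u<..v} = {}"
        using const xy False by (auto simp: jumps_def)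
      ultimately show ?thesis using xy by auto
    qed
  qed
  then show ?thesis using e(1) by blast
qed

section \<open>Sampling a path along a grid\<close>

definition grid :: "real \<Rightarrow> real \<Rightarrow> nat \<Rightarrow> nat \<Rightarrow> real" where
  "grid a b n k = a + real k * ((b - a) / real n)"

lemma grid_0 [simp]: "grid a b n 0 = a"
  by (simp add: grid_def)

lemma grid_end [simp]: "0 < n \<Longrightarrow> grid a b n n = b"
  by (simp add: grid_def)

lemma grid_Suc: "grid a b n (Suc k) = grid a b n k + (b - a) / real n"
  by (simp add: grid_def add_divide_distrib distrib_right)

lemma grid_less: "a < b \<Longrightarrow> 0 < n \<Longrightarrow> grid a b n k < grid a b n (Suc k)"
  by (simp add: grid_Suc)

lemma grid_mono: "a < b \<Longrightarrow> j \<le> k \<Longrightarrow> grid a b n j \<le> grid a b n k"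
  by (simp add: grid_def mult_right_mono divide_right_mono)

lemma grid_ge: "a < b \<Longrightarrow> a \<le> grid a b n k"
  using grid_mono[of a b 0 k n] by simp

lemma grid_le: "a < b \<Longrightarrow> 0 < n \<Longrightarrow> k \<le> n \<Longrightarrow> grid a b n k \<le> b"
  using grid_mono[of a b k n n] by simp

text \<open>Its expectation involves only laws at pairs of times, which the Markov property
  provides; the number of jumps itself is not a function of finitely many times.\<close>

definition grid_count :: "(real \<Rightarrow> 'x) \<Rightarrow> 'x \<Rightarrow> 'x \<Rightarrow> real \<Rightarrow> real \<Rightarrow> nat \<Rightarrow> nat" where
  "grid_count f x y a b n = (\<Sum>k<n. if f (grid a b n k) = x \<and> f (grid a b n (Suc k)) = y then 1 else 0)"

text \<open>Once the mesh is below the threshold of \<open>jump_path_mesh\<close>, the end points of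
  each cell show exactly whether it contains a jump from \<open>x\<close> to \<open>y\<close>. The
  counts therefore agree exactly from some \<open>n\<close> on.\<close>

lemma jumps_grid:
  assumes f: "jump_path f" and ab: "0 \<le> a" "a < b" and xy: "x \<noteq> y"
  shows "finite (jumps f x y \<inter> {a<..b})"
    and "\<forall>\<^sub>F n in sequentially. grid_count f x y a b n = card (jumps f x y \<inter> {a<..b})"
proof -
  obtain d where d: "d > 0" and mesh: "\<And>u v. a \<le> u \<Longrightarrow> u < v \<Longrightarrow> v \<le> b \<Longrightarrow> v - u < d \<Longrightarrow>
      finite (jumps f x y \<inter> {u<..v}) \<and> card (jumps f x y \<inter> {u<..v}) = (if f u = x \<and> f v = y then 1 else 0)"
    using jump_path_mesh[OF f ab(1), of b] xy by metis
  have main: "finite (jumps f x y \<inter> {a<..b}) \<and> card (jumps f x y \<inter> {a<..b}) = grid_count f x y a b n"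
    if n: "0 < n" "(b - a) / real n < d" for n
  proof -
    let ?g = "grid a b n"
    have "k \<le> n \<Longrightarrow> finite (jumps f x y \<inter> {a<..?g k}) \<and>
        card (jumps f x y \<inter> {a<..?g k}) = (\<Sum>i<k. if f (?g i) = x \<and> f (?g (Suc i)) = y then 1 else 0)" for k
    proof (induction k)
      case (Suc k)
      have split: "jumps f x y \<inter> {a<..?g (Suc k)} = (jumps f x y \<inter> {a<..?g k}) \<union> (jumps f x y \<inter> {?g k<..?g (Suc k)})"
        using grid_less[OF ab(2) n(1), of k] grid_ge[OF ab(2), of n k] by auto
      have "finite (jumps f x y \<inter> {?g k<..?g (Suc k)}) \<and>
          card (jumps f x y \<inter> {?g k<..?g (Suc k)}) = (if f (?g k) = x \<and> f (?g (Suc k)) = y then 1 else 0)"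
      proof (rule mesh)
        show "?g (Suc k) - ?g k < d" using n(2) by (simp add: grid_Suc)
      qed (use Suc.prems in \<open>intro grid_less grid_ge grid_le ab n; simp\<close>)+
      then show ?case using Suc unfolding split by (subst card_Un_disjoint) auto
    qed simp
    from this[of n] show ?thesis using n(1) by (simp add: grid_count_def)
  qed
  have "\<forall>\<^sub>F n in sequentially. 0 < n \<and> (b - a) / real n < d"
  proof -
    have "(\<lambda>n. (b - a) / real n) \<longlonglongrightarrow> 0" by (rule lim_const_over_n)
    then have "\<forall>\<^sub>F n in sequentially. (b - a) / real n < d" using d by (rule order_tendstoD)
    then show ?thesis using eventually_gt_at_top[of 0] by eventually_elim simp
  qed
  then have ev: "\<forall>\<^sub>F n in sequentially. finite (jumps f x y \<inter> {a<..b}) \<and> card (jumps f x y \<inter> {a<..b}) = grid_count f x y a b n"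
    by eventually_elim (use main in blast)
  then show "\<forall>\<^sub>F n in sequentially. grid_count f x y a b n = card (jumps f x y \<inter> {a<..b})"
    by eventually_elim simp
  show "finite (jumps f x y \<inter> {a<..b})"
    using eventually_happens[OF ev] by auto
qed

text \<open>Needed to dominate the grid counts for every \<open>n\<close>. On a coarse grid a cell
  may show \<open>x\<close> and \<open>y\<close> at its end points although the path went there
  through other states, so the jumps from \<open>x\<close> to \<open>y\<close> alone are no upper
  bound.\<close>

definition all_jumps :: "(real \<Rightarrow> 'x) \<Rightarrow> real set" where
  "all_jumps f = (\<Union>x. \<Union>y\<in>- {x}. jumps f x y)"

lemma finite_all_jumps:
  fixes f :: "real \<Rightarrow> 'x::finite"
  assumes "jump_path f" "0 \<le> a" "a < b"
  shows "finite (all_jumps f \<inter> {a<..b})"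
proof -
  have "all_jumps f \<inter> {a<..b} = (\<Union>x. \<Union>y\<in>- {x}. jumps f x y \<inter> {a<..b})"
    unfolding all_jumps_def by blast
  also have "finite \<dots>" using jumps_grid(1)[OF assms] by (intro finite_UN_I) auto
  finally show ?thesis .
qed

lemma card_all_jumps:
  fixes f :: "real \<Rightarrow> 'x::finite"
  assumes "jump_path f" "0 \<le> a" "a < b"
  shows "card (all_jumps f \<inter> {a<..b}) = (\<Sum>x\<in>UNIV. \<Sum>y\<in>- {x}. card (jumps f x y \<inter> {a<..b}))"
proof -
  have fin: "finite (jumps f x y \<inter> {a<..b})" if "y \<in> - {x}" for x y
    using jumps_grid(1)[OF assms, of x y] that by auto
  have "all_jumps f \<inter> {a<..b} = (\<Union>x. \<Union>y\<in>- {x}. jumps f x y \<inter> {a<..b})"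
    unfolding all_jumps_def by blast
  also have "card \<dots> = (\<Sum>x\<in>UNIV. card (\<Union>y\<in>- {x}. jumps f x y \<inter> {a<..b}))"
    using fin by (subst card_UN_disjoint) (auto simp: jumps_def simp del: UN_simps)
  also have "\<dots> = (\<Sum>x\<in>UNIV. \<Sum>y\<in>- {x}. card (jumps f x y \<inter> {a<..b}))"
    using fin by (intro sum.cong refl, subst card_UN_disjoint) (auto simp: jumps_def simp del: UN_simps)
  finally show ?thesis .
qed

text \<open>Without jumps in the interval, the grid counts of all pairs of distinct states vanish on
  a fine grid. The path then keeps its value from each grid point to the next, and so from
  \<open>u\<close> to \<open>v\<close>.\<close>

lemma jump_between:
  fixes f :: "real \<Rightarrow> 'x::finite"
  assumes f: "jump_path f" and uv: "0 \<le> u" "u < v" and neq: "f u \<noteq> f v"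
  shows "all_jumps f \<inter> {u<..v} \<noteq> {}"
proof
  assume empty: "all_jumps f \<inter> {u<..v} = {}"
  have zero: "jumps f x y \<inter> {u<..v} = {}" if "x \<noteq> y" for x y
  proof -
    have "jumps f x y \<subseteq> all_jumps f" unfolding all_jumps_def by (rule SUP_upper2[of x], simp, rule SUP_upper2[of y]) (use that in auto)
    then show ?thesis using empty by auto
  qed
  have "\<forall>\<^sub>F n in sequentially. grid_count f x y u v n = 0" if "y \<in> - {x}" for x y
  proof -
    have xy: "x \<noteq> y" using that by auto
    show ?thesis using jumps_grid(2)[OF f uv xy] zero[OF xy] by simp
  qed
  then have "\<forall>\<^sub>F n in sequentially. \<forall>x. \<forall>y\<in>- {x}. grid_count f x y u v n = 0"
    by (intro eventually_all_finite eventually_ball_finite ballI) auto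
  then have "\<forall>\<^sub>F n in sequentially. 0 < n \<and> (\<forall>x. \<forall>y\<in>- {x}. grid_count f x y u v n = 0)"
    using eventually_gt_at_top[of 0] by eventually_elim simp
  from eventually_happens'[OF sequentially_bot this]
  obtain n where n: "0 < n" "\<And>x y. x \<noteq> y \<Longrightarrow> grid_count f x y u v n = 0"
    by auto
  have "k \<le> n \<Longrightarrow> f (grid u v n k) = f u" for k
  proof (induction k)
    case (Suc k)
    have "f (grid u v n k) = f (grid u v n (Suc k))"
    proof (rule ccontr)
      assume neq: "f (grid u v n k) \<noteq> f (grid u v n (Suc k))"
      have "grid_count f (f (grid u v n k)) (f (grid u v n (Suc k))) u v n = 0" by (rule n(2)[OF neq])
      then show False using Suc.prems unfolding grid_count_def by (auto split: if_splits)
    qed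
    then show ?case using Suc by simp
  qed simp
  from this[of n] show False using n(1) neq by simp
qed

text \<open>Each counted cell sees a change of value and so contains a jump of some kind, and the
  cells are disjoint.\<close>

lemma grid_count_le_all_jumps:
  fixes f :: "real \<Rightarrow> 'x::finite"
  assumes f: "jump_path f" and ab: "0 \<le> a" "a < b" and xy: "x \<noteq> y" and n: "0 < n"
  shows "grid_count f x y a b n \<le> card (all_jumps f \<inter> {a<..b})"
proof -
  let ?g = "grid a b n"
  have "k \<le> n \<Longrightarrow> (\<Sum>i<k. if f (?g i) = x \<and> f (?g (Suc i)) = y then 1 else 0) \<le> card (all_jumps f \<inter> {a<..?g k})" for k
  proof (induction k)
    case (Suc k)
    have g: "a \<le> ?g k" "?g k < ?g (Suc k)" "?g (Suc k) \<le> b"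
      using Suc.prems grid_less[OF ab(2) n] grid_ge[OF ab(2)] grid_le[OF ab(2) n] by auto
    have split: "all_jumps f \<inter> {a<..?g (Suc k)} = (all_jumps f \<inter> {a<..?g k}) \<union> (all_jumps f \<inter> {?g k<..?g (Suc k)})"
      using g by auto
    have fin: "finite (all_jumps f \<inter> A)" if "A \<subseteq> {a<..b}" for A
      by (rule finite_subset[OF _ finite_all_jumps[OF f ab]]) (use that in auto)
    have "(if f (?g k) = x \<and> f (?g (Suc k)) = y then 1 else 0) \<le> card (all_jumps f \<inter> {?g k<..?g (Suc k)})"
    proof (cases "f (?g k) = x \<and> f (?g (Suc k)) = y")
      case True
      then have "all_jumps f \<inter> {?g k<..?g (Suc k)} \<noteq> {}"
        using g ab xy by (intro jump_between[OF f]) auto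
      moreover have "finite (all_jumps f \<inter> {?g k<..?g (Suc k)})"
        by (rule fin) (use g in auto)
      ultimately have "0 < card (all_jumps f \<inter> {?g k<..?g (Suc k)})" by (simp add: card_gt_0_iff)
      then show ?thesis by simp
    next
      case False
      then show ?thesis by auto
    qed
    moreover have "card (all_jumps f \<inter> {a<..?g (Suc k)}) = card (all_jumps f \<inter> {a<..?g k}) + card (all_jumps f \<inter> {?g k<..?g (Suc k)})"
      unfolding split by (rule card_Un_disjoint) (use g in \<open>auto intro!: fin\<close>)
    ultimately show ?case using Suc by simp
  qed simp
  from this[of n] show ?thesis using n by (simp add: grid_count_def)
qed

section \<open>Expected number of jumps\<close>

context jump_process
begin

abbreviation jump_count :: "'x \<Rightarrow> 'x \<Rightarrow> real \<Rightarrow> real \<Rightarrow> 'w \<Rightarrow> real" where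
  "jump_count x y a b w \<equiv> real (card (jumps (\<lambda>t. X t w) x y \<inter> {a<..b}))"

abbreviation sampled_count :: "'x \<Rightarrow> 'x \<Rightarrow> real \<Rightarrow> real \<Rightarrow> nat \<Rightarrow> 'w \<Rightarrow> real" where
  "sampled_count x y a b n w \<equiv> real (grid_count (\<lambda>t. X t w) x y a b n)"

lemma K_nonneg: "0 \<le> K"
  using generator_bound[of 0 undefined] l1_norm_nonneg order_trans by blast

lemma row_generator_bound: "\<bar>row_mult w (generator (q u)) y\<bar> \<le> K * l1_norm w"
  using abs_le_l1_norm[of "row_mult w (generator (q u))" y] l1_norm_row_mult_le[of "generator (q u)" K w, OF generator_bound]
  by linarith

lemma generator_entry_bound: "\<bar>generator (q u) x y\<bar> \<le> K"
  using abs_le_l1_norm[of "generator (q u) x" y] generator_bound[of u x] by linarith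

lemma P_lipschitz:
  assumes "0 \<le> s" "s \<le> t"
  shows "\<bar>P s t x y - (if x = y then 1 else 0)\<bar> \<le> K * (t - s)"
proof -
  have "\<bar>LBINT u:{s..t}. row_mult (P s u x) (generator (q u)) y\<bar> \<le> K * (t - s)"
    using set_integral_abs_le[OF P_integrable[OF assms, of x y], of K] row_generator_bound P_l1 assms
    by (metis (no_types, lifting) atLeastAtMost_iff mult.right_neutral real_norm_def)
  then show ?thesis using P_eq[OF assms, of x y] by linarith
qed

lemma law_lipschitz:
  assumes "0 \<le> s" "s \<le> t"
  shows "\<bar>law t y - law s y\<bar> \<le> K * (t - s)"
proof -
  have "\<bar>LBINT u:{s..t}. row_mult (law u) (generator (q u)) y\<bar> \<le> K * (t - s)"
    using set_integral_abs_le[OF linear_flow_integrable[OF law_flow assms(1), of t y], of K] row_generator_bound law_l1 assms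
    by (metis (no_types, lifting) atLeastAtMost_iff mult.right_neutral real_norm_def order_trans)
  then show ?thesis using linear_flow_increment[OF law_flow assms, of y] by linarith
qed

text \<open>For distinct states, the expected number of jumps from \<open>x\<close> to
  \<open>y\<close> per unit time, as \<open>expectation_jump_count\<close> will confirm.\<close>

definition jump_density :: "'x \<Rightarrow> 'x \<Rightarrow> real \<Rightarrow> real" where
  "jump_density x y s = law s x * q s x y"

lemma q_bound: "x \<noteq> y \<Longrightarrow> q s x y \<le> K"
  using generator_entry_bound[of s x y] by (simp add: generator_def)

lemma jump_density_nonneg: "0 \<le> s \<Longrightarrow> 0 \<le> jump_density x y s"
  by (simp add: jump_density_def law_nonneg q_nonneg)

lemma jump_density_le: "x \<noteq> y \<Longrightarrow> 0 \<le> s \<Longrightarrow> jump_density x y s \<le> K"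
  unfolding jump_density_def using mult_mono[OF law_le_1 q_bound, of s x y s x] q_nonneg by simp

lemma jump_density_measurable [measurable]: "(\<lambda>s. indicator {0..} s * jump_density x y s) \<in> borel_measurable borel"
proof -
  have "(\<lambda>s. (indicator {0..} s * law s x) * q s x y) \<in> borel_measurable borel"
    by (intro borel_measurable_times law_measurable q_measurable)
  then show ?thesis by (simp add: jump_density_def mult_ac)
qed

lemma jump_density_set_measurable:
  assumes "0 \<le> a"
  shows "set_borel_measurable lborel {a..b} (jump_density x y)"
proof -
  have "(\<lambda>s. indicator {a..b} s * (indicator {0..} s * jump_density x y s)) \<in> borel_measurable borel"
    by measurable
  also have "(\<lambda>s. indicator {a..b} s * (indicator {0..} s * jump_density x y s)) = (\<lambda>s. indicator {a..b} s * jump_density x y s)"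
    using assms by (auto simp: indicator_def)
  finally show ?thesis by (simp add: set_borel_measurable_def)
qed

lemma jump_density_integrable:
  assumes "x \<noteq> y" "0 \<le> a"
  shows "set_integrable lborel {a..b} (jump_density x y)"
  by (rule set_integrable_bounded_Icc[OF jump_density_set_measurable[OF assms(2)], where B = K])
     (use assms jump_density_le jump_density_nonneg in auto)

text \<open>By the forward equation both terms are integrals over \<open>{u..v}\<close>. The
  integrands differ through \<open>P u s x\<close> against the unit mass at \<open>x\<close> and
  through \<open>law u\<close> against \<open>law s\<close>, both of order \<open>s - u\<close>. The
  resulting quadratic error per cell sums to order 1/n over a grid of n cells.\<close>

lemma short_time_jump:
  assumes xy: "x \<noteq> y" and uv: "0 \<le> u" "u \<le> v"
  shows "\<bar>law u x * P u v x y - (LBINT s:{u..v}. jump_density x y s)\<bar>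
    \<le> K * K * (real CARD('x) + 1) * (v - u)\<^sup>2"
proof -
  \<comment> \<open>\<open>CARD('x)\<close> passes from entries to the l1 norm of the change in
    \<open>P\<close>; the 1 accounts for the change of the law.\<close>
  let ?C = "K * K * (real CARD('x) + 1)"
  let ?f = "\<lambda>s. law u x * row_mult (P u s x) (generator (q s)) y"
  have i: "set_integrable lborel {u..v} ?f"
    using P_integrable[OF uv] by simp
  have j: "set_integrable lborel {u..v} (jump_density x y)"
    by (rule jump_density_integrable[OF xy uv(1)])
  have "\<bar>?f s - jump_density x y s\<bar> \<le> ?C * (v - u)" if s: "s \<in> {u..v}" for s
  proof -
    define e where "e = (\<lambda>z. P u s x z - (if x = z then 1 else 0))"
    have re: "row_mult (P u s x) (generator (q s)) y = row_mult e (generator (q s)) y + q s x y"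
      unfolding e_def row_mult_diff_left using xy by (simp add: generator_def)
    have eq: "?f s - jump_density x y s = law u x * row_mult e (generator (q s)) y + (law u x - law s x) * generator (q s) x y"
      unfolding re using xy by (simp add: jump_density_def generator_def algebra_simps)
    have "l1_norm e \<le> real CARD('x) * (K * (s - u))"
      unfolding l1_norm_def e_def using sum_bounded_above[of UNIV "\<lambda>z. \<bar>P u s x z - (if x = z then 1 else 0)\<bar>"] P_lipschitz[of u s x] s uv
      by auto
    then have "K * l1_norm e \<le> K * (real CARD('x) * (K * (s - u)))" by (rule mult_left_mono[OF _ K_nonneg])
    with row_generator_bound[of e s y]
    have "\<bar>row_mult e (generator (q s)) y\<bar> \<le> K * (real CARD('x) * (K * (s - u)))" by linarith
    then have 1: "\<bar>law u x * row_mult e (generator (q s)) y\<bar> \<le> 1 * (K * (real CARD('x) * (K * (s - u))))"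
      unfolding abs_mult using law_nonneg[OF uv(1), of x] law_le_1[OF uv(1), of x] by (intro mult_mono) auto
    have 2: "\<bar>(law u x - law s x) * generator (q s) x y\<bar> \<le> (K * (s - u)) * K"
      unfolding abs_mult using law_lipschitz[of u s x] s uv
      by (intro mult_mono generator_entry_bound) (auto simp: abs_minus_commute K_nonneg)
    have "\<bar>?f s - jump_density x y s\<bar> \<le> ?C * (s - u)"
      using abs_triangle_ineq[of "law u x * row_mult e (generator (q s)) y" "(law u x - law s x) * generator (q s) x y"] 1 2
      unfolding eq by (simp add: algebra_simps)
    also have "\<dots> \<le> ?C * (v - u)" using s K_nonneg by (intro mult_left_mono) auto
    finally show ?thesis .
  qed
  then have "norm (LBINT s:{u..v}. ?f s - jump_density x y s) \<le> ?C * (v - u) * (v - u)"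
    by (intro set_integral_abs_le set_integral_diff(1) i j) (use uv in auto)
  moreover have "(LBINT s:{u..v}. ?f s - jump_density x y s) = law u x * P u v x y - (LBINT s:{u..v}. jump_density x y s)"
    using P_eq[OF uv, of x y] xy by (subst set_integral_diff(2)[OF i j]) simp
  ultimately show ?thesis by (simp add: power2_eq_square mult_ac)
qed

lemma grid_count_measurable:
  assumes "0 \<le> a" "a < b"
  shows "sampled_count x y a b n \<in> borel_measurable M"
proof -
  have "0 \<le> grid a b n k" for k using grid_ge[OF assms(2), of n k] assms(1) by simp
  then have [measurable]: "X (grid a b n k) \<in> measurable M (count_space UNIV)" for k by (rule X_measurable)
  show ?thesis unfolding grid_count_def of_nat_sum by measurable
qed

lemma expectation_grid_count:
  assumes ab: "0 \<le> a" "a < b" and n: "0 < n"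
  shows "integrable M (sampled_count x y a b n)"
    and "expectation (sampled_count x y a b n) =
      (\<Sum>k<n. law (grid a b n k) x * P (grid a b n k) (grid a b n (Suc k)) x y)"
proof -
  let ?A = "\<lambda>k. {w \<in> space M. X (grid a b n k) w = x \<and> X (grid a b n (Suc k)) w = y}"
  have g: "0 \<le> grid a b n k" "grid a b n k \<le> grid a b n (Suc k)" for k
    using grid_ge[OF ab(2), of n k] grid_less[OF ab(2) n, of k] ab(1) by auto
  have meas: "?A k \<in> sets M" for k by (rule X_pair_event) (rule g)+
  have i: "integrable M (indicat_real (?A k))" for k
    by (intro integrable_real_indicator meas) (simp add: emeasure_eq_measure)
  have eq: "sampled_count x y a b n w = (\<Sum>k<n. indicat_real (?A k) w)" if "w \<in> space M" for w
    unfolding grid_count_def of_nat_sum using that by (intro sum.cong) (auto simp: indicator_def)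
  show "integrable M (sampled_count x y a b n)"
    by (subst Bochner_Integration.integrable_cong[OF refl eq]) (auto intro: i)
  have "expectation (sampled_count x y a b n) = expectation (\<lambda>w. \<Sum>k<n. indicat_real (?A k) w)"
    by (rule Bochner_Integration.integral_cong[OF refl eq])
  also have "\<dots> = (\<Sum>k<n. prob (?A k))"
    by (subst Bochner_Integration.integral_sum[OF i]) (simp add: Int_absorb2 subset_eq)
  also have "\<dots> = (\<Sum>k<n. law (grid a b n k) x * P (grid a b n k) (grid a b n (Suc k)) x y)"
    by (intro sum.cong refl markov_law g)
  finally show "expectation (sampled_count x y a b n) =
      (\<Sum>k<n. law (grid a b n k) x * P (grid a b n k) (grid a b n (Suc k)) x y)" .
qed

lemma expectation_grid_count_limit:
  assumes xy: "x \<noteq> y" and ab: "0 \<le> a" "a < b"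
  shows "(\<lambda>n. expectation (sampled_count x y a b n))
    \<longlonglongrightarrow> (LBINT s:{a..b}. jump_density x y s)"
proof -
  let ?C = "K * K * (real CARD('x) + 1)"
  let ?I = "LBINT s:{a..b}. jump_density x y s"
  have bound: "\<bar>expectation (sampled_count x y a b n) - ?I\<bar> \<le> ?C * (b - a)\<^sup>2 / real n" if n: "0 < n" for n
  proof -
    let ?g = "grid a b n"
    have g: "0 \<le> ?g k" "a \<le> ?g k" "?g k \<le> ?g (Suc k)" for k
      using grid_ge[OF ab(2), of n k] grid_less[OF ab(2) n, of k] ab(1) by auto
    have "(\<Sum>i<k. LBINT s:{?g i..?g (Suc i)}. jump_density x y s) = (LBINT s:{a..?g k}. jump_density x y s)" for k
    proof (induction k)
      case (Suc k)
      then show ?case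
        using set_integral_Icc_split[OF jump_density_integrable[OF xy ab(1), of "?g (Suc k)"] g(2)[of k] g(3)[of k]] by simp
    qed (use set_integral_Icc_refl[of a "jump_density x y"] in simp)
    from this[of n] have I: "?I = (\<Sum>i<n. LBINT s:{?g i..?g (Suc i)}. jump_density x y s)"
      using n by simp
    have "\<bar>expectation (sampled_count x y a b n) - ?I\<bar>
        = \<bar>\<Sum>k<n. law (?g k) x * P (?g k) (?g (Suc k)) x y - (LBINT s:{?g k..?g (Suc k)}. jump_density x y s)\<bar>"
      by (simp add: expectation_grid_count(2)[OF ab n] I sum_subtractf)
    also have "\<dots> \<le> (\<Sum>k<n. ?C * (?g (Suc k) - ?g k)\<^sup>2)"
      by (rule order_trans[OF sum_abs sum_mono]) (intro short_time_jump xy g)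
    also have "\<dots> = ?C * (b - a)\<^sup>2 / real n"
      using n by (simp add: grid_Suc power2_eq_square)
    finally show ?thesis .
  qed
  have "(\<lambda>n. expectation (sampled_count x y a b n) - ?I) \<longlonglongrightarrow> 0"
  proof (rule Lim_null_comparison)
    show "\<forall>\<^sub>F n in sequentially. norm (expectation (sampled_count x y a b n) - ?I) \<le> ?C * (b - a)\<^sup>2 / real n"
      using eventually_gt_at_top[of 0] by eventually_elim (use bound in auto)
    show "(\<lambda>n. ?C * (b - a)\<^sup>2 / real n) \<longlonglongrightarrow> 0" by (rule lim_const_over_n)
  qed
  then show ?thesis by (simp add: LIM_zero_iff)
qed

lemma jump_count_limit:
  assumes "x \<noteq> y" "0 \<le> a" "a < b" "w \<in> space M"
  shows "(\<lambda>n. sampled_count x y a b n w) \<longlonglongrightarrow> jump_count x y a b w"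
  using jumps_grid(2)[OF X_path[OF assms(4)] assms(2,3,1)]
  by (intro tendsto_eventually) (auto elim: eventually_mono)

lemma jump_count_measurable:
  assumes "x \<noteq> y" "0 \<le> a" "a < b"
  shows "(jump_count x y a b) \<in> borel_measurable M"
  by (rule borel_measurable_LIMSEQ_real[OF jump_count_limit[OF assms] grid_count_measurable[OF assms(2,3)]])

text \<open>Fatou's lemma bounds the expected number of jumps, which then dominates the grid counts.\<close>

lemma jump_count_nn_integral_le:
  assumes "x \<noteq> y" "0 \<le> a" "a < b"
  shows "(\<integral>\<^sup>+ w. ennreal (jump_count x y a b w) \<partial>M) < \<infinity>"
proof -
  let ?N = "\<lambda>n w. ennreal (sampled_count x y a b n w)"
  have "(\<integral>\<^sup>+ w. ennreal (jump_count x y a b w) \<partial>M) = (\<integral>\<^sup>+ w. liminf (\<lambda>n. ?N n w) \<partial>M)"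
    by (intro nn_integral_cong lim_imp_Liminf[symmetric] tendsto_ennrealI jump_count_limit assms) auto
  also have "\<dots> \<le> liminf (\<lambda>n. \<integral>\<^sup>+ w. ?N n w \<partial>M)"
    by (intro nn_integral_liminf measurable_compose[OF grid_count_measurable[OF assms(2,3)] measurable_ennreal])
  also have "\<dots> = ennreal (LBINT s:{a..b}. jump_density x y s)"
  proof (rule lim_imp_Liminf)
    have "(\<lambda>n. ennreal (expectation (sampled_count x y a b n))) \<longlonglongrightarrow> ennreal (LBINT s:{a..b}. jump_density x y s)"
      by (intro tendsto_ennrealI expectation_grid_count_limit assms)
    moreover have "\<forall>\<^sub>F n in sequentially. ennreal (expectation (sampled_count x y a b n)) = (\<integral>\<^sup>+ w. ?N n w \<partial>M)"
      using eventually_gt_at_top[of 0]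
      by eventually_elim (intro nn_integral_eq_integral[symmetric] expectation_grid_count assms; simp)
    ultimately show "(\<lambda>n. \<integral>\<^sup>+ w. ?N n w \<partial>M) \<longlonglongrightarrow> ennreal (LBINT s:{a..b}. jump_density x y s)"
      by (rule Lim_transform_eventually)
  qed simp
  finally show ?thesis by (auto intro: le_less_trans)
qed

lemma jump_count_integrable:
  assumes "x \<noteq> y" "0 \<le> a" "a < b"
  shows "integrable M (jump_count x y a b)"
  using jump_count_nn_integral_le[OF assms] jump_count_measurable[OF assms]
  by (intro integrableI_bounded) auto

text \<open>Dominated convergence along the grids. The dominating variable is the number of jumps of
  all kinds, a finite sum of counts that Fatou's lemma has shown to be integrable.\<close>

lemma expectation_jump_count:
  assumes xy: "x \<noteq> y" and ab: "0 \<le> a" "a < b"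
  shows "expectation (jump_count x y a b) = (LBINT s:{a..b}. jump_density x y s)"
proof (rule LIMSEQ_unique)
  \<comment> \<open>The shift to \<open>Suc n\<close> ensures a positive number of cells, as the
    domination of grid counts demands.\<close>
  show "(\<lambda>n. expectation (sampled_count x y a b (Suc n))) \<longlonglongrightarrow> (LBINT s:{a..b}. jump_density x y s)"
    using expectation_grid_count_limit[OF assms] by (rule LIMSEQ_Suc)
  let ?total = "\<lambda>w. real (\<Sum>x\<in>UNIV. \<Sum>y\<in>- {x}. card (jumps (\<lambda>t. X t w) x y \<inter> {a<..b}))"
  show "(\<lambda>n. expectation (sampled_count x y a b (Suc n)))
      \<longlonglongrightarrow> expectation (jump_count x y a b)"
  proof (rule integral_dominated_convergence)
    show "integrable M ?total"
      unfolding of_nat_sum by (intro Bochner_Integration.integrable_sum jump_count_integrable ab) auto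
    show "AE w in M. (\<lambda>n. sampled_count x y a b (Suc n) w) \<longlonglongrightarrow> jump_count x y a b w"
      by (intro AE_I2 LIMSEQ_Suc jump_count_limit assms)
    show "AE w in M. norm (sampled_count x y a b (Suc n) w) \<le> ?total w" for n
    proof (rule AE_I2)
      fix w assume "w \<in> space M"
      then show "norm (sampled_count x y a b (Suc n) w) \<le> ?total w"
        using grid_count_le_all_jumps[OF X_path ab xy, of w "Suc n"] card_all_jumps[OF X_path ab, of w]
        by (simp del: of_nat_sum)
    qed
  qed (use jump_count_measurable[OF assms] grid_count_measurable[OF ab] in auto)
qed

end

section \<open>Expectations of sums over jumps\<close>

lemma nn_integral_indicator_count_space:
  assumes "finite J"
  shows "(\<integral>\<^sup>+ s. indicator A s \<partial>count_space J) = ennreal (real (card (J \<inter> A)))"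
proof -
  have "(\<integral>\<^sup>+ s. indicator A s \<partial>count_space J) = (\<Sum>s\<in>J. indicator A s)"
    by (rule nn_integral_count_space_finite[OF assms])
  also have "\<dots> = (\<Sum>s\<in>J \<inter> A. 1)"
    by (rule sum.mono_neutral_cong_right) (use assms in auto)
  finally show ?thesis by (simp add: ennreal_of_nat_eq_real_of_nat)
qed

context jump_process
begin

definition jump_set :: "'x \<Rightarrow> 'x \<Rightarrow> real \<Rightarrow> 'w \<Rightarrow> real set" where
  "jump_set x y t w = jumps (\<lambda>s. X s w) x y \<inter> {0<..t}"

text \<open>Cut off outside \<open>{0<..t}\<close>, so that integrals over the whole line see only
  times at which the density is known to be nonnegative.\<close>

definition jump_intensity :: "'x \<Rightarrow> 'x \<Rightarrow> real \<Rightarrow> real \<Rightarrow> ennreal" where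
  "jump_intensity x y t s = ennreal (indicator {0<..t} s * jump_density x y s)"

text \<open>Sums over jumps are written as integrals against counting measure, which makes
  additivity and monotone convergence directly available.\<close>

abbreviation jump_integral :: "'x \<Rightarrow> 'x \<Rightarrow> real \<Rightarrow> (real \<Rightarrow> ennreal) \<Rightarrow> 'w \<Rightarrow> ennreal" where
  "jump_integral x y t f w \<equiv> \<integral>\<^sup>+ s. f s \<partial>count_space (jump_set x y t w)"

lemma finite_jump_set: "x \<noteq> y \<Longrightarrow> 0 < t \<Longrightarrow> w \<in> space M \<Longrightarrow> finite (jump_set x y t w)"
  unfolding jump_set_def using jumps_grid(1)[OF X_path order_refl] by blast

lemma jump_intensity_measurable [measurable]: "jump_intensity x y t \<in> borel_measurable borel"
proof -
  have "(\<lambda>s. indicator {0<..t} s * (indicator {0..} s * jump_density x y s)) \<in> borel_measurable borel"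
    by measurable
  also have "(\<lambda>s. indicator {0<..t} s * (indicator {0..} s * jump_density x y s)) = (\<lambda>s. indicator {0<..t} s * jump_density x y s)"
    by (auto simp: indicator_def)
  finally show ?thesis unfolding jump_intensity_def[abs_def] by measurable
qed

lemma jump_count_Ioc:
  assumes xy: "x \<noteq> y" and t: "0 < t"
  shows "jump_integral x y t (indicator {a<..b}) \<in> borel_measurable M"
    and "(\<integral>\<^sup>+ w. jump_integral x y t (indicator {a<..b}) w \<partial>M)
      = (\<integral>\<^sup>+ s. indicator {a<..b} s * jump_intensity x y t s \<partial>lborel)"
    and "(\<integral>\<^sup>+ s. indicator {a<..b} s * jump_intensity x y t s \<partial>lborel) < \<infinity>"
proof -
  \<comment> \<open>Clipping to \<open>{0<..t}\<close> may leave nothing, and then both sides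
    vanish; otherwise \<open>expectation_jump_count\<close> applies.\<close>
  define a' b' where "a' = max a 0" and "b' = min b t"
  have int: "{a<..b} \<inter> {0<..t} = {a'<..b'}" by (auto simp: a'_def b'_def)
  have count: "jump_integral x y t (indicator {a<..b}) w = ennreal (jump_count x y a' b' w)"
    if "w \<in> space M" for w
  proof -
    have "jump_set x y t w \<inter> {a<..b} = jumps (\<lambda>s. X s w) x y \<inter> {a'<..b'}"
      unfolding int[symmetric] jump_set_def by blast
    then show ?thesis
      using nn_integral_indicator_count_space[OF finite_jump_set[OF xy t that], of "{a<..b}"] by simp
  qed
  have dens: "indicator {a<..b} s * jump_intensity x y t s = ennreal (indicator {a'<..b'} s * jump_density x y s)" for s
    by (auto simp: jump_intensity_def int[symmetric] indicator_def)
  have ae: "(\<integral>\<^sup>+ s. indicator {a<..b} s * jump_intensity x y t s \<partial>lborel) = (\<integral>\<^sup>+ s. ennreal (indicator {a'..b'} s * jump_density x y s) \<partial>lborel)"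
  proof (rule nn_integral_cong_AE)
    have "AE s in lborel. s \<noteq> a'" by (rule AE_lborel_singleton)
    then show "AE s in lborel. indicator {a<..b} s * jump_intensity x y t s = ennreal (indicator {a'..b'} s * jump_density x y s)"
      by eventually_elim (unfold dens, auto simp: indicator_def)
  qed
  have a': "0 \<le> a'" by (simp add: a'_def)
  have val: "(\<integral>\<^sup>+ s. indicator {a<..b} s * jump_intensity x y t s \<partial>lborel) = ennreal (LBINT s:{a'..b'}. jump_density x y s)"
    unfolding ae set_lebesgue_integral_def
    using jump_density_integrable[OF xy a', of b'] a' unfolding set_integrable_def
    by (subst nn_integral_eq_integral) (auto simp: indicator_def intro!: jump_density_nonneg)
  then show "(\<integral>\<^sup>+ s. indicator {a<..b} s * jump_intensity x y t s \<partial>lborel) < \<infinity>" by simp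
  show "jump_integral x y t (indicator {a<..b}) \<in> borel_measurable M"
  proof (cases "a' < b'")
    case True
    show ?thesis
      by (subst measurable_cong[OF count], assumption)
        (rule measurable_compose[OF jump_count_measurable[OF xy a' True] measurable_ennreal])
  next
    case False
    then show ?thesis by (subst measurable_cong[OF count]) auto
  qed
  show "(\<integral>\<^sup>+ w. jump_integral x y t (indicator {a<..b}) w \<partial>M)
      = (\<integral>\<^sup>+ s. indicator {a<..b} s * jump_intensity x y t s \<partial>lborel)"
  proof (cases "a' < b'")
    case True
    have "(\<integral>\<^sup>+ w. jump_integral x y t (indicator {a<..b}) w \<partial>M)
        = (\<integral>\<^sup>+ w. ennreal (jump_count x y a' b' w) \<partial>M)"
      by (rule nn_integral_cong[OF count])
    also have "\<dots> = ennreal (expectation (jump_count x y a' b'))"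
      by (rule nn_integral_eq_integral[OF jump_count_integrable[OF xy a' True]]) simp
    finally show ?thesis using val expectation_jump_count[OF xy a' True] by simp
  next
    case False
    have "(\<integral>\<^sup>+ w. jump_integral x y t (indicator {a<..b}) w \<partial>M) = (\<integral>\<^sup>+ w. 0 \<partial>M)"
      by (rule nn_integral_cong) (use False count in simp)
    moreover have "(\<integral>\<^sup>+ s. indicator {a<..b} s * jump_intensity x y t s \<partial>lborel) = (\<integral>\<^sup>+ (s::real). 0 \<partial>lborel)"
      unfolding dens by (rule nn_integral_cong) (use False in simp)
    ultimately show ?thesis by simp
  qed
qed

text \<open>A Dynkin class argument: both sides are finite measures in \<open>A\<close> that agree
  on half-open intervals, which are stable under intersection and generate the Borel sets.
  Measurability in \<open>w\<close> is carried through the same induction.\<close>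

lemma jump_count_Borel:
  assumes xy: "x \<noteq> y" and t: "0 < t" and A: "A \<in> sets borel"
  shows "jump_integral x y t (indicator A) \<in> borel_measurable M \<and>
    (\<integral>\<^sup>+ w. jump_integral x y t (indicator A) w \<partial>M)
      = (\<integral>\<^sup>+ s. indicator A s * jump_intensity x y t s \<partial>lborel)"
proof -
  let ?G = "range (\<lambda>(a, b). {a<..b::real})"
  let ?Z = "\<lambda>A. jump_integral x y t (indicator A)"
  let ?D = "\<lambda>A. \<integral>\<^sup>+ s. indicator A s * jump_intensity x y t s \<partial>lborel"
  have sets: "sets borel = sigma_sets UNIV ?G"
    unfolding borel_sigma_sets_Ioc by (rule sets_measure_of) auto
  \<comment> \<open>The whole line is not a half-open interval, but jump sets and intensity do not
    distinguish it from \<open>{0<..t}\<close>. Its finite value permits the subtraction for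
    complements.\<close>
  have whole: "?Z UNIV w = ?Z {0<..t} w" if "w \<in> space M" for w
    unfolding nn_integral_indicator_count_space[OF finite_jump_set[OF xy t that]]
    by (simp add: jump_set_def)
  have wholeD: "?D UNIV = ?D {0<..t}"
    by (rule nn_integral_cong) (auto simp: jump_intensity_def indicator_def)
  have UNIV: "?Z UNIV \<in> borel_measurable M" "(\<integral>\<^sup>+ w. ?Z UNIV w \<partial>M) = ?D UNIV" "?D UNIV < \<infinity>"
  proof -
    show "?Z UNIV \<in> borel_measurable M"
      by (subst measurable_cong[OF whole], assumption) (rule jump_count_Ioc(1)[OF xy t])
    show "(\<integral>\<^sup>+ w. ?Z UNIV w \<partial>M) = ?D UNIV"
      unfolding wholeD jump_count_Ioc(2)[OF xy t, symmetric] by (rule nn_integral_cong[OF whole])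
    show "?D UNIV < \<infinity>"
      unfolding wholeD by (rule jump_count_Ioc(3)[OF xy t])
  qed
  have "Int_stable ?G"
  proof (rule Int_stableI)
    fix A B assume "A \<in> ?G" "B \<in> ?G"
    then obtain a b c d where "A = {a<..b}" "B = {c<..d}" by auto
    then have "A \<inter> B = (\<lambda>(a, b). {a<..b}) (max a c, min b d)" by auto
    then show "A \<inter> B \<in> ?G" by blast
  qed
  moreover have "?G \<subseteq> Pow UNIV" by simp
  moreover from A have "A \<in> sigma_sets UNIV ?G" by (simp add: sets)
  ultimately show ?thesis
  proof (induction rule: sigma_sets_induct_disjoint)
    case (basic A)
    then show ?case using jump_count_Ioc[OF xy t] by auto
  next
    case empty
    then show ?case by simp
  next
    case (compl A)
    have A: "A \<in> sets borel" using compl sets by simp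
    note IH = compl.IH
    have Z: "?Z (UNIV - A) w = ?Z UNIV w - ?Z A w" if "w \<in> space M" for w
    proof -
      have fin: "finite (jump_set x y t w)" by (rule finite_jump_set[OF xy t that])
      have "real (card (jump_set x y t w \<inter> (UNIV - A))) = real (card (jump_set x y t w)) - real (card (jump_set x y t w \<inter> A))"
        using card_Diff_subset_Int[of "jump_set x y t w" A] fin card_mono[OF fin, of "jump_set x y t w \<inter> A"]
        by (simp add: Diff_eq of_nat_diff)
      then show ?thesis
        unfolding nn_integral_indicator_count_space[OF fin] by (simp add: ennreal_minus)
    qed
    have le: "?Z A w \<le> ?Z UNIV w" for w by (rule nn_integral_mono) (simp add: indicator_def)
    have leD: "?D A \<le> ?D UNIV" by (intro nn_integral_mono mult_right_mono) (auto simp: indicator_def)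
    have fin: "?D A < \<infinity>" using leD UNIV(3) by (rule le_less_trans)
    have "(\<integral>\<^sup>+ w. ?Z (UNIV - A) w \<partial>M) = (\<integral>\<^sup>+ w. ?Z UNIV w - ?Z A w \<partial>M)"
      by (rule nn_integral_cong[OF Z])
    also have "\<dots> = (\<integral>\<^sup>+ w. ?Z UNIV w \<partial>M) - (\<integral>\<^sup>+ w. ?Z A w \<partial>M)"
      by (rule nn_integral_diff) (use UNIV IH fin le in auto)
    also have "\<dots> = ?D UNIV - ?D A" using UNIV IH by simp
    also have "\<dots> = (\<integral>\<^sup>+ s. indicator UNIV s * jump_intensity x y t s - indicator A s * jump_intensity x y t s \<partial>lborel)"
      by (rule nn_integral_diff[symmetric]) (use A fin in \<open>auto intro!: mult_right_mono simp: indicator_def\<close>)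
    also have "\<dots> = ?D (UNIV - A)"
      by (rule nn_integral_cong) (auto simp: indicator_def jump_intensity_def intro!: diff_eq_0_ennreal)
    finally have "(\<integral>\<^sup>+ w. ?Z (UNIV - A) w \<partial>M) = ?D (UNIV - A)" .
    moreover have "?Z (UNIV - A) \<in> borel_measurable M"
      using UNIV(1) IH by (subst measurable_cong[OF Z]) auto
    ultimately show ?case by simp
  next
    case (union A)
    have A: "A i \<in> sets borel" for i using union.hyps sets by auto
    have ind: "indicator (\<Union>i. A i) s = (\<Sum>i. indicator (A i) s :: ennreal)" for s
      by (rule suminf_indicator[OF union.hyps(1), symmetric])
    have Z: "?Z (\<Union>i. A i) w = (\<Sum>i. ?Z (A i) w)" for w
      unfolding ind by (rule nn_integral_suminf) simp
    have "(\<integral>\<^sup>+ w. ?Z (\<Union>i. A i) w \<partial>M) = (\<Sum>i. \<integral>\<^sup>+ w. ?Z (A i) w \<partial>M)"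
      unfolding Z by (rule nn_integral_suminf) (use union.IH in blast)
    also have "\<dots> = (\<Sum>i. ?D (A i))" using union.IH by simp
    also have "\<dots> = (\<integral>\<^sup>+ s. (\<Sum>i. indicator (A i) s * jump_intensity x y t s) \<partial>lborel)"
      by (rule nn_integral_suminf[symmetric]) (use A in measurable)
    also have "\<dots> = ?D (\<Union>i. A i)" unfolding ind by simp
    finally show ?case unfolding Z using union.IH by (auto intro!: borel_measurable_suminf_order)
  qed
qed

text \<open>Campbell's formula for the point process of jumps from \<open>x\<close> to
  \<open>y\<close>, extended from indicators to nonnegative functions by linearity and monotone
  limits.\<close>

lemma jump_nn_integral:
  fixes f :: "real \<Rightarrow> ennreal"
  assumes xy: "x \<noteq> y" and t: "0 < t" and f: "f \<in> borel_measurable borel"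
  shows "jump_integral x y t f \<in> borel_measurable M \<and>
    (\<integral>\<^sup>+ w. jump_integral x y t f w \<partial>M)
      = (\<integral>\<^sup>+ s. f s * jump_intensity x y t s \<partial>lborel)"
  using f
proof (induction rule: borel_measurable_induct)
  case (cong f g)
  then have "f = g" by auto
  then show ?case using cong by simp
next
  case (set A)
  then show ?case by (intro jump_count_Borel xy t)
next
  case (mult u c)
  then have [measurable]: "jump_integral x y t u \<in> borel_measurable M" by simp
  from mult show ?case by (simp add: nn_integral_cmult mult.assoc)
next
  case (add u v)
  then have [measurable]: "jump_integral x y t u \<in> borel_measurable M"
    "jump_integral x y t v \<in> borel_measurable M" by simp_all
  from add show ?case by (simp add: nn_integral_add distrib_right)
next
  case (seq U)
  have [measurable]: "U i \<in> borel_measurable borel" for i using seq by simp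
  have mono: "incseq (\<lambda>i s. U i s * jump_intensity x y t s)"
    using seq by (auto simp: incseq_def le_fun_def intro!: mult_right_mono)
  have Z: "(\<integral>\<^sup>+ s. (SUP i. U i) s \<partial>count_space J) = (SUP i. \<integral>\<^sup>+ s. U i s \<partial>count_space J)" for J
    unfolding SUP_apply by (rule nn_integral_monotone_convergence_SUP) (use seq in auto)
  have Zmono: "incseq (\<lambda>i w. jump_integral x y t (U i) w)"
    using seq by (auto simp: incseq_def le_fun_def intro!: nn_integral_mono)
  have "(\<integral>\<^sup>+ w. (SUP i. jump_integral x y t (U i) w) \<partial>M) = (SUP i. \<integral>\<^sup>+ w. jump_integral x y t (U i) w \<partial>M)"
    by (rule nn_integral_monotone_convergence_SUP[OF Zmono]) (use seq in auto)
  also have "\<dots> = (SUP i. \<integral>\<^sup>+ s. U i s * jump_intensity x y t s \<partial>lborel)"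
    using seq by simp
  also have "\<dots> = (\<integral>\<^sup>+ s. (SUP i. U i s * jump_intensity x y t s) \<partial>lborel)"
    by (rule nn_integral_monotone_convergence_SUP[OF mono, symmetric]) measurable
  also have "\<dots> = (\<integral>\<^sup>+ s. (SUP i. U i) s * jump_intensity x y t s \<partial>lborel)"
    by (simp add: SUP_mult_right_ennreal image_comp)
  finally show ?case unfolding Z using seq by (auto intro!: borel_measurable_SUP)
qed

lemma expectation_jump_set_nonneg:
  assumes xy: "x \<noteq> y" and t: "0 < t" and h: "set_borel_measurable lborel {0..t} h" "\<And>s. 0 \<le> h s"
    and int: "set_integrable lborel {0..t} (\<lambda>s. h s * jump_density x y s)"
  shows "integrable M (\<lambda>w. \<Sum>s\<in>jump_set x y t w. h s)"
    and "expectation (\<lambda>w. \<Sum>s\<in>jump_set x y t w. h s) = (LBINT s:{0..t}. h s * jump_density x y s)"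
proof -
  \<comment> \<open>\<open>h\<close> is controlled only on \<open>{0..t}\<close>; truncating it
    there leaves sums over the jump set unchanged.\<close>
  let ?f = "\<lambda>s. ennreal (indicator {0..t} s * h s)"
  have f: "?f \<in> borel_measurable borel"
    using h(1) unfolding set_borel_measurable_def by auto
  have Z: "jump_integral x y t ?f w = ennreal (\<Sum>s\<in>jump_set x y t w. h s)" if "w \<in> space M" for w
  proof -
    have "(\<Sum>s\<in>jump_set x y t w. ?f s) = (\<Sum>s\<in>jump_set x y t w. ennreal (h s))"
      by (rule sum.cong) (auto simp: jump_set_def)
    then show ?thesis
      by (simp add: nn_integral_count_space_finite[OF finite_jump_set[OF xy t that]] sum_ennreal h(2))
  qed
  have "(\<lambda>w. ennreal (\<Sum>s\<in>jump_set x y t w. h s)) \<in> borel_measurable M"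
    using jump_nn_integral[OF xy t f] by (subst measurable_cong[OF Z[symmetric]]) auto
  then have "(\<lambda>w. enn2real (ennreal (\<Sum>s\<in>jump_set x y t w. h s))) \<in> borel_measurable M"
    by (rule measurable_compose) measurable
  then have meas: "(\<lambda>w. \<Sum>s\<in>jump_set x y t w. h s) \<in> borel_measurable M"
    by (simp add: sum_nonneg h(2))
  have "(\<integral>\<^sup>+ w. ennreal (\<Sum>s\<in>jump_set x y t w. h s) \<partial>M) = (\<integral>\<^sup>+ s. ?f s * jump_intensity x y t s \<partial>lborel)"
    using jump_nn_integral[OF xy t f] nn_integral_cong[OF Z, of M "\<lambda>w. w"] by (simp add: nn_integral_cong[OF Z])
  also have "\<dots> = (\<integral>\<^sup>+ s. ennreal (indicator {0..t} s * (h s * jump_density x y s)) \<partial>lborel)"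
  proof (rule nn_integral_cong_AE)
    have "AE s in lborel. s \<noteq> (0::real)" by (rule AE_lborel_singleton)
    then show "AE s in lborel. ?f s * jump_intensity x y t s = ennreal (indicator {0..t} s * (h s * jump_density x y s))"
      by eventually_elim (auto simp: jump_intensity_def indicator_def ennreal_mult h(2) jump_density_nonneg)
  qed
  also have "\<dots> = ennreal (LBINT s:{0..t}. h s * jump_density x y s)"
    using int unfolding set_integrable_def set_lebesgue_integral_def
    by (subst nn_integral_eq_integral) (auto simp: indicator_def h(2) intro!: mult_nonneg_nonneg jump_density_nonneg)
  finally have nn: "(\<integral>\<^sup>+ w. ennreal (\<Sum>s\<in>jump_set x y t w. h s) \<partial>M) = ennreal (LBINT s:{0..t}. h s * jump_density x y s)" .
  show i: "integrable M (\<lambda>w. \<Sum>s\<in>jump_set x y t w. h s)"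
    by (rule integrableI_nn_integral_finite[OF meas _ nn]) (auto intro!: sum_nonneg h(2))
  have "0 \<le> (LBINT s:{0..t}. h s * jump_density x y s)"
    unfolding set_lebesgue_integral_def
    by (rule Bochner_Integration.integral_nonneg) (auto simp: indicator_def h(2) intro!: mult_nonneg_nonneg jump_density_nonneg)
  then show "expectation (\<lambda>w. \<Sum>s\<in>jump_set x y t w. h s) = (LBINT s:{0..t}. h s * jump_density x y s)"
    using nn by (subst integral_eq_nn_integral[OF meas]) (auto intro!: sum_nonneg h(2))
qed

lemma expectation_jump_set:
  assumes xy: "x \<noteq> y" and t: "0 < t" and h: "set_borel_measurable lborel {0..t} h"
    and int: "set_integrable lborel {0..t} (\<lambda>s. h s * jump_density x y s)"
  shows "integrable M (\<lambda>w. \<Sum>s\<in>jump_set x y t w. h s)"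
    and "expectation (\<lambda>w. \<Sum>s\<in>jump_set x y t w. h s) = (LBINT s:{0..t}. h s * jump_density x y s)"
proof -
  \<comment> \<open>\<open>c = 1\<close> and \<open>c = -1\<close> yield the positive and the
    negative part of \<open>h\<close> by one argument.\<close>
  have part: "set_borel_measurable lborel {0..t} (\<lambda>s. max 0 (c * h s))"
    "set_integrable lborel {0..t} (\<lambda>s. max 0 (c * h s) * jump_density x y s)" if "\<bar>c\<bar> = 1" for c :: real
  proof -
    have [measurable]: "(\<lambda>s. indicator {0..t} s * h s) \<in> borel_measurable borel"
      using h by (simp add: set_borel_measurable_def)
    have [measurable]: "(\<lambda>s. indicator {0..t} s * jump_density x y s) \<in> borel_measurable borel"
      using jump_density_set_measurable[OF order_refl, of t x y] by (simp add: set_borel_measurable_def)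
    have "(\<lambda>s. indicator {0..t} s * max 0 (c * (indicator {0..t} s * h s))) \<in> borel_measurable borel"
      by measurable
    also have "(\<lambda>s. indicator {0..t} s * max 0 (c * (indicator {0..t} s * h s))) = (\<lambda>s. indicator {0..t} s * max 0 (c * h s))"
      by (auto simp: indicator_def)
    finally show "set_borel_measurable lborel {0..t} (\<lambda>s. max 0 (c * h s))"
      by (simp add: set_borel_measurable_def)
    show "set_integrable lborel {0..t} (\<lambda>s. max 0 (c * h s) * jump_density x y s)"
    proof (rule set_integrable_bound[OF int])
      have "(\<lambda>s. max 0 (c * (indicator {0..t} s * h s)) * (indicator {0..t} s * jump_density x y s)) \<in> borel_measurable borel"
        by measurable
      also have "(\<lambda>s. max 0 (c * (indicator {0..t} s * h s)) * (indicator {0..t} s * jump_density x y s))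
          = (\<lambda>s. indicator {0..t} s * (max 0 (c * h s) * jump_density x y s))"
        by (auto simp: indicator_def)
      finally show "set_borel_measurable lborel {0..t} (\<lambda>s. max 0 (c * h s) * jump_density x y s)"
        by (simp add: set_borel_measurable_def)
      have "\<bar>max 0 (c * h s)\<bar> \<le> \<bar>h s\<bar>" for s
      proof -
        have "\<bar>c * h s\<bar> = \<bar>h s\<bar>" using that by (simp add: abs_mult)
        then show ?thesis by linarith
      qed
      then show "AE s in lborel. s \<in> {0..t} \<longrightarrow> norm (max 0 (c * h s) * jump_density x y s) \<le> norm (h s * jump_density x y s)"
        by (auto simp: abs_mult intro!: mult_right_mono)
    qed
  qed
  note pos = expectation_jump_set_nonneg[OF xy t part(1)[of 1] _ part(2)[of 1]]
  note neg = expectation_jump_set_nonneg[OF xy t part(1)[of "- 1"] _ part(2)[of "- 1"]]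
  have decomp: "h s = max 0 (1 * h s) - max 0 (- 1 * h s)" for s by simp
  have sums: "(\<Sum>s\<in>J. h s) = (\<Sum>s\<in>J. max 0 (1 * h s)) - (\<Sum>s\<in>J. max 0 (- 1 * h s))" for J
    by (subst decomp) (rule sum_subtractf)
  show "integrable M (\<lambda>w. \<Sum>s\<in>jump_set x y t w. h s)"
    unfolding sums by (intro Bochner_Integration.integrable_diff pos neg) auto
  have "expectation (\<lambda>w. \<Sum>s\<in>jump_set x y t w. h s)
      = (LBINT s:{0..t}. max 0 (1 * h s) * jump_density x y s) - (LBINT s:{0..t}. max 0 (- 1 * h s) * jump_density x y s)"
    unfolding sums using pos neg by (subst Bochner_Integration.integral_diff) auto
  also have "\<dots> = (LBINT s:{0..t}. max 0 (1 * h s) * jump_density x y s - max 0 (- 1 * h s) * jump_density x y s)"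
    by (rule set_integral_diff(2)[symmetric]) (intro part; simp)+
  also have "\<dots> = (LBINT s:{0..t}. h s * jump_density x y s)"
    unfolding left_diff_distrib[symmetric] decomp[symmetric] ..
  finally show "expectation (\<lambda>w. \<Sum>s\<in>jump_set x y t w. h s) = (LBINT s:{0..t}. h s * jump_density x y s)" .
qed

lemma jump_sum_eq:
  assumes t: "0 < t" and w: "w \<in> space M"
  shows "jump_sum \<alpha> t (\<lambda>s. X s w) = (\<Sum>x\<in>UNIV. \<Sum>y\<in>- {x}. \<Sum>s\<in>jump_set x y t w. \<alpha> s x y)"
proof -
  let ?f = "\<lambda>s. X s w"
  let ?a = "\<lambda>s. \<alpha> s (left_value ?f s) (?f s)"
  have fin: "finite (jump_set x y t w)" if "y \<in> - {x}" for x y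
    using finite_jump_set[OF _ t w, of x y] that by auto
  have "jump_times ?f t = (\<Union>x. \<Union>y\<in>- {x}. jump_set x y t w)"
    by (auto simp: jump_times_def jump_set_def jumps_def)
  then have "jump_sum \<alpha> t ?f = (\<Sum>s\<in>(\<Union>x. \<Union>y\<in>- {x}. jump_set x y t w). ?a s)"
    by (simp add: jump_sum_def)
  also have "\<dots> = (\<Sum>x\<in>UNIV. \<Sum>s\<in>(\<Union>y\<in>- {x}. jump_set x y t w). ?a s)"
    by (rule sum.UNION_disjoint) (use fin in \<open>auto simp: jump_set_def jumps_def simp del: UN_simps\<close>)
  also have "\<dots> = (\<Sum>x\<in>UNIV. \<Sum>y\<in>- {x}. \<Sum>s\<in>jump_set x y t w. ?a s)"
    by (intro sum.cong refl sum.UNION_disjoint) (use fin in \<open>auto simp: jump_set_def jumps_def simp del: UN_simps\<close>)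
  also have "\<dots> = (\<Sum>x\<in>UNIV. \<Sum>y\<in>- {x}. \<Sum>s\<in>jump_set x y t w. \<alpha> s x y)"
    by (intro sum.cong refl) (auto simp: jump_set_def jumps_def)
  finally show ?thesis .
qed

theorem expectation_jump_sum:
  assumes t: "0 < t" and \<alpha>: "\<And>x y. set_borel_measurable lborel {0..t} (\<lambda>s. \<alpha> s x y)"
    and int: "\<And>x y. x \<noteq> y \<Longrightarrow> set_integrable lborel {0..t} (\<lambda>s. \<alpha> s x y * q s x y)"
  shows "integrable M (\<lambda>w. jump_sum \<alpha> t (\<lambda>s. X s w))"
    and "\<And>x y. x \<noteq> y \<Longrightarrow> set_integrable lborel {0..t} (\<lambda>s. law s x * (\<alpha> s x y * q s x y))"
    and "expectation (\<lambda>w. jump_sum \<alpha> t (\<lambda>s. X s w))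
      = (\<Sum>x\<in>UNIV. \<Sum>y\<in>- {x}. LBINT s:{0..t}. law s x * (\<alpha> s x y * q s x y))"
proof -
  show i: "set_integrable lborel {0..t} (\<lambda>s. law s x * (\<alpha> s x y * q s x y))" if "x \<noteq> y" for x y
    by (rule set_integrable_bounded_mult[OF int[OF that] linear_flow_set_measurable[OF law_flow order_refl], of _ 1])
       (use law_nonneg law_le_1 in auto)
  have eq: "law s x * (\<alpha> s x y * q s x y) = \<alpha> s x y * jump_density x y s" for s x y
    by (simp add: jump_density_def)
  have pair: "integrable M (\<lambda>w. \<Sum>s\<in>jump_set x y t w. \<alpha> s x y)"
    "expectation (\<lambda>w. \<Sum>s\<in>jump_set x y t w. \<alpha> s x y) = (LBINT s:{0..t}. law s x * (\<alpha> s x y * q s x y))"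
    if "y \<in> - {x}" for x y
    using expectation_jump_set[OF _ t \<alpha>, of x y] i[of x y] that by (auto simp: eq)
  show "integrable M (\<lambda>w. jump_sum \<alpha> t (\<lambda>s. X s w))"
    by (subst Bochner_Integration.integrable_cong[OF refl jump_sum_eq[OF t]])
       (auto intro!: Bochner_Integration.integrable_sum pair)
  have "expectation (\<lambda>w. jump_sum \<alpha> t (\<lambda>s. X s w)) = expectation (\<lambda>w. \<Sum>x\<in>UNIV. \<Sum>y\<in>- {x}. \<Sum>s\<in>jump_set x y t w. \<alpha> s x y)"
    by (rule Bochner_Integration.integral_cong[OF refl jump_sum_eq[OF t]])
  also have "\<dots> = (\<Sum>x\<in>UNIV. \<Sum>y\<in>- {x}. expectation (\<lambda>w. \<Sum>s\<in>jump_set x y t w. \<alpha> s x y))"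
    by (subst Bochner_Integration.integral_sum, (intro Bochner_Integration.integrable_sum pair; simp),
        intro sum.cong refl Bochner_Integration.integral_sum pair)
  also have "\<dots> = (\<Sum>x\<in>UNIV. \<Sum>y\<in>- {x}. LBINT s:{0..t}. law s x * (\<alpha> s x y * q s x y))"
    by (intro sum.cong refl pair)
  finally show "expectation (\<lambda>w. jump_sum \<alpha> t (\<lambda>s. X s w))
      = (\<Sum>x\<in>UNIV. \<Sum>y\<in>- {x}. LBINT s:{0..t}. law s x * (\<alpha> s x y * q s x y))" .
qed

end

section \<open>Derivatives of weighted integrals and Fourier coefficients\<close>

text \<open>The error \<open>C * l\<^sup>2\<close> is uniform in \<open>s\<close>, so integration
  only multiplies it by the integral of \<open>norm (c s)\<close>. Banach values cover the complex
  weights of Fourier coefficients.\<close>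

lemma has_vector_derivative_weighted_integral:
  fixes c :: "real \<Rightarrow> 'a::{banach, second_countable_topology}" and h :: "real \<Rightarrow> real \<Rightarrow> real"
  assumes c: "set_integrable lborel A c"
    and h: "\<And>l. set_integrable lborel A (\<lambda>s. h l s *\<^sub>R c s)"
    and a: "set_integrable lborel A (\<lambda>s. a s *\<^sub>R c s)"
    and b: "set_integrable lborel A (\<lambda>s. b s *\<^sub>R c s)"
    and bound: "\<And>l s. \<bar>l\<bar> \<le> 1 \<Longrightarrow> s \<in> A \<Longrightarrow> \<bar>h l s - a s - l * b s\<bar> \<le> C * l\<^sup>2"
  shows "((\<lambda>l. LBINT s:A. h l s *\<^sub>R c s) has_vector_derivative (LBINT s:A. b s *\<^sub>R c s)) (at 0)"
proof (rule has_vector_derivative_quadratic)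
  fix l :: real assume l: "\<bar>l\<bar> \<le> 1"
  have lb: "set_integrable lborel A (\<lambda>s. l *\<^sub>R (b s *\<^sub>R c s))"
    using b by (rule set_integrable_scaleR_right)
  have eq: "(h l s - a s - l * b s) *\<^sub>R c s = h l s *\<^sub>R c s - a s *\<^sub>R c s - l *\<^sub>R (b s *\<^sub>R c s)" for s
    by (simp add: scaleR_diff_left)
  have i: "set_integrable lborel A (\<lambda>s. (h l s - a s - l * b s) *\<^sub>R c s)"
    unfolding eq by (intro set_integral_diff(1) h a lb)
  have "(LBINT s:A. h l s *\<^sub>R c s) - (LBINT s:A. a s *\<^sub>R c s) - l *\<^sub>R (LBINT s:A. b s *\<^sub>R c s)
      = (LBINT s:A. (h l s - a s - l * b s) *\<^sub>R c s)"
    unfolding eq set_integral_diff(2)[OF set_integral_diff(1)[OF h a] lb] set_integral_diff(2)[OF h a] set_integral_scaleR_right ..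
  also have "norm \<dots> \<le> (LBINT s:A. norm ((h l s - a s - l * b s) *\<^sub>R c s))"
    by (rule set_integral_norm_bound[OF i])
  also have "\<dots> \<le> (LBINT s:A. C * l\<^sup>2 * norm (c s))"
    by (rule set_integral_mono[OF set_integrable_norm[OF i]])
       (use set_integrable_norm[OF c] in simp, use bound[OF l] in \<open>simp add: mult_right_mono\<close>)
  also have "\<dots> = C * (LBINT s:A. norm (c s)) * l\<^sup>2" by simp
  finally show "norm ((LBINT s:A. h l s *\<^sub>R c s) - (LBINT s:A. a s *\<^sub>R c s) - l *\<^sub>R (LBINT s:A. b s *\<^sub>R c s))
      \<le> C * (LBINT s:A. norm (c s)) * l\<^sup>2" .
qed

lemma has_real_derivative_weighted_integral:
  fixes c :: "real \<Rightarrow> real" and h :: "real \<Rightarrow> real \<Rightarrow> real"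
  assumes "set_integrable lborel A c" "\<And>l. set_integrable lborel A (\<lambda>s. h l s * c s)"
    "set_integrable lborel A (\<lambda>s. a s * c s)" "set_integrable lborel A (\<lambda>s. b s * c s)"
    "\<And>l s. \<bar>l\<bar> \<le> 1 \<Longrightarrow> s \<in> A \<Longrightarrow> \<bar>h l s - a s - l * b s\<bar> \<le> C * l\<^sup>2"
  shows "((\<lambda>l. LBINT s:A. h l s * c s) has_real_derivative (LBINT s:A. b s * c s)) (at 0)"
  using has_vector_derivative_weighted_integral[of A c h a b C] assms
  by (simp add: has_real_derivative_iff_has_vector_derivative)

context periodic_perturbation
begin

text \<open>Once \<open>\<beta>\<close> is identified, this is the stationary correlation of
  \<open>v\<close> at time \<open>s\<close> with \<open>\<phi>\<close> at time 0, expressed through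
  the semigroup.\<close>

definition correlation_integrand :: "('x \<Rightarrow> real) \<Rightarrow> real \<Rightarrow> real" where
  "correlation_integrand v s = (\<Sum>y\<in>UNIV. v y * row_mult \<beta> (S s) y)"

lemma correlation_integrable: "set_integrable lborel {0..} (correlation_integrand v)"
  unfolding correlation_integrand_def[abs_def]
  by (intro set_integrable_sum set_integrable_mult_right S_row_integrable \<beta>_mass)

lemma correlation_convolution:
  shows "set_integrable lborel {0..} (\<lambda>s. \<tau> (t - s) * correlation_integrand v s)"
    and "(LBINT s:{0..}. \<tau> (t - s) * correlation_integrand v s) = (\<Sum>y\<in>UNIV. v y * response t y)"
proof -
  have eq: "\<tau> (t - s) * correlation_integrand v s = (\<Sum>y\<in>UNIV. v y * (\<tau> (t - s) * row_mult \<beta> (S s) y))" for s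
    by (simp add: correlation_integrand_def sum_distrib_left mult_ac)
  have i: "set_integrable lborel {0..} (\<lambda>s. v y * (\<tau> (t - s) * row_mult \<beta> (S s) y))" for y
    by (intro set_integrable_mult_right response_integrable')
  then show "set_integrable lborel {0..} (\<lambda>s. \<tau> (t - s) * correlation_integrand v s)"
    unfolding eq by (rule set_integrable_sum)
  show "(LBINT s:{0..}. \<tau> (t - s) * correlation_integrand v s) = (\<Sum>y\<in>UNIV. v y * response t y)"
    unfolding eq by (subst set_integral_sum[OF i]) (simp add: response_def)
qed

lemma response_uniform_bound: "\<exists>C. \<forall>t y. \<bar>response t y\<bar> \<le> C"
proof -
  obtain c where c: "\<And>t y. \<bar>response t y\<bar> \<le> c y" using response_bounded by metis
  have "c y \<le> (\<Sum>y\<in>UNIV. c y)" for y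
    by (rule member_le_sum) (auto intro: order_trans[OF abs_ge_zero c])
  then show ?thesis using c order_trans by blast
qed

text \<open>Expected jump sums contain the product of law and rate, both of which depend on
  \<open>l\<close>. The product rule adds \<open>m x * (\<tau> t * E x y)\<close>, the direct effect
  of the perturbation on the jump rates.\<close>

lemma weighted_law_expansion:
  fixes p :: "real \<Rightarrow> real \<Rightarrow> 'x \<Rightarrow> real"
  assumes C: "\<And>l t x. \<bar>l\<bar> \<le> 1 \<Longrightarrow> 0 \<le> t \<Longrightarrow> \<bar>p l t x - m x - l * response t x\<bar> \<le> C * l\<^sup>2"
  shows "\<exists>C'. \<forall>l t x y. \<bar>l\<bar> \<le> 1 \<longrightarrow> 0 \<le> t \<longrightarrow>
    \<bar>p l t x * exp (l * (\<tau> t * E x y)) - m x - l * (response t x + m x * (\<tau> t * E x y))\<bar> \<le> C' * l\<^sup>2"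
proof -
  obtain CD where CD: "\<And>t x. \<bar>response t x\<bar> \<le> CD" using response_uniform_bound by blast
  let ?e = "exp exponent_bound" and ?b = exponent_bound
  have "\<bar>p l t x * exp (l * (\<tau> t * E x y)) - m x - l * (response t x + m x * (\<tau> t * E x y))\<bar>
      \<le> (C * ?e + ?e * ?b\<^sup>2 + CD * (?e * ?b)) * l\<^sup>2" if l: "\<bar>l\<bar> \<le> 1" and t: "0 \<le> t" for l t x y
  proof -
    define z where "z = l * (\<tau> t * E x y)"
    have z: "exp z \<le> ?e"
    proof -
      have "\<bar>z\<bar> \<le> 1 * ?b"
        unfolding z_def abs_mult[of l] by (rule mult_mono[OF l exponent_bound]) auto
      then show ?thesis by simp
    qed
    have "m x \<le> 1" using member_le_sum[of x UNIV m] m_nonneg m_mass by simp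
    \<comment> \<open>Each summand is of second order: the remainder for the law, the remainder of
      the exponential, and a product of two first-order terms.\<close>
    have eq: "p l t x * exp z - m x - l * (response t x + m x * (\<tau> t * E x y))
        = (p l t x - m x - l * response t x) * exp z + m x * (exp z - 1 - z) + l * response t x * (exp z - 1)"
      by (simp add: z_def algebra_simps)
    have "\<bar>p l t x * exp z - m x - l * (response t x + m x * (\<tau> t * E x y))\<bar> \<le> \<bar>p l t x - m x - l * response t x\<bar> * exp z + m x * \<bar>exp z - 1 - z\<bar> + \<bar>l\<bar> * \<bar>response t x\<bar> * \<bar>exp z - 1\<bar>"
      unfolding eq using m_nonneg[of x]
      by (intro order_trans[OF abs_triangle_ineq] add_mono order_refl) (simp_all add: abs_mult)
    also have "\<dots> \<le> C * l\<^sup>2 * ?e + 1 * (l\<^sup>2 * (?e * ?b\<^sup>2)) + \<bar>l\<bar> * CD * (\<bar>l\<bar> * (?e * ?b))"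
    proof (intro add_mono mult_mono C l t z CD order_refl)
      show "\<bar>exp z - 1 - z\<bar> \<le> l\<^sup>2 * (?e * ?b\<^sup>2)" unfolding z_def by (rule exp_second_order[OF l])
      show "\<bar>exp z - 1\<bar> \<le> \<bar>l\<bar> * (?e * ?b)" unfolding z_def by (rule exp_first_order[OF l])
      show "0 \<le> C * l\<^sup>2" using C[OF l t, of x] by linarith
      show "0 \<le> \<bar>l\<bar> * CD" using CD[of t x] by (intro mult_nonneg_nonneg) auto
    qed (use \<open>m x \<le> 1\<close> in auto)
    also have "\<dots> = (C * ?e + ?e * ?b\<^sup>2 + CD * (?e * ?b)) * (\<bar>l\<bar> * \<bar>l\<bar>)"
      by (simp add: power2_eq_square algebra_simps)
    finally show ?thesis by (simp add: z_def power2_eq_square)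
  qed
  then show ?thesis by blast
qed

text \<open>The response is a convolution with \<open>\<tau>\<close>, so its Fourier coefficient
  factorises. After Fubini, \<open>e t = e (t - s) * e s\<close> splits off the kernel, and what
  remains is an integral over a shifted period, which the shift does not change.\<close>

lemma fourier_response:
  fixes k :: int
  defines "e \<equiv> \<lambda>t. exp (- \<i> * of_int k * of_real (2 * pi / T) * of_real t)"
  shows "set_integrable lborel {0..} (\<lambda>s. e s * complex_of_real (correlation_integrand v s))"
    and "fourier_coeff T k (\<lambda>t. \<Sum>y\<in>UNIV. v y * response t y)
      = fourier_coeff T k \<tau> * (LBINT s:{0..}. e s * complex_of_real (correlation_integrand v s))"
proof -
  let ?g = "\<lambda>s. indicator {0..} s * correlation_integrand v s"
  have e_norm: "norm (e t) = 1" for t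
    unfolding e_def norm_exp_eq_Re by simp
  have e_add: "e (t + s) = e t * e s" for t s
    unfolding e_def exp_add[symmetric] by (simp only: of_real_add distrib_left)
  have e_T: "e (t + T) = e t" for t
  proof -
    have "e T = exp ((2 * of_int (- k) * pi) * \<i>)"
      unfolding e_def using T_pos by (simp add: algebra_simps)
    also have "\<dots> = 1" by (rule exp_integer_2pi) simp
    finally show ?thesis by (simp add: e_add)
  qed
  have [measurable]: "e \<in> borel_measurable borel"
    unfolding e_def by (intro borel_measurable_continuous_onI continuous_intros)
  have [measurable]: "?g \<in> borel_measurable borel" and g_int: "integrable lborel ?g"
    using correlation_integrable[of v] by (auto simp: set_integrable_def dest: borel_measurable_integrable)
  show "set_integrable lborel {0..} (\<lambda>s. e s * complex_of_real (correlation_integrand v s))"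
  proof (rule set_integrable_bound[OF correlation_integrable[of v]])
    have "(\<lambda>s. e s * complex_of_real (?g s)) \<in> borel_measurable borel" by measurable
    then show "set_borel_measurable lborel {0..} (\<lambda>s. e s * complex_of_real (correlation_integrand v s))"
      by (simp add: set_borel_measurable_def scaleR_conv_of_real mult_ac)
  qed (simp add: norm_mult e_norm)
  \<comment> \<open>Cut to one period in \<open>t\<close>, the double integrand is dominated by
    \<open>B\<close> times the integrable kernel in \<open>s\<close>, which justifies
    Fubini.\<close>
  define F where "F t s = indicator {0..T} t *\<^sub>R (e t * complex_of_real (\<tau> (t - s) * ?g s))" for t s
  have F_int: "integrable (lborel \<Otimes>\<^sub>M lborel) (\<lambda>(t, s). F t s)"
  proof (rule Bochner_Integration.integrable_bound)
    show "integrable (lborel \<Otimes>\<^sub>M lborel) (\<lambda>(t, s). (indicator {0..T} t * B) * ?g s)"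
    proof (rule lborel_pair.Fubini_integrable)
      show "integrable lborel (\<lambda>x. LBINT y. norm (case (x, y) of (t, s) \<Rightarrow> indicat_real {0..T} t * B * ?g s))"
        by (simp add: abs_mult emeasure_lborel_Icc_eq)
    qed (use g_int in \<open>auto simp: case_prod_unfold\<close>)
    show "(\<lambda>(t, s). F t s) \<in> borel_measurable (lborel \<Otimes>\<^sub>M lborel)"
      unfolding F_def case_prod_unfold by measurable
    show "AE z in lborel \<Otimes>\<^sub>M lborel. norm (case z of (t, s) \<Rightarrow> F t s) \<le> norm (case z of (t, s) \<Rightarrow> indicat_real {0..T} t * B * ?g s)"
    proof (rule AE_I2, clarify)
      fix t s :: real
      show "norm (F t s) \<le> norm (indicat_real {0..T} t * B * ?g s)"
        using mult_right_mono[OF \<tau>_bound[of "t - s"], of "\<bar>correlation_integrand v s\<bar>"] B_nonneg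
        by (auto simp: F_def indicator_def norm_mult e_norm abs_mult)
    qed
  qed
  have "(LBINT t:{0..T}. e t * complex_of_real (\<Sum>y\<in>UNIV. v y * response t y)) = (LBINT t. (LBINT s. F t s))"
    unfolding set_lebesgue_integral_def
  proof (rule Bochner_Integration.integral_cong[OF refl])
    fix t :: real
    have "(LBINT s. F t s) = indicator {0..T} t *\<^sub>R (e t * complex_of_real (LBINT s. \<tau> (t - s) * ?g s))"
      unfolding F_def by (simp del: of_real_mult)
    also have "(LBINT s. \<tau> (t - s) * ?g s) = (\<Sum>y\<in>UNIV. v y * response t y)"
      unfolding correlation_convolution(2)[symmetric] set_lebesgue_integral_def by (simp add: mult_ac)
    finally show "indicator {0..T} t *\<^sub>R (e t * complex_of_real (\<Sum>y\<in>UNIV. v y * response t y)) = (LBINT s. F t s)" by simp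
  qed
  also have "\<dots> = (LBINT s. (LBINT t. F t s))"
    by (rule lborel_pair.Fubini_integral[OF F_int, symmetric])
  also have "\<dots> = (LBINT s. (LBINT u:{0..T}. e u * complex_of_real (\<tau> u)) * (e s * complex_of_real (?g s)))"
  proof (rule Bochner_Integration.integral_cong[OF refl])
    fix s :: real
    have "(LBINT t. F t s) = (LBINT t:{0..T}. (e (t - s) * complex_of_real (\<tau> (t - s))) * (e s * complex_of_real (?g s)))"
      unfolding F_def set_lebesgue_integral_def
      by (intro Bochner_Integration.integral_cong refl) (simp add: mult_ac flip: e_add)
    also have "\<dots> = (LBINT t:{0..T}. e (t - s) * complex_of_real (\<tau> (t - s))) * (e s * complex_of_real (?g s))"
      by (rule set_integral_mult_left)
    also have "(LBINT t:{0..T}. e (t - s) * complex_of_real (\<tau> (t - s))) = (LBINT u:{- s..- s + T}. e u * complex_of_real (\<tau> u))"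
      using set_integral_shift_Icc(1)[of 0 T "\<lambda>u. e u * complex_of_real (\<tau> u)" "- s"] by (simp add: add.commute)
    also have "\<dots> = (LBINT u:{0..T}. e u * complex_of_real (\<tau> u))"
      by (rule set_integral_periodic[of _ B]) (auto simp: norm_mult e_norm \<tau>_bound T_pos e_T \<tau>_periodic)
    finally show "(LBINT t. F t s) = (LBINT u:{0..T}. e u * complex_of_real (\<tau> u)) * (e s * complex_of_real (?g s))" .
  qed
  also have "\<dots> = (LBINT u:{0..T}. e u * complex_of_real (\<tau> u)) * (LBINT s:{0..}. e s * complex_of_real (correlation_integrand v s))"
  proof -
    have "(LBINT s. e s * complex_of_real (?g s)) = (LBINT s:{0..}. e s * complex_of_real (correlation_integrand v s))"
      unfolding set_lebesgue_integral_def by (simp add: scaleR_conv_of_real mult_ac)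
    then show ?thesis by (subst integral_mult_right_zero) simp
  qed
  finally show "fourier_coeff T k (\<lambda>t. \<Sum>y\<in>UNIV. v y * response t y)
      = fourier_coeff T k \<tau> * (LBINT s:{0..}. e s * complex_of_real (correlation_integrand v s))"
    unfolding fourier_coeff_def e_def by simp
qed

end

section \<open>The response formulas\<close>

theorem theorem4p8:
  fixes r :: "'x::finite \<Rightarrow> 'x \<Rightarrow> real"
    and \<mu> :: "'x pmf"
    and P\<^sub>0 :: "real \<Rightarrow> real \<Rightarrow> 'x \<Rightarrow> 'x \<Rightarrow> real"
    and N :: "'v measure" and Y :: "real \<Rightarrow> 'v \<Rightarrow> 'x"
    and T :: real
    and g :: "real \<Rightarrow> 'x \<Rightarrow> 'x \<Rightarrow> real"
    and \<tau> :: "real \<Rightarrow> real"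
    and E E' :: "'x \<Rightarrow> 'x \<Rightarrow> real"
    and \<phi> :: "'x \<Rightarrow> real"
    and P :: "real \<Rightarrow> real \<Rightarrow> real \<Rightarrow> 'x \<Rightarrow> 'x \<Rightarrow> real"
    and \<nu> :: "real \<Rightarrow> 'x pmf"
    and M :: "real \<Rightarrow> 'w measure" and X :: "real \<Rightarrow> real \<Rightarrow> 'w \<Rightarrow> 'x"
  assumes r_nonneg: "\<And>x y. r x y \<ge> 0"
    and r_diag: "\<And>x. r x x = 0"
    and r_irreducible: "irreducible_rates r"
    and \<mu>_invariant: "invariant_for_rates r \<mu>"
    and unperturbed: "markov_jump_process (\<lambda>s. r) P\<^sub>0 \<mu> N Y"
    and T_pos: "T > 0"
    and \<tau>_bounded: "bounded (range \<tau>)"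
    and \<tau>_measurable: "\<tau> \<in> borel_measurable borel"
    and \<tau>_periodic: "\<And>s. \<tau> (s + T) = \<tau> s"
    and g_eq: "\<And>s x y. g s x y = \<tau> s * E x y"
    and perturbed: "\<And>l. markov_jump_process (perturbed_rate r g l) (P l) (\<nu> l) (M l) (X l)"
    and \<nu>_invariant: "\<And>l. invariant_for_matrix (P l 0 T) (\<nu> l)"
    and E'_eq: "\<And>x y. E' x y = E y x"
    and \<phi>_eq: "\<And>x. \<phi> x = contraction (reversed_rate \<mu> r) E' x - contraction r E x"
  shows
    "(\<forall>s x. response_potential \<mu> r g s x = \<tau> s * \<phi> x)
    \<and> (\<forall>(v :: 'x \<Rightarrow> real) t. t \<ge> 0 \<longrightarrow>
        set_integrable lborel {0..} (\<lambda>s. \<tau> (t - s) * (LINT w|N. v (Y s w) * \<phi> (Y 0 w))) \<and>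
        ((\<lambda>l. LINT w|M l. v (X l t w)) has_real_derivative
          (LINT s:{0..}|lborel. \<tau> (t - s) * (LINT w|N. v (Y s w) * \<phi> (Y 0 w)))) (at 0))
    \<and> (\<forall>(v :: real \<Rightarrow> 'x \<Rightarrow> real) t. t > 0 \<longrightarrow>
        (\<forall>x. set_integrable lborel {0..t} (\<lambda>s. v s x)) \<longrightarrow>
        (\<forall>l. integrable (M l) (\<lambda>w. LINT s:{0..t}|lborel. v s (X l s w))) \<and>
        (\<forall>u\<in>{0..t}. set_integrable lborel {0..}
          (\<lambda>s. \<tau> (u - s) * (LINT w|N. v u (Y s w) * \<phi> (Y 0 w)))) \<and>
        set_integrable lborel {0..t} (\<lambda>u. LINT s:{0..}|lborel.
          \<tau> (u - s) * (LINT w|N. v u (Y s w) * \<phi> (Y 0 w))) \<and>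
        ((\<lambda>l. LINT w|M l. (LINT s:{0..t}|lborel. v s (X l s w))) has_real_derivative
          (LINT u:{0..t}|lborel. (LINT s:{0..}|lborel.
            \<tau> (u - s) * (LINT w|N. v u (Y s w) * \<phi> (Y 0 w))))) (at 0))
    \<and> (\<forall>(\<alpha> :: real \<Rightarrow> 'x \<Rightarrow> 'x \<Rightarrow> real) t. t > 0 \<longrightarrow>
        (\<forall>x y. set_borel_measurable lborel {0..t} (\<lambda>s. \<alpha> s x y)) \<longrightarrow>
        (\<forall>x. set_integrable lborel {0..t} (\<lambda>s. contraction r (\<lambda>x y. \<bar>\<alpha> s x y\<bar>) x)) \<longrightarrow>
        (\<forall>l. integrable (M l) (\<lambda>w. jump_sum \<alpha> t (\<lambda>s. X l s w))) \<and>
        set_integrable lborel {0..t}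
          (\<lambda>s. \<tau> s * (LINT w|N. contraction r (\<lambda>x y. \<alpha> s x y * E x y) (Y s w))) \<and>
        (\<forall>s\<in>{0..t}. set_integrable lborel {0..}
          (\<lambda>u. \<tau> (s - u) * (LINT w|N. contraction r (\<alpha> s) (Y u w) * \<phi> (Y 0 w)))) \<and>
        set_integrable lborel {0..t} (\<lambda>s. LINT u:{0..}|lborel.
          \<tau> (s - u) * (LINT w|N. contraction r (\<alpha> s) (Y u w) * \<phi> (Y 0 w))) \<and>
        ((\<lambda>l. LINT w|M l. jump_sum \<alpha> t (\<lambda>s. X l s w)) has_real_derivative
          ((LINT s:{0..t}|lborel.
              \<tau> s * (LINT w|N. contraction r (\<lambda>x y. \<alpha> s x y * E x y) (Y s w)))
           + (LINT s:{0..t}|lborel. (LINT u:{0..}|lborel.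
              \<tau> (s - u) * (LINT w|N. contraction r (\<alpha> s) (Y u w) * \<phi> (Y 0 w)))))) (at 0))
    \<and> (\<forall>(v :: 'x \<Rightarrow> real) (k :: int) (f :: real \<Rightarrow> real \<Rightarrow> real).
        (\<forall>l. \<forall>t\<ge>0. f l t = (LINT w|M l. v (X l t w))) \<longrightarrow>
        (\<forall>l. \<forall>t\<ge>0. f l (t + T) = f l t) \<and>
        (\<forall>l. set_integrable lborel {0..T} (f l)) \<and>
        set_integrable lborel {0..}
          (\<lambda>s. exp (- \<i> * of_int k * of_real (2 * pi / T) * of_real s) *
               complex_of_real (LINT w|N. v (Y s w) * \<phi> (Y 0 w))) \<and>
        ((\<lambda>l. fourier_coeff T k (f l)) has_vector_derivative
          (fourier_coeff T k \<tau> *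
           (LINT s:{0..}|lborel.
              exp (- \<i> * of_int k * of_real (2 * pi / T) * of_real s) *
              complex_of_real (LINT w|N. v (Y s w) * \<phi> (Y 0 w))))) (at 0))"
proof -
  obtain B where \<tau>_bound: "\<And>s. \<bar>\<tau> s\<bar> \<le> B"
    using \<tau>_bounded by (auto simp: bounded_iff)
  have g: "g = (\<lambda>s x y. \<tau> s * E x y)" by (intro ext g_eq)
  interpret U: jump_process "\<lambda>s. r" P\<^sub>0 \<mu> N Y "2 * (\<Sum>x\<in>UNIV. l1_norm (r x))"
  proof
    show "markov_jump_process (\<lambda>s. r) P\<^sub>0 \<mu> N Y" by (rule unperturbed)
    show "l1_norm (generator r x) \<le> 2 * (\<Sum>x\<in>UNIV. l1_norm (r x))" for x
      using l1_norm_generator_le[of r x] member_le_sum[of x UNIV "\<lambda>x. l1_norm (r x)"] by simp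
  qed (auto simp: r_nonneg)
  interpret R: periodic_perturbation r "P\<^sub>0 0" "pmf \<mu>" T \<tau> B E
  proof
    show "linear_flow (\<lambda>_. generator r) (\<lambda>t. P\<^sub>0 0 t x)" for x
      by (rule transition_function_linear_flow[OF U.transition])
    show "row_mult (pmf \<mu>) (generator r) y = 0" for y
      using \<mu>_invariant by (simp add: invariant_for_rates_def row_mult_def)
    show "\<tau> (s + T) = \<tau> s" for s by (rule \<tau>_periodic)
  qed (auto simp: r_nonneg r_irreducible U.P_0_0 U.P_nonneg U.P_mass sum_pmf_eq_1 T_pos \<tau>_measurable \<tau>_bound)
  have rate: "perturbed_rate r g l = R.rate l" for l by (simp add: R.rate_def g)
  \<comment> \<open>This bound grows with \<open>l\<close>, but it serves uniqueness and jump counts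
    for one \<open>l\<close> at a time; uniformity in \<open>l\<close> comes from the expansions of
    the exponential.\<close>
  have process: "jump_process (R.rate l) (P l) (\<nu> l) (M l) (X l) (2 * exp (\<bar>l\<bar> * R.exponent_bound) * R.rate_bound)" for l
    by unfold_locales (use perturbed[of l] in \<open>auto simp: rate R.rate_nonneg intro: R.generator_rate_bound\<close>)
  define p where "p l = jump_process.law (P l) (\<nu> l)" for l
  note p_flow = jump_process.law_flow[OF process, folded p_def]
  note p_nonneg = jump_process.law_nonneg[OF process, folded p_def]
  note p_mass = jump_process.law_mass[OF process, folded p_def]
  note p_le_1 = jump_process.law_le_1[OF process, folded p_def]
  note p_at = jump_process.expectation_at[OF process, folded p_def]
  \<comment> \<open>Invariance under \<open>P l 0 T\<close> says that the law at time
    \<open>T\<close> is the initial one. As the rates have period \<open>T\<close>, the shifted law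
    solves the same equation, and uniqueness gives equality at all times.\<close>
  have p_periodic: "p l (t + T) y = p l t y" if t: "0 \<le> t" for l t y
  proof (rule linear_flow_unique[OF _ p_flow R.generator_rate_bound _ t])
    show "linear_flow (\<lambda>u. generator (R.rate l u)) (\<lambda>u. p l (u + T))"
      using linear_flow_shift[OF p_flow[of l], of T] T_pos by (simp add: R.rate_periodic)
    show "p l (0 + T) y = p l 0 y" for y
      using \<nu>_invariant[of l] unfolding p_def jump_process.law_0[OF process]
      by (simp add: jump_process.law_def[OF process] invariant_for_matrix_def row_mult_def)
  qed
  obtain C where C: "\<And>l t y. \<bar>l\<bar> \<le> 1 \<Longrightarrow> 0 \<le> t \<Longrightarrow> \<bar>p l t y - pmf \<mu> y - l * R.response t y\<bar> \<le> C * l\<^sup>2"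
    using R.linear_response[of p, OF p_flow p_nonneg p_mass p_periodic] by blast
  obtain C' where C': "\<And>l t x y. \<bar>l\<bar> \<le> 1 \<Longrightarrow> 0 \<le> t \<Longrightarrow>
      \<bar>p l t x * exp (l * (\<tau> t * E x y)) - pmf \<mu> x - l * (R.response t x + pmf \<mu> x * (\<tau> t * E x y))\<bar> \<le> C' * l\<^sup>2"
    using R.weighted_law_expansion[of p C, OF C] by blast
  obtain CD where CD: "\<And>t y. \<bar>R.response t y\<bar> \<le> CD" using R.response_uniform_bound by blast
  have \<mu>_pos: "0 < pmf \<mu> x" for x
    by (rule R.invariant_pos[OF R.m_invariant R.m_nonneg R.m_mass])
  \<comment> \<open>The incoming part of the generator, multiplied and divided by
    \<open>pmf \<mu> x\<close>, is the contraction with the reversed rates; the diagonal part gives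
    the contraction with \<open>r\<close>.\<close>
  have \<beta>: "R.\<beta> x = pmf \<mu> x * \<phi> x" for x
  proof -
    have "R.\<beta> x = (\<Sum>z\<in>UNIV. pmf \<mu> z * (E z x * r z x)) - pmf \<mu> x * (\<Sum>z\<in>UNIV. E x z * r x z)"
      unfolding R.\<beta>_def R.L'_def row_mult_def generator_def
      by (simp add: right_diff_distrib sum_subtractf if_distrib[of "(*) _"] cong: if_cong)
    also have "(\<Sum>z\<in>UNIV. pmf \<mu> z * (E z x * r z x)) = pmf \<mu> x * (\<Sum>z\<in>UNIV. E' x z * reversed_rate \<mu> r x z)"
      using \<mu>_pos[of x] by (simp add: sum_distrib_left reversed_rate_def E'_eq mult_ac)
    finally show ?thesis by (simp add: \<phi>_eq contraction_def right_diff_distrib)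
  qed
  have correlation: "(LINT w|N. h (Y s w) * \<phi> (Y 0 w)) = R.correlation_integrand h s" if "0 \<le> s" for h s
    using U.correlation[OF that, of h \<phi>] by (simp add: R.correlation_integrand_def \<beta>[symmetric] cong: sum.cong)
  have stationary: "(LINT w|N. h (Y s w)) = (\<Sum>x\<in>UNIV. h x * pmf \<mu> x)" if "0 \<le> s" for h s
    using U.expectation_at(2)[OF that, of h] R.invariant_flow[OF R.m_invariant that] by (simp add: U.law_def)
  have conv_int: "set_integrable lborel {0..} (\<lambda>s. \<tau> (t - s) * (LINT w|N. h (Y s w) * \<phi> (Y 0 w)))" for t h
    using R.correlation_convolution(1)[of t h] by (subst set_integrable_cong[OF refl refl]) (auto simp: correlation)
  have conv: "(LBINT s:{0..}. \<tau> (t - s) * (LINT w|N. h (Y s w) * \<phi> (Y 0 w))) = (\<Sum>y\<in>UNIV. h y * R.response t y)" for t h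
    unfolding R.correlation_convolution(2)[symmetric]
    by (rule set_lebesgue_integral_cong) (auto simp: correlation)
  have p_abs: "\<bar>p l s x\<bar> \<le> 1" if "s \<in> {0..t}" for l s x t
    using that p_nonneg[of s l x] p_le_1[of s l x] by auto
  have resp_meas: "set_borel_measurable lborel A (\<lambda>s. R.response s x)" if "A \<in> sets borel" for A x
    unfolding set_borel_measurable_def using that by measurable
  have p_mult: "set_integrable lborel {0..t} (\<lambda>s. p l s x * c s)" if "set_integrable lborel {0..t} c" for l t x and c :: "real \<Rightarrow> real"
    by (rule set_integrable_bounded_mult[OF that linear_flow_set_measurable[OF p_flow order_refl] p_abs])
  have resp_mult: "set_integrable lborel {0..t} (\<lambda>s. R.response s x * c s)" if "set_integrable lborel {0..t} c" for t x and c :: "real \<Rightarrow> real"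
    by (rule set_integrable_bounded_mult[OF that resp_meas CD]) simp

  show ?thesis
  proof (intro conjI, goal_cases)
  case 1
  show ?case
    by (simp add: response_potential_def g_eq \<phi>_eq contraction_def E'_eq right_diff_distrib sum_distrib_left sum_subtractf mult_ac)
  next
  case 2
  show ?case
  proof (intro allI impI conjI conv_int)
    fix v :: "'x \<Rightarrow> real" and t :: real assume t: "0 \<le> t"
    have "((\<lambda>l. p l t x) has_real_derivative R.response t x) (at 0)" for x
      unfolding has_real_derivative_iff_has_vector_derivative
      by (rule has_vector_derivative_quadratic[where a = "pmf \<mu> x" and C = C]) (use C t in auto)
    then have "((\<lambda>l. \<Sum>x\<in>UNIV. v x * p l t x) has_real_derivative (\<Sum>x\<in>UNIV. v x * R.response t x)) (at 0)"
      by (intro DERIV_sum DERIV_cmult)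
    then show "((\<lambda>l. LINT w|M l. v (X l t w)) has_real_derivative
          (LBINT s:{0..}. \<tau> (t - s) * (LINT w|N. v (Y s w) * \<phi> (Y 0 w)))) (at 0)"
      by (simp only: conv p_at(2)[OF t])
  qed
  next
  case 3
  show ?case
  proof (intro allI impI, goal_cases)
    case (1 v t)
    have t: "0 < t" by fact
    from 1 have v: "set_integrable lborel {0..t} (\<lambda>s. v s x)" for x by blast
    \<comment> \<open>The weight \<open>v s x\<close> is any integrable function of
      \<open>s\<close>, possibly unbounded; the uniformity in \<open>s\<close> of the expansion of
      \<open>p\<close> is what admits it.\<close>
    have "((\<lambda>l. LBINT s:{0..t}. p l s x * v s x) has_real_derivative (LBINT s:{0..t}. R.response s x * v s x)) (at 0)" for x
      by (rule has_real_derivative_weighted_integral[where a = "\<lambda>_. pmf \<mu> x" and C = C])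
         (use C in \<open>auto intro!: v p_mult resp_mult\<close>)
    then have "((\<lambda>l. \<Sum>x\<in>UNIV. LBINT s:{0..t}. p l s x * v s x) has_real_derivative
        (\<Sum>x\<in>UNIV. LBINT s:{0..t}. R.response s x * v s x)) (at 0)"
      by (rule DERIV_sum)
    moreover have "(LINT w|M l. (LBINT s:{0..t}. v s (X l s w))) = (\<Sum>x\<in>UNIV. LBINT s:{0..t}. p l s x * v s x)" for l
    proof -
      have "(LINT w|M l. (LBINT s:{0..t}. v s (X l s w))) = (LBINT s:{0..t}. (\<Sum>x\<in>UNIV. p l s x * v s x))"
        using jump_process.expectation_time_integral(2)[OF process v, folded p_def] by (simp only: mult.commute[of "v _ _"])
      also have "\<dots> = (\<Sum>x\<in>UNIV. LBINT s:{0..t}. p l s x * v s x)"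
        by (rule set_integral_sum) (rule p_mult[OF v])
      finally show ?thesis .
    qed
    ultimately have deriv: "((\<lambda>l. LINT w|M l. (LBINT s:{0..t}. v s (X l s w))) has_real_derivative
        (\<Sum>x\<in>UNIV. LBINT s:{0..t}. R.response s x * v s x)) (at 0)"
      by presburger
    have sum: "(\<Sum>x\<in>UNIV. LBINT s:{0..t}. R.response s x * v s x) = (LBINT u:{0..t}. (\<Sum>x\<in>UNIV. v u x * R.response u x))"
      by (subst set_integral_sum) (simp_all add: mult.commute[of "v _ _"] resp_mult v)
    show ?case
      unfolding conv
    proof (intro conjI allI ballI conv_int)
      show "integrable (M l) (\<lambda>w. LBINT s:{0..t}. v s (X l s w))" for l
        by (rule jump_process.expectation_time_integral(1)[OF process v])
      show "set_integrable lborel {0..t} (\<lambda>u. \<Sum>y\<in>UNIV. v u y * R.response u y)"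
        by (intro set_integrable_sum) (simp add: mult.commute[of "v _ _"] resp_mult v)
      show "((\<lambda>l. LINT w|M l. (LBINT s:{0..t}. v s (X l s w))) has_real_derivative
          (LBINT u:{0..t}. (\<Sum>y\<in>UNIV. v u y * R.response u y))) (at 0)"
        using deriv unfolding sum .
    qed
  qed
  next
  case 4
  show ?case
  proof (intro allI impI, goal_cases)
    case (1 \<alpha> t)
    have t: "0 < t" by fact
    from 1 have meas: "set_borel_measurable lborel {0..t} (\<lambda>s. \<alpha> s x y)" for x y by blast
    from 1 have int0: "set_integrable lborel {0..t} (\<lambda>s. contraction r (\<lambda>x y. \<bar>\<alpha> s x y\<bar>) x)" for x by blast
    \<comment> \<open>The assumption controls \<open>\<alpha>\<close> only after multiplication by
      the unperturbed rate, so this product is the weight; all dependence on \<open>l\<close> is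
      left in a bounded factor.\<close>
    define c where "c x y s = \<alpha> s x y * r x y" for x y s
    have c: "set_integrable lborel {0..t} (c x y)" for x y
    proof (rule set_integrable_bound[OF int0[of x]])
      have "(\<lambda>s. (indicator {0..t} s *\<^sub>R \<alpha> s x y) * r x y) \<in> borel_measurable lborel"
        using meas[of x y] unfolding set_borel_measurable_def by (intro borel_measurable_times) auto
      then show "set_borel_measurable lborel {0..t} (c x y)"
        by (simp add: set_borel_measurable_def c_def[abs_def] mult.assoc)
      have "\<bar>c x y s\<bar> \<le> \<bar>contraction r (\<lambda>x y. \<bar>\<alpha> s x y\<bar>) x\<bar>" for s
      proof -
        have "\<bar>c x y s\<bar> = \<bar>\<alpha> s x y\<bar> * r x y" by (simp add: c_def abs_mult r_nonneg)
        also have "\<dots> \<le> contraction r (\<lambda>x y. \<bar>\<alpha> s x y\<bar>) x"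
          unfolding contraction_def by (rule member_le_sum) (auto simp: r_nonneg)
        finally show ?thesis by linarith
      qed
      then show "AE s in lborel. s \<in> {0..t} \<longrightarrow> norm (c x y s) \<le> norm (contraction r (\<lambda>x y. \<bar>\<alpha> s x y\<bar>) x)"
        by simp
    qed
    \<comment> \<open>Jumps run over pairs of distinct states, contractions over all pairs; the
      vanishing diagonal reconciles the two sums.\<close>
    have c_diag: "c x x s = 0" for x s by (simp add: c_def r_diag)
    have \<tau>E: "set_integrable lborel {0..t} (\<lambda>s. \<tau> s * E x y * c x y s)" for x y
      by (rule set_integrable_bounded_mult[OF c _ R.exponent_bound])
         (auto simp: set_borel_measurable_def)
    have expE: "set_integrable lborel {0..t} (\<lambda>s. exp (l * (\<tau> s * E x y)) * c x y s)" for l x y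
    proof (rule set_integrable_bounded_mult[OF c])
      show "set_borel_measurable lborel {0..t} (\<lambda>s. exp (l * (\<tau> s * E x y)))"
        by (auto simp: set_borel_measurable_def)
      show "\<bar>exp (l * (\<tau> s * E x y))\<bar> \<le> exp (\<bar>l\<bar> * R.exponent_bound)" for s
        using R.exponent_bound[of s x y] by (simp add: abs_mult mult_left_mono order_trans[OF abs_ge_self, of "l * _"])
    qed
    have \<alpha>_rate: "\<alpha> s x y * R.rate l s x y = exp (l * (\<tau> s * E x y)) * c x y s" for s x y l
      by (simp add: R.rate_def perturbed_rate_def c_def)
    have \<alpha>_int: "set_integrable lborel {0..t} (\<lambda>s. \<alpha> s x y * R.rate l s x y)" for x y l
      unfolding \<alpha>_rate by (rule expE)
    note jump = jump_process.expectation_jump_sum[OF process t meas \<alpha>_int, folded p_def]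
    \<comment> \<open>The change of the law and the direct change of the rate, which become the two
      integrals in the formula for jump sums.\<close>
    let ?b = "\<lambda>x y s. R.response s x + pmf \<mu> x * (\<tau> s * E x y)"
    have b: "set_integrable lborel {0..t} (\<lambda>s. ?b x y s * c x y s)" for x y
      unfolding distrib_right mult.assoc
      using resp_mult[OF c] \<tau>E[of x y] by (intro set_integral_add(1)) (auto simp: mult.assoc)
    have "((\<lambda>l. LBINT s:{0..t}. (p l s x * exp (l * (\<tau> s * E x y))) * c x y s) has_real_derivative
        (LBINT s:{0..t}. ?b x y s * c x y s)) (at 0)" for x y
    proof (rule has_real_derivative_weighted_integral[where a = "\<lambda>_. pmf \<mu> x" and C = C'])
      show "set_integrable lborel {0..t} (\<lambda>s. (p l s x * exp (l * (\<tau> s * E x y))) * c x y s)" for l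
        unfolding mult.assoc by (rule p_mult[OF expE])
    qed (use C' in \<open>auto intro!: c b\<close>)
    then have "((\<lambda>l. \<Sum>x\<in>UNIV. \<Sum>y\<in>- {x}. LBINT s:{0..t}. (p l s x * exp (l * (\<tau> s * E x y))) * c x y s) has_real_derivative
        (\<Sum>x\<in>UNIV. \<Sum>y\<in>- {x}. LBINT s:{0..t}. ?b x y s * c x y s)) (at 0)"
      by (intro DERIV_sum)
    also have "(\<lambda>l. \<Sum>x\<in>UNIV. \<Sum>y\<in>- {x}. LBINT s:{0..t}. (p l s x * exp (l * (\<tau> s * E x y))) * c x y s)
        = (\<lambda>l. LINT w|M l. jump_sum \<alpha> t (\<lambda>s. X l s w))"
      by (simp add: jump(3) \<alpha>_rate mult.assoc)
    finally have deriv: "((\<lambda>l. LINT w|M l. jump_sum \<alpha> t (\<lambda>s. X l s w)) has_real_derivative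
        (\<Sum>x\<in>UNIV. \<Sum>y\<in>- {x}. LBINT s:{0..t}. ?b x y s * c x y s)) (at 0)" .
    have i1: "set_integrable lborel {0..t} (\<lambda>s. pmf \<mu> x * (\<tau> s * E x y * c x y s))" for x y
      using \<tau>E[of x y] by simp
    have i2: "set_integrable lborel {0..t} (\<lambda>s. R.response s x * c x y s)" for x y
      by (rule resp_mult[OF c])
    have first: "\<tau> s * (LINT w|N. contraction r (\<lambda>x y. \<alpha> s x y * E x y) (Y s w))
        = (\<Sum>x\<in>UNIV. \<Sum>y\<in>UNIV. pmf \<mu> x * (\<tau> s * E x y * c x y s))" if "s \<in> {0..t}" for s
      using stationary[of s "contraction r (\<lambda>x y. \<alpha> s x y * E x y)"] that
      by (simp add: contraction_def c_def sum_distrib_left sum_distrib_right mult_ac)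
    have second: "(\<Sum>x\<in>UNIV. contraction r (\<alpha> s) x * R.response s x) = (\<Sum>x\<in>UNIV. \<Sum>y\<in>UNIV. R.response s x * c x y s)" for s
      by (simp add: contraction_def c_def sum_distrib_left sum_distrib_right mult_ac)
    have int1: "set_integrable lborel {0..t} (\<lambda>s. \<tau> s * (LINT w|N. contraction r (\<lambda>x y. \<alpha> s x y * E x y) (Y s w)))"
      by (subst set_integrable_cong[OF refl refl first]) (auto intro!: set_integrable_sum i1)
    have int2: "set_integrable lborel {0..t} (\<lambda>s. \<Sum>x\<in>UNIV. contraction r (\<alpha> s) x * R.response s x)"
      unfolding second by (intro set_integrable_sum i2)
    have "(\<Sum>x\<in>UNIV. \<Sum>y\<in>- {x}. LBINT s:{0..t}. ?b x y s * c x y s)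
        = (\<Sum>x\<in>UNIV. \<Sum>y\<in>UNIV. LBINT s:{0..t}. ?b x y s * c x y s)"
      by (intro sum.cong refl sum.mono_neutral_left) (auto simp: c_diag)
    also have "\<dots> = (\<Sum>x\<in>UNIV. \<Sum>y\<in>UNIV. (LBINT s:{0..t}. pmf \<mu> x * (\<tau> s * E x y * c x y s)) + (LBINT s:{0..t}. R.response s x * c x y s))"
      by (subst set_integral_add(2)[OF i1 i2, symmetric]) (simp add: algebra_simps)
    also have "\<dots> = (LBINT s:{0..t}. (\<Sum>x\<in>UNIV. \<Sum>y\<in>UNIV. pmf \<mu> x * (\<tau> s * E x y * c x y s)))
        + (LBINT s:{0..t}. (\<Sum>x\<in>UNIV. \<Sum>y\<in>UNIV. R.response s x * c x y s))"
      by (simp add: set_integral_sum[OF set_integrable_sum[OF i1]] set_integral_sum[OF i1]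
          set_integral_sum[OF set_integrable_sum[OF i2]] set_integral_sum[OF i2] sum.distrib del: set_integral_mult_right)
    also have "(LBINT s:{0..t}. (\<Sum>x\<in>UNIV. \<Sum>y\<in>UNIV. pmf \<mu> x * (\<tau> s * E x y * c x y s)))
        = (LBINT s:{0..t}. \<tau> s * (LINT w|N. contraction r (\<lambda>x y. \<alpha> s x y * E x y) (Y s w)))"
      by (rule set_lebesgue_integral_cong) (simp_all add: first)
    finally have sum: "(\<Sum>x\<in>UNIV. \<Sum>y\<in>- {x}. LBINT s:{0..t}. ?b x y s * c x y s)
        = (LBINT s:{0..t}. \<tau> s * (LINT w|N. contraction r (\<lambda>x y. \<alpha> s x y * E x y) (Y s w)))
        + (LBINT s:{0..t}. (\<Sum>x\<in>UNIV. contraction r (\<alpha> s) x * R.response s x))"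
      unfolding second .
    show ?case
      unfolding conv
    proof (intro conjI allI ballI conv_int)
      show "integrable (M l) (\<lambda>w. jump_sum \<alpha> t (\<lambda>s. X l s w))" for l by (rule jump(1))
    qed (use int1 int2 deriv[unfolded sum] in blast)+
  qed
  next
  case 5
  show ?case
  proof (intro allI impI, goal_cases)
    case (1 v k f)
    have f: "f l t = (\<Sum>x\<in>UNIV. v x * p l t x)" if "0 \<le> t" for l t
      using 1 that p_at(2)[OF that] by simp
    let ?e = "\<lambda>s. exp (- \<i> * of_int k * of_real (2 * pi / T) * of_real s)"
    \<comment> \<open>Normalisation and character together form a bounded complex weight, so the
      Fourier coefficient is a weighted integral of the real function \<open>f l\<close>.\<close>
    let ?c = "\<lambda>s. (1 / of_real T) * ?e s"
    let ?m = "\<Sum>x\<in>UNIV. v x * pmf \<mu> x" and ?b = "\<lambda>t. \<Sum>x\<in>UNIV. v x * R.response t x"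
    have coeff: "fourier_coeff T k h = (LBINT t:{0..T}. h t *\<^sub>R ?c t)" for h
      unfolding fourier_coeff_def by (simp add: scaleR_conv_of_real mult_ac flip: set_integral_mult_right)
    have weighted: "set_integrable lborel {0..T} (\<lambda>s. h s *\<^sub>R ?c s)" if "set_integrable lborel {0..T} h" for h :: "real \<Rightarrow> real"
    proof (rule set_integrable_bound)
      show "set_integrable lborel {0..T} (\<lambda>s. (1 / T) * h s)" using that by simp
      have "?c \<in> borel_measurable lborel"
        unfolding measurable_lborel2 by (intro borel_measurable_continuous_onI continuous_intros)
      moreover have "(\<lambda>s. indicator {0..T} s *\<^sub>R h s) \<in> borel_measurable lborel"
        using that unfolding set_integrable_def by (rule borel_measurable_integrable)
      ultimately have "(\<lambda>s. (indicator {0..T} s *\<^sub>R h s) *\<^sub>R ?c s) \<in> borel_measurable lborel"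
        by (rule borel_measurable_scaleR[rotated])
      then show "set_borel_measurable lborel {0..T} (\<lambda>s. h s *\<^sub>R ?c s)"
        by (simp add: set_borel_measurable_def)
      show "AE s in lborel. s \<in> {0..T} \<longrightarrow> norm (h s *\<^sub>R ?c s) \<le> norm ((1 / T) * h s)"
        using T_pos by (simp add: norm_mult norm_divide norm_exp_eq_Re)
    qed
    have vp: "set_integrable lborel {0..T} (\<lambda>s. \<Sum>x\<in>UNIV. v x * p l s x)" for l
      using p_mult[OF set_integrable_const_Icc] by (intro set_integrable_sum) (simp add: mult.commute)
    have f_int: "set_integrable lborel {0..T} (f l)" for l
      using vp[of l] by (subst set_integrable_cong[OF refl refl f]) auto
    have b_int: "set_integrable lborel {0..T} ?b"
      using resp_mult[OF set_integrable_const_Icc] by (intro set_integrable_sum) (simp add: mult.commute)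
    have "((\<lambda>l. LBINT t:{0..T}. f l t *\<^sub>R ?c t) has_vector_derivative (LBINT t:{0..T}. ?b t *\<^sub>R ?c t)) (at 0)"
    proof (rule has_vector_derivative_weighted_integral[where a = "\<lambda>_. ?m" and C = "C * (\<Sum>x\<in>UNIV. \<bar>v x\<bar>)"])
      show "set_integrable lborel {0..T} ?c"
        using weighted[OF set_integrable_const_Icc[of 0 T 1]] by simp
      fix l s :: real assume l: "\<bar>l\<bar> \<le> 1" and s: "s \<in> {0..T}"
      have "f l s - ?m - l * ?b s = (\<Sum>x\<in>UNIV. v x * (p l s x - pmf \<mu> x - l * R.response s x))"
        using s by (simp add: f right_diff_distrib sum_subtractf sum_distrib_left mult_ac)
      also have "\<bar>\<dots>\<bar> \<le> (\<Sum>x\<in>UNIV. \<bar>v x\<bar> * (C * l\<^sup>2))"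
        by (rule order_trans[OF sum_abs sum_mono]) (use C[OF l] s in \<open>auto simp: abs_mult intro!: mult_left_mono\<close>)
      also have "\<dots> = C * (\<Sum>x\<in>UNIV. \<bar>v x\<bar>) * l\<^sup>2"
        by (simp add: sum_distrib_left sum_distrib_right mult_ac)
      finally show "\<bar>f l s - ?m - l * ?b s\<bar> \<le> C * (\<Sum>x\<in>UNIV. \<bar>v x\<bar>) * l\<^sup>2" .
    qed (intro weighted f_int b_int set_integrable_const_Icc)+
    then have deriv: "((\<lambda>l. fourier_coeff T k (f l)) has_vector_derivative fourier_coeff T k ?b) (at 0)"
      unfolding coeff .
    have corr_int: "set_integrable lborel {0..} (\<lambda>s. ?e s * complex_of_real (LINT w|N. v (Y s w) * \<phi> (Y 0 w)))"
      using R.fourier_response(1)[of k v] by (subst set_integrable_cong[OF refl refl]) (auto simp: correlation)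
    have corr: "(LBINT s:{0..}. ?e s * complex_of_real (LINT w|N. v (Y s w) * \<phi> (Y 0 w)))
        = (LBINT s:{0..}. ?e s * complex_of_real (R.correlation_integrand v s))"
      by (rule set_lebesgue_integral_cong) (auto simp: correlation)
    have periodic: "f l (t + T) = f l t" if "0 \<le> t" for l t
      using that T_pos by (simp add: f p_periodic)
    show ?case
      using periodic f_int corr_int deriv unfolding corr R.fourier_response(2) by blast
  qed
  qed
qed

end
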